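(* Let $K$ be a field of characteristic zero, $S=K[x_1,x_2,x_3]$, and let $d_1,d_2,d_3$ be positive integers. For a generic sequence $f_1,f_2,f_3$ of homogeneous polynomials of degrees $d_1,d_2,d_3$, the initial ideal of $(f_1,f_2,f_3)$ with respect to the reverse lexicographic order is an almost reverse lexicographic ideal; that is, there is a nonempty Zariski open subset $U\subset S_{d_1}\times S_{d_2}\times S_{d_3}$ such that for every $(f_1,f_2,f_3)\in U$ the initial ideal $J$ of $I=(f_1,f_2,f_3)$ with respect to the reverse lexicographic order has the following property: if $u$ is a minimal monomial generator of $J$, then every monomial of the same degree which precedes $u$ is in $J$ as well.
   Context: $S_d$ denotes the vector space of homogeneous polynomials of degree $d$ in $S$. The monomial order is the graded reverse lexicographic order with $x_1>x_2>x_3$; a monomial precedes $u$ if it is larger than $u$ in this order. *)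

theory Defs
  imports "HOL-Analysis.Analysis" "HOL-Library.Poly_Mapping"
begin

section \<open>Polynomials, homogeneous polynomials, ideals\<close>

text \<open>A monomial is its exponent vector, so the product of monomials is written \<open>+\<close>.
  The variables are indexed by a finite linearly ordered type; for three variables this is the
  type \<^typ>\<open>3\<close>, whose elements are \<open>0 < 1 < 2\<close>. The numeral \<open>3 :: 3\<close> equals \<open>0\<close>, so
  \<open>x\<^sub>1, x\<^sub>2, x\<^sub>3\<close> are the variables with index \<open>0, 1, 2\<close>.\<close>

type_synonym 'v monom = "'v \<Rightarrow>\<^sub>0 nat"
type_synonym ('v, 'k) mpoly = "'v monom \<Rightarrow>\<^sub>0 'k"

definition mono_deg :: "'v::finite monom \<Rightarrow> nat" where
  "mono_deg u = (\<Sum>i\<in>UNIV. Poly_Mapping.lookup u i)"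

definition of_monom :: "'v monom \<Rightarrow> ('v, 'k::zero_neq_one) mpoly" where
  "of_monom u = Poly_Mapping.single u 1"

definition homogeneous :: "nat \<Rightarrow> ('v::finite, 'k::zero) mpoly set" where
  "homogeneous d = {f. \<forall>u\<in>Poly_Mapping.keys f. mono_deg u = d}"

text \<open>The ideal generated by a set is its span in the ring regarded as a module over itself.\<close>

interpretation ideal: module "(*) :: 'a::comm_ring_1 \<Rightarrow> 'a \<Rightarrow> 'a"
  by standard (simp_all add: algebra_simps)

abbreviation ideal_gen :: "'a::comm_ring_1 set \<Rightarrow> 'a set" where
  "ideal_gen \<equiv> module.span (*)"

section \<open>Graded reverse lexicographic order and initial ideals\<close>

text \<open>For monomials of equal degree, \<open>v\<close> is smaller than \<open>u\<close> iff in the last variable in which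
  the exponents differ, \<open>v\<close> has the larger exponent. A smaller index is a larger variable.
  This is unrelated to the \<^class>\<open>linorder\<close> instance of \<^type>\<open>poly_mapping\<close>.\<close>

definition grevlex_less :: "'v::{finite,linorder} monom \<Rightarrow> 'v monom \<Rightarrow> bool" where
  "grevlex_less v u \<longleftrightarrow>
     mono_deg v < mono_deg u \<or>
     mono_deg v = mono_deg u \<and>
       (\<exists>i. Poly_Mapping.lookup v i > Poly_Mapping.lookup u i \<and>
          (\<forall>j>i. Poly_Mapping.lookup v j = Poly_Mapping.lookup u j))"

definition is_initial_monom ::
  "('v::{finite,linorder}, 'k::zero) mpoly \<Rightarrow> 'v monom \<Rightarrow> bool" where
  "is_initial_monom f u \<longleftrightarrow> u \<in> Poly_Mapping.keys f \<and>
     (\<forall>v\<in>Poly_Mapping.keys f. v \<noteq> u \<longrightarrow> grevlex_less v u)"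

definition initial_ideal ::
  "('v::{finite,linorder}, 'k::comm_ring_1) mpoly set \<Rightarrow> ('v, 'k) mpoly set" where
  "initial_ideal I = ideal_gen (of_monom ` {u. \<exists>f\<in>I. is_initial_monom f u})"

section \<open>Almost reverse lexicographic ideals\<close>

definition monom_gens :: "'v monom set \<Rightarrow> ('v, 'k::comm_ring_1) mpoly set \<Rightarrow> bool" where
  "monom_gens G J \<longleftrightarrow> ideal_gen (of_monom ` G) = J"

text \<open>A monomial ideal has exactly one minimal set of monomial generators.\<close>

definition minimal_monom_gen :: "('v, 'k::comm_ring_1) mpoly set \<Rightarrow> 'v monom \<Rightarrow> bool" where
  "minimal_monom_gen J u \<longleftrightarrow>
     (\<exists>G. u \<in> G \<and> monom_gens G J \<and> (\<forall>H. H \<subset> G \<longrightarrow> \<not> monom_gens H J))"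

definition almost_revlex_ideal ::
  "('v::{finite,linorder}, 'k::comm_ring_1) mpoly set \<Rightarrow> bool" where
  "almost_revlex_ideal J \<longleftrightarrow>
     (\<exists>G. monom_gens G J) \<and>
     (\<forall>u v. minimal_monom_gen J u \<and> mono_deg v = mono_deg u \<and> grevlex_less u v
        \<longrightarrow> of_monom v \<in> J)"

section \<open>The Zariski topology on families of polynomials\<close>

definition homogeneous_families ::
  "('i \<Rightarrow> nat) \<Rightarrow> ('i \<Rightarrow> ('v::finite, 'k::zero) mpoly) set" where
  "homogeneous_families d = {f. \<forall>i. f i \<in> homogeneous (d i)}"

definition eval_poly :: "('c, 'k::comm_ring_1) mpoly \<Rightarrow> ('c \<Rightarrow> 'k) \<Rightarrow> 'k" where
  "eval_poly p a = (\<Sum>m\<in>Poly_Mapping.keys p.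
     Poly_Mapping.lookup p m *
     (\<Prod>c\<in>Poly_Mapping.keys m. a c ^ Poly_Mapping.lookup m c))"

text \<open>The coordinates of a family \<open>f\<close> are the coefficients of \<open>f i\<close> at the monomials \<open>u\<close>,
  indexed by the pairs \<open>(i, u)\<close>. On \<^term>\<open>homogeneous_families d\<close> all coordinates except the
  finitely many with \<open>u\<close> of degree \<open>d i\<close> vanish, so the further variables allowed in the
  defining equations have no effect there.\<close>

definition coeffs_of :: "('i \<Rightarrow> ('v, 'k::zero) mpoly) \<Rightarrow> 'i \<times> 'v monom \<Rightarrow> 'k" where
  "coeffs_of f = (\<lambda>(i, u). Poly_Mapping.lookup (f i) u)"

definition zariski_open_in ::
  "('i \<Rightarrow> ('v, 'k::comm_ring_1) mpoly) set \<Rightarrow> ('i \<Rightarrow> ('v, 'k) mpoly) set \<Rightarrow> bool" where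
  "zariski_open_in V U \<longleftrightarrow>
     (\<exists>P :: ('i \<times> 'v monom, 'k) mpoly set.
        U = V - {f. \<forall>p\<in>P. eval_poly p (coeffs_of f) = 0})"

end

theory Submission
  imports Defs
begin

text \<open>Write \<open>Q\<^sub>e(f)\<close> for the part of degree \<open>e\<close> of the ideal \<open>I = (f\<^sub>1, f\<^sub>2, f\<^sub>3)\<close> and \<open>A = S/I\<close>. There
is a nonempty open set \<open>U\<close> of families \<open>f\<close> at which, for every degree \<open>e\<close> up to a fixed bound and
every set \<open>W\<close> of monomials of degree \<open>e\<close>, the dimension of \<open>Q\<^sub>e(f) + span W\<close> is as large as it is for
any family, and likewise for the ideals generated by some of the \<open>f\<^sub>i\<close>. Each of these finitely many
conditions is implied by the nonvanishing of a polynomial in the coefficients that is nonzero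
somewhere, and the field is infinite (\<open>generic_ranks_maximal\<close>). For \<open>f\<close> in \<open>U\<close> two facts follow by
comparing \<open>f\<close> with well-chosen other families.

\<^bold>\<open>Multiplication by powers of \<open>x\<^sub>3\<close> has maximal rank on \<open>A\<close>\<close> (\<open>generic_lefschetz\<close>). By
comparison with \<open>x\<^sub>i ^ d\<^sub>i\<close>, the Hilbert function of \<open>f\<close> is that of a complete intersection
(\<open>generic_hilbert_function\<close>). The algebra \<open>S/(x\<^sub>i ^ d\<^sub>i)\<close> has the strong Lefschetz property with respect to
\<open>L = x\<^sub>1 + x\<^sub>2 + x\<^sub>3\<close>: multiplication by \<open>L\<close> and a suitable lowering operator generate an action of the
Lie algebra \<open>sl\<^sub>2\<close>, which forces \<open>L ^ (N - 2 j)\<close> to be injective from degree \<open>j\<close> to degree \<open>N - j\<close>, with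
\<open>N\<close> the sum of the \<open>d\<^sub>i - 1\<close> (\<open>lefschetz_middle\<close>). A linear change of coordinates that takes \<open>L\<close> to
\<open>x\<^sub>3\<close> yields a family for which \<open>x\<^sub>3\<close> has the property, and maximality of ranks passes it on to \<open>f\<close>.

\<^bold>\<open>The initial monomials are stable under replacing \<open>x\<^sub>2\<close> by \<open>x\<^sub>1\<close>\<close> (\<open>initial_monoms_stable\<close>). This is
the part of the Borel-fixedness of generic initial ideals that matters here. Fix the degree \<open>e\<close> and
the exponent \<open>c\<close> of \<open>x\<^sub>3\<close>. The elements of \<open>Q\<^sub>e(f)\<close> divisible by \<open>x\<^sub>3 ^ c\<close>, taken modulo \<open>x\<^sub>3 ^ (c + 1)\<close> and with
\<open>x\<^sub>1 = 1\<close>, form a space of univariate polynomials of some dimension \<open>k\<close>. In characteristic zero, at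
all but finitely many points \<open>t\<close> no nonzero element of it vanishes to order \<open>k\<close>
(\<open>finite_excess_vanishing\<close>, a form of the nonvanishing of the Wronskian). After a substitution
\<open>x\<^sub>2 \<mapsto> x\<^sub>2 + t x\<^sub>1\<close> the orders of vanishing at \<open>0\<close> are thus \<open>0, \<dots>, k - 1\<close>, and comparison of \<open>f\<close>
with the substituted family shows that this already holds for \<open>f\<close>.

Now let \<open>u\<close> be a minimal generator of the initial ideal, of degree \<open>e\<close> and with exponent \<open>c\<close> of
\<open>x\<^sub>3\<close>, and let \<open>v\<close> be a larger monomial of the same degree. If \<open>e > N\<close>, then \<open>I\<close> contains all forms of
degree \<open>e\<close>. Otherwise, if \<open>v\<close> also has exponent \<open>c\<close>, then stability
applies. If \<open>v\<close> has a smaller exponent of \<open>x\<^sub>3\<close>, write a polynomial of \<open>I\<close> with initial monomial \<open>u\<close> as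
\<open>x\<^sub>3 ^ c g\<close>. Minimality of \<open>u\<close> gives \<open>g \<notin> I\<close>, so that \<open>x\<^sub>3 ^ c\<close> is not injective from degree \<open>e - c\<close> to degree \<open>e\<close> of
\<open>A\<close>. Hence it is surjective, so \<open>v\<close> is congruent modulo \<open>I\<close> to a multiple of \<open>x\<^sub>3 ^ c\<close>, all of whose
monomials are smaller than \<open>v\<close> (\<open>ranks_maximal_imp_almost_revlex\<close>).\<close>

section \<open>Dimension of finitely generated subspaces\<close>

text \<open>As a simplification rule, \<open>a * (b * x) = (a * b) * x\<close> runs against \<open>mult.assoc\<close> and makes
normalization with \<open>algebra_simps\<close> loop.\<close>

declare ideal.scale_scale [simp del]

text \<open>A vector space that need not be finite-dimensional, in which dimensions of finitely generated
subspaces are compared.\<close>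

locale dimension_space = vector_space
begin

text \<open>A set is finite-dimensional if finitely many vectors span it. They need not lie in the set.\<close>

definition fin_dim :: "'b set \<Rightarrow> bool" where
  "fin_dim V \<longleftrightarrow> (\<exists>B. finite B \<and> V \<subseteq> span B)"

lemma fin_dim_subset: "fin_dim W \<Longrightarrow> V \<subseteq> W \<Longrightarrow> fin_dim V"
  unfolding fin_dim_def by blast

lemma fin_dim_span: "finite B \<Longrightarrow> fin_dim (span B)"
  unfolding fin_dim_def by blast

lemma fin_dim_independent:
  assumes "fin_dim V" "independent B" "B \<subseteq> V"
  shows "finite B \<and> card B \<le> dim V"
proof -
  obtain A where A: "finite A" "V \<subseteq> span A" using assms(1) unfolding fin_dim_def by blast
  have fB: "finite B" using independent_span_bound[OF A(1) assms(2)] A(2) assms(3) by blast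
  obtain C where C: "B \<subseteq> C" "C \<subseteq> V" "independent C" "V \<subseteq> span C"
    using maximal_independent_subset_extend[OF assms(3,2)] by blast
  have "finite C" using independent_span_bound[OF A(1) C(3)] A(2) C(2) by blast
  then have "card B \<le> card C" using C(1) by (rule card_mono)
  also have "card C = dim V" using C by (intro basis_card_eq_dim) auto
  finally show ?thesis using fB by blast
qed

lemma fin_dim_basis:
  assumes "fin_dim V" "subspace V"
  obtains B where "finite B" "B \<subseteq> V" "independent B" "span B = V" "card B = dim V"
proof -
  obtain B where B: "B \<subseteq> V" "independent B" "V \<subseteq> span B" "card B = dim V"
    using basis_exists by blast
  have "span B = V" using B assms(2) by (intro span_subspace) auto
  then show ?thesis using that B fin_dim_independent[OF assms(1) B(2,1)] by blast
qed

lemma fin_dim_dim_mono: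
  assumes "fin_dim W" "V \<subseteq> W"
  shows "dim V \<le> dim W"
proof -
  obtain B where B: "B \<subseteq> V" "independent B" "V \<subseteq> span B" "card B = dim V"
    using basis_exists by blast
  then show ?thesis using fin_dim_independent[OF assms(1) B(2)] assms(2) by fastforce
qed

lemma fin_dim_subspace_eq:
  assumes "fin_dim W" "subspace V" "subspace W" "V \<subseteq> W" "dim W \<le> dim V"
  shows "V = W"
proof -
  obtain B where B: "finite B" "B \<subseteq> V" "independent B" "span B = V" "card B = dim V"
    using fin_dim_basis fin_dim_subset assms by metis
  obtain C where C: "B \<subseteq> C" "C \<subseteq> W" "independent C" "W \<subseteq> span C"
    using maximal_independent_subset_extend[of B W] B assms(4) by blast
  have "finite C" "card C \<le> dim W" using fin_dim_independent[OF assms(1) C(3,2)] by auto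
  then have "B = C" using card_subset_eq[OF _ C(1)] card_mono[OF _ C(1)] B(5) assms(5) by simp
  then show ?thesis using B(4) C(4) assms(4) by blast
qed

text \<open>Rank and nullity of the map \<open>Y \<rightarrow> V/X\<close> induced by \<open>T\<close>. All dimension counts below are
instances: \<open>T\<close> is the identity, an injective map, or multiplication by a polynomial.\<close>

lemma dim_sum_image:
  assumes T: "Vector_Spaces.linear scale scale T"
    and X: "subspace X" "fin_dim X" and Y: "subspace Y" "fin_dim Y"
  shows "dim {x + T y | x y. x \<in> X \<and> y \<in> Y} + dim {y \<in> Y. T y \<in> X} = dim X + dim Y"
proof -
  interpret T: Vector_Spaces.linear scale scale T by (rule T)
  define K where "K = {y \<in> Y. T y \<in> X}"
  have K: "subspace K" unfolding K_def
    using X(1) Y(1) by (auto simp: subspace_def T.add T.scale)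
  have fK: "fin_dim K" by (rule fin_dim_subset[OF Y(2)]) (auto simp: K_def)
  obtain BK where BK: "finite BK" "BK \<subseteq> K" "independent BK" "span BK = K" "card BK = dim K"
    using fin_dim_basis[OF fK K] by blast
  obtain BX where BX: "finite BX" "BX \<subseteq> X" "independent BX" "span BX = X" "card BX = dim X"
    using fin_dim_basis[OF X(2,1)] by blast
  have KY: "K \<subseteq> Y" by (auto simp: K_def)
  obtain BY where BY: "BK \<subseteq> BY" "BY \<subseteq> Y" "independent BY" "Y \<subseteq> span BY"
    using maximal_independent_subset_extend[of BK Y] BK KY by blast
  have fBY: "finite BY" using fin_dim_independent[OF Y(2) BY(3,2)] by blast
  have cBY: "card BY = dim Y" using BY by (intro basis_card_eq_dim)
  have sBY: "span BY = Y" using BY Y(1) by (intro span_subspace)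
  define C where "C = BY - BK"
  have fC: "finite C" using fBY by (simp add: C_def)
  \<comment> \<open>The images of the basis vectors of a complement of the kernel are added one by one.\<close>
  have step: "\<exists>B. finite B \<and> independent B \<and> span B = span (BX \<union> T ` C') \<and> card B = card BX + card C'"
    if "C' \<subseteq> C" "finite C'" for C'
    using that(2,1)
  proof (induction C')
    case empty
    then show ?case using BX by (intro exI[of _ BX]) auto
  next
    case (insert y C')
    then obtain B where B: "finite B" "independent B" "span B = span (BX \<union> T ` C')"
      "card B = card BX + card C'" by auto
    have "T y \<notin> span B"
    proof
      assume "T y \<in> span B"
      then obtain x z where z: "x \<in> X" "z \<in> span (T ` C')" "T y = x + z"
        unfolding B(3) span_Un BX(4) by blast
      then obtain c where c: "c \<in> span C'" "z = T c" using T.span_image by blast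
      have "y \<in> Y" "c \<in> Y" using insert.prems BY(2) c(1) sBY span_mono[of C' BY]
        by (auto simp: C_def)
      moreover have "T (y - c) \<in> X" using z c by (simp add: T.diff)
      ultimately have "y - c \<in> span BK" using Y(1) subspace_diff by (auto simp: BK(4) K_def)
      then have "y - c \<in> span (BK \<union> C')" "c \<in> span (BK \<union> C')"
        using c(1) span_mono[of BK "BK \<union> C'"] span_mono[of C' "BK \<union> C'"] by auto
      then have "(y - c) + c \<in> span (BK \<union> C')" by (rule span_add)
      then have "y \<in> span (BK \<union> C')" by simp
      moreover have "BK \<union> C' \<subseteq> BY - {y}" "y \<in> BY" using insert BY(1) by (auto simp: C_def)
      ultimately show False using BY(3) span_mono[of "BK \<union> C'" "BY - {y}"] unfolding dependent_def by blast
    qed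
    then have "independent (insert (T y) B)" "T y \<notin> B"
      using B independent_insertI span_base by auto
    moreover have "span (insert (T y) B) = span (BX \<union> T ` insert y C')"
    proof -
      have "span (insert (T y) B) = span ({T y} \<union> B)" by simp
      also have "\<dots> = span ({T y} \<union> (BX \<union> T ` C'))" unfolding span_Un B(3) ..
      finally show ?thesis by (simp add: insert_commute)
    qed
    ultimately show ?case using B insert by (intro exI[of _ "insert (T y) B"]) auto
  qed
  obtain B where B: "finite B" "independent B" "span B = span (BX \<union> T ` C)" "card B = card BX + card C"
    using step[of C] fC by blast
  have "{x + T y | x y. x \<in> X \<and> y \<in> Y} = span B" (is "?Z = _")
  proof
    show "span B \<subseteq> ?Z" unfolding B(3) span_Un BX(4) T.span_image
      using span_mono[of C BY] sBY by (auto simp: C_def)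
    show "?Z \<subseteq> span B"
    proof safe
      fix x y assume xy: "x \<in> X" "y \<in> Y"
      have "BY = BK \<union> C" using BY(1) by (auto simp: C_def)
      then obtain k c where kc: "k \<in> K" "c \<in> span C" "y = k + c"
        using xy(2) sBY span_Un[of BK C] BK(4) by auto
      have "x + T k \<in> X" using kc(1) xy(1) X(1) subspace_add by (auto simp: K_def)
      moreover have "x + T y = (x + T k) + T c" using kc(3) by (simp add: T.add algebra_simps)
      moreover have "T c \<in> span (T ` C)" using kc(2) T.span_image by blast
      ultimately show "x + T y \<in> span B" unfolding B(3) span_Un BX(4) by blast
    qed
  qed
  then have "dim ?Z = card BX + card C" using dim_span_eq_card_independent[OF B(2)] B(4) by simp
  moreover have "card BY = card BK + card C"
    using card_Diff_subset[OF BK(1) BY(1)] card_mono[OF fBY BY(1)] by (simp add: C_def)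
  ultimately show ?thesis unfolding K_def[symmetric] using BX(5) BK(5) cBY by linarith
qed

lemma subspace_sum_image:
  assumes T: "Vector_Spaces.linear scale scale T" and X: "subspace X" and Y: "subspace Y"
  shows "subspace {x + T y | x y. x \<in> X \<and> y \<in> Y}"
proof -
  interpret T: Vector_Spaces.linear scale scale T by (rule T)
  have "subspace {x + z | x z. x \<in> X \<and> z \<in> T ` Y}"
    by (rule subspace_sums[OF X T.subspace_image[OF Y]])
  moreover have "{x + z | x z. x \<in> X \<and> z \<in> T ` Y} = {x + T y | x y. x \<in> X \<and> y \<in> Y}" by blast
  ultimately show ?thesis by simp
qed

lemma dim_sum_inter:
  assumes X: "subspace X" "fin_dim X" and Y: "subspace Y" "fin_dim Y"
  shows "dim {x + y | x y. x \<in> X \<and> y \<in> Y} + dim (X \<inter> Y) = dim X + dim Y"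
proof -
  have "Vector_Spaces.linear scale scale (\<lambda>x. x)"
    by (simp add: Vector_Spaces.linear_iff vector_space_axioms)
  from dim_sum_image[OF this assms] show ?thesis by (simp add: Int_def conj_commute)
qed

lemma dim_image_inj:
  assumes T: "Vector_Spaces.linear scale scale T" "inj_on T Y" and Y: "subspace Y" "fin_dim Y"
  shows "dim (T ` Y) = dim Y"
proof -
  interpret T: Vector_Spaces.linear scale scale T by (rule T)
  have "fin_dim {0}" unfolding fin_dim_def by (intro exI[of _ "{}"]) auto
  from dim_sum_image[OF T(1) subspace_single_0 this Y]
  have "dim {x + T y | x y. x \<in> {0} \<and> y \<in> Y} + dim {y \<in> Y. T y \<in> {0}} = dim {0} + dim Y" .
  moreover have "{x + T y | x y. x \<in> {0} \<and> y \<in> Y} = T ` Y" by auto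
  moreover have "{y \<in> Y. T y \<in> {0}} = {0}"
  proof -
    have "y = 0" if "y \<in> Y" "T y = 0" for y
      using inj_onD[OF T(2), of y 0] that subspace_0[OF Y(1)] T.zero by simp
    then show ?thesis using subspace_0[OF Y(1)] T.zero by auto
  qed
  ultimately show ?thesis by simp
qed

end

section \<open>Polynomials as a vector space; substitution\<close>

abbreviation lookup where "lookup \<equiv> Poly_Mapping.lookup"
abbreviation keys where "keys \<equiv> Poly_Mapping.keys"

lemma mpoly_sum_monom: "(\<Sum>u\<in>keys p. Poly_Mapping.single u (lookup p u)) = p"
  by (intro poly_mapping_eqI)
    (auto simp: lookup_sum lookup_single when_def sum.delta in_keys_iff)

lemma mpoly_induct [case_names zero add]:
  assumes "P 0" "\<And>p u c. P p \<Longrightarrow> P (Poly_Mapping.single u c + p)"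
  shows "P (p :: 'a \<Rightarrow>\<^sub>0 'b::comm_monoid_add)"
proof -
  have "P (\<Sum>u\<in>A. Poly_Mapping.single u (lookup p u))" if "finite A" for A
    using that by induction (auto intro: assms)
  from this[of "keys p"] show ?thesis by (simp add: mpoly_sum_monom)
qed

lemma lookup_single_mult:
  fixes p :: "('v, 'k::comm_ring_1) mpoly"
  shows "lookup (Poly_Mapping.single u c * p) (u + w) = c * lookup p w"
  by (induction p rule: mpoly_induct)
    (auto simp: distrib_left lookup_add mult_single lookup_single when_def)

lemma lookup_single_mult_0:
  fixes p :: "('v, 'k::comm_ring_1) mpoly"
  assumes "\<nexists>z. w = u + z"
  shows "lookup (Poly_Mapping.single u c * p) w = 0"
proof -
  have "w \<notin> keys (Poly_Mapping.single u c * p)"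
    using keys_mult[of "Poly_Mapping.single u c" p] assms by (auto split: if_splits)
  then show ?thesis by (simp add: in_keys_iff)
qed

lemma monom_dvd_iff:
  fixes u w :: "'v monom"
  shows "(\<exists>z. w = u + z) \<longleftrightarrow> (\<forall>i. lookup u i \<le> lookup w i)"
proof
  assume "\<forall>i. lookup u i \<le> lookup w i"
  then have "w = u + (w - u)"
    by (intro poly_mapping_eqI) (simp add: lookup_add lookup_minus)
  then show "\<exists>z. w = u + z" by blast
qed (auto simp: lookup_add)

lemma mono_deg_add: "mono_deg (u + v) = mono_deg u + mono_deg v"
  by (simp add: mono_deg_def lookup_add sum.distrib)

lemma mono_deg_0 [simp]: "mono_deg 0 = 0"
  by (simp add: mono_deg_def)

lemma mono_deg_single [simp]: "mono_deg (Poly_Mapping.single i n) = n"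
  by (simp add: mono_deg_def lookup_single when_def)

lemma finite_mono_deg: "finite {u :: 'v::finite monom. mono_deg u \<le> e}"
proof -
  have "lookup ` {u :: 'v monom. mono_deg u \<le> e} \<subseteq> (UNIV \<rightarrow>\<^sub>E {..e})"
  proof safe
    fix u :: "'v monom" and i assume "mono_deg u \<le> e"
    moreover have "lookup u i \<le> mono_deg u" unfolding mono_deg_def by (rule member_le_sum) auto
    ultimately show "lookup u i \<le> e" by linarith
  qed auto
  moreover have "finite ((UNIV :: 'v set) \<rightarrow>\<^sub>E {..e})" by (intro finite_PiE) auto
  ultimately have "finite (lookup ` {u :: 'v monom. mono_deg u \<le> e})" by (rule finite_subset)
  then show ?thesis by (rule finite_imageD) (auto intro!: inj_onI poly_mapping_eqI dest: fun_cong)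
qed

lemma finite_mono_deg_eq: "finite {u :: 'v::finite monom. mono_deg u = e}"
  by (rule finite_subset[OF _ finite_mono_deg[of e]]) auto

text \<open>Scalar multiplication of polynomials.\<close>

definition smul :: "'k::comm_ring_1 \<Rightarrow> ('v, 'k) mpoly \<Rightarrow> ('v, 'k) mpoly" where
  "smul c p = Poly_Mapping.single 0 c * p"

lemma lookup_smul [simp]: "lookup (smul c p) u = c * lookup p u"
  using lookup_single_mult[of 0 c p u] by (simp add: smul_def)

lemma vector_space_smul:
  "vector_space (smul :: 'k::field \<Rightarrow> ('v, 'k) mpoly \<Rightarrow> ('v, 'k) mpoly)"
  by unfold_locales (simp_all only: smul_def single_add distrib_left distrib_right mult_single
    mult.assoc[symmetric] add_0 single_one mult_1_left)

interpretation mp: dimension_space "smul :: 'k::field \<Rightarrow> ('v, 'k) mpoly \<Rightarrow> ('v, 'k) mpoly"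
  unfolding dimension_space_def by (rule vector_space_smul)

lemma smul_mult: "smul c p * q = smul c (p * q)" "p * smul c q = smul c (p * q)"
  by (simp_all only: smul_def mult_ac)

lemma single_eq_smul: "Poly_Mapping.single u c = smul c (of_monom u)"
  by (simp add: smul_def of_monom_def mult_single)

lemma linear_mult_left: "Vector_Spaces.linear smul smul (\<lambda>p. a * p)"
  for a :: "('v, 'k::field) mpoly"
  unfolding Vector_Spaces.linear_iff
  using mp.vector_space_axioms by (auto simp: smul_mult algebra_simps)

text \<open>The polynomials all of whose monomials lie in \<open>M\<close>, that is, the span of \<open>M\<close>.\<close>

definition supported :: "'v monom set \<Rightarrow> ('v, 'k::zero) mpoly set" where
  "supported M = {p. keys p \<subseteq> M}"

lemma supported_iff: "p \<in> supported M \<longleftrightarrow> (\<forall>u. u \<notin> M \<longrightarrow> lookup p u = 0)"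
  by (auto simp: supported_def in_keys_iff)

lemma subspace_supported: "mp.subspace (supported M)"
  by (rule mp.subspaceI) (auto simp: supported_iff lookup_add)

lemma of_monom_supported [simp]:
  "of_monom u \<in> (supported M :: ('v, 'k::zero_neq_one) mpoly set) \<longleftrightarrow> u \<in> M"
  by (simp add: supported_def of_monom_def)

lemma span_of_monom: "mp.span (of_monom ` M) = (supported M :: ('v, 'k::field) mpoly set)"
proof
  show "mp.span (of_monom ` M) \<subseteq> (supported M :: ('v, 'k) mpoly set)"
    by (rule mp.span_minimal) (auto simp: subspace_supported)
  show "(supported M :: ('v, 'k) mpoly set) \<subseteq> mp.span (of_monom ` M)"
  proof
    fix p :: "('v, 'k) mpoly" assume "p \<in> supported M"
    then have "(\<Sum>u\<in>keys p. smul (lookup p u) (of_monom u)) \<in> mp.span (of_monom ` M)"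
      by (intro mp.span_sum mp.span_scale mp.span_base) (auto simp: supported_def)
    then show "p \<in> mp.span (of_monom ` M)"
      by (simp add: mpoly_sum_monom flip: single_eq_smul)
  qed
qed

lemma inj_of_monom: "inj (of_monom :: 'v monom \<Rightarrow> ('v, 'k::zero_neq_one) mpoly)"
proof (rule injI)
  fix u v assume *: "of_monom u = (of_monom v :: ('v, 'k) mpoly)"
  have "keys (of_monom u :: ('v, 'k) mpoly) = {u}" "keys (of_monom v :: ('v, 'k) mpoly) = {v}"
    by (auto simp: of_monom_def)
  then show "u = v" using * by (metis singleton_inject)
qed

lemma independent_of_monom:
  "mp.independent (of_monom ` M :: ('v, 'k::field) mpoly set)"
  unfolding mp.dependent_def
proof safe
  fix u assume u: "u \<in> M" "(of_monom u :: ('v, 'k) mpoly) \<in> mp.span (of_monom ` M - {of_monom u})"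
  have "of_monom ` M - {of_monom u :: ('v, 'k) mpoly} = of_monom ` (M - {u})"
    using inj_of_monom by (auto simp: inj_def)
  then have "(of_monom u :: ('v, 'k) mpoly) \<in> supported (M - {u})"
    using u(2) by (simp add: span_of_monom)
  then show False by simp
qed

lemma dim_supported: "mp.dim (supported M :: ('v, 'k::field) mpoly set) = card M"
proof -
  have "mp.dim (supported M :: ('v, 'k::field) mpoly set) = card (of_monom ` M :: ('v, 'k) mpoly set)"
    unfolding span_of_monom[symmetric] by (rule mp.dim_span_eq_card_independent[OF independent_of_monom])
  also have "\<dots> = card M" by (rule card_image) (meson inj_of_monom inj_on_subset subset_UNIV)
  finally show ?thesis .
qed

lemma fin_dim_supported: "finite M \<Longrightarrow> mp.fin_dim (supported M)"
  unfolding span_of_monom[symmetric] by (simp add: mp.fin_dim_span)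

lemma homogeneous_supported: "homogeneous e = supported {u. mono_deg u = e}"
  by (auto simp: homogeneous_def supported_def)

lemma homogeneousD: "p \<in> homogeneous e \<Longrightarrow> mono_deg u \<noteq> e \<Longrightarrow> lookup p u = 0"
  by (simp add: homogeneous_supported supported_iff)

lemma subspace_homogeneous: "mp.subspace (homogeneous e)"
  by (simp add: homogeneous_supported subspace_supported)

lemma fin_dim_homogeneous: "mp.fin_dim (homogeneous e :: ('v::finite, 'k::field) mpoly set)"
  by (simp add: homogeneous_supported fin_dim_supported finite_mono_deg_eq)

lemma homogeneous_mult:
  "p \<in> homogeneous a \<Longrightarrow> q \<in> homogeneous b \<Longrightarrow> p * q \<in> homogeneous (a + b)"
  using keys_mult[of p q] by (fastforce simp: homogeneous_def mono_deg_add)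

lemma homogeneous_power: "p \<in> homogeneous a \<Longrightarrow> p ^ n \<in> homogeneous (n * a)"
proof (induction n)
  case 0
  then show ?case by (simp add: homogeneous_def)
next
  case (Suc n)
  then show ?case using homogeneous_mult[of p a "p ^ n" "n * a"] by simp
qed

lemma of_monom_homogeneous [simp]:
  "(of_monom u :: ('v::finite, 'k::zero_neq_one) mpoly) \<in> homogeneous e \<longleftrightarrow> mono_deg u = e"
  by (simp add: homogeneous_supported)

lemma of_monom_mult: "of_monom u * of_monom v = (of_monom (u + v) :: ('v, 'k::comm_ring_1) mpoly)"
  by (simp add: of_monom_def mult_single)

text \<open>The homogeneous component of degree \<open>e\<close>.\<close>

definition homog_comp :: "nat \<Rightarrow> ('v::finite, 'k::comm_monoid_add) mpoly \<Rightarrow> ('v, 'k) mpoly" where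
  "homog_comp e p = (\<Sum>u | u \<in> keys p \<and> mono_deg u = e. Poly_Mapping.single u (lookup p u))"

lemma lookup_homog_comp: "lookup (homog_comp e p) u = (if mono_deg u = e then lookup p u else 0)"
proof -
  have "lookup (homog_comp e p) u =
      (\<Sum>v | v \<in> keys p \<and> mono_deg v = e. if v = u then lookup p v else 0)"
    by (simp add: homog_comp_def lookup_sum lookup_single when_def)
  also have "\<dots> = (if mono_deg u = e then lookup p u else 0)"
    by (subst sum.delta) (auto simp: in_keys_iff)
  finally show ?thesis .
qed

lemma homog_comp_add: "homog_comp e (p + q) = homog_comp e p + homog_comp e q"
  by (rule poly_mapping_eqI) (simp add: lookup_homog_comp lookup_add)

lemma homog_comp_homogeneous: "homog_comp e p \<in> homogeneous e"
  by (simp add: homogeneous_supported supported_iff lookup_homog_comp)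

lemma homog_comp_id: "p \<in> homogeneous e \<Longrightarrow> homog_comp e p = p"
  by (rule poly_mapping_eqI) (auto simp: lookup_homog_comp homogeneousD)

lemma homog_comp_mult:
  assumes g: "g \<in> homogeneous d"
  shows "homog_comp e (p * g) =
    (if d \<le> e then homog_comp (e - d) p * g else (0 :: ('v::finite, 'k::comm_ring_1) mpoly))"
proof (induction p rule: mpoly_induct)
  case zero
  have "homog_comp e' 0 = (0 :: ('v, 'k) mpoly)" for e' by (simp add: homog_comp_def)
  then show ?case by simp
next
  case (add p u c)
  have s: "Poly_Mapping.single u c * g \<in> homogeneous (mono_deg u + d)"
    by (rule homogeneous_mult[OF _ g]) (auto simp: homogeneous_def)
  have "homog_comp e (Poly_Mapping.single u c * g) =
     (if d \<le> e then homog_comp (e - d) (Poly_Mapping.single u c) * g else 0)"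
  proof (cases "e = mono_deg u + d")
    case True
    then have "homog_comp (e - d) (Poly_Mapping.single u c) = Poly_Mapping.single u c"
      by (intro homog_comp_id) (auto simp: homogeneous_def)
    then show ?thesis using homog_comp_id[OF s] True by simp
  next
    case False
    have "homog_comp e (Poly_Mapping.single u c * g) = 0"
      using False by (intro poly_mapping_eqI) (auto simp: lookup_homog_comp homogeneousD[OF s])
    moreover have "homog_comp (e - d) (Poly_Mapping.single u c) = 0" if "d \<le> e"
      using False that by (intro poly_mapping_eqI) (auto simp: lookup_homog_comp lookup_single when_def)
    ultimately show ?thesis by simp
  qed
  then show ?case using add by (simp add: algebra_simps homog_comp_add)
qed

text \<open>Unital ring homomorphisms, between whole types.\<close>

definition ring_map :: "('a::comm_ring_1 \<Rightarrow> 'b::comm_ring_1) \<Rightarrow> bool" where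
  "ring_map h \<longleftrightarrow> h 0 = 0 \<and> h 1 = 1 \<and> (\<forall>a b. h (a + b) = h a + h b) \<and> (\<forall>a b. h (a * b) = h a * h b)"

text \<open>The value of \<open>p\<close> at \<open>y\<close> in a ring \<open>'r\<close>, with the coefficients mapped to \<open>'r\<close> by \<open>h\<close>. With
\<open>h\<close> the embedding of the constants this is substitution of polynomials, and with \<open>h\<close> the identity
it is \<^const>\<open>eval_poly\<close>.\<close>

definition subst :: "('k::comm_ring_1 \<Rightarrow> 'r::comm_ring_1) \<Rightarrow> ('v \<Rightarrow> 'r) \<Rightarrow> ('v, 'k) mpoly \<Rightarrow> 'r" where
  "subst h y p = (\<Sum>m\<in>keys p. h (lookup p m) * (\<Prod>c\<in>keys m. y c ^ lookup m c))"

lemma monom_eval_superset: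
  assumes "finite A" "keys m \<subseteq> A"
  shows "(\<Prod>c\<in>keys m. y c ^ lookup m c) = (\<Prod>c\<in>A. (y c :: 'r::comm_ring_1) ^ lookup m c)"
  by (rule prod.mono_neutral_left) (use assms in \<open>auto simp: in_keys_iff\<close>)

lemma subst_superset:
  assumes h: "ring_map h" "finite A" "keys p \<subseteq> A"
  shows "subst h y p = (\<Sum>m\<in>A. h (lookup p m) * (\<Prod>c\<in>keys m. y c ^ lookup m c))"
  unfolding subst_def by (rule sum.mono_neutral_left) (use assms in \<open>auto simp: in_keys_iff ring_map_def\<close>)

lemma subst_add:
  assumes h: "ring_map h"
  shows "subst h y (p + q) = subst h y p + subst h y q"
proof -
  have "subst h y r = (\<Sum>m\<in>keys p \<union> keys q. h (lookup r m) * (\<Prod>c\<in>keys m. y c ^ lookup m c))"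
    if "r \<in> {p, q, p + q}" for r
    using that keys_add[of p q] by (intro subst_superset[OF h]) auto
  then show ?thesis using h by (simp add: lookup_add ring_map_def sum.distrib algebra_simps)
qed

lemma subst_0 [simp]: "subst h y 0 = 0"
  by (simp add: subst_def)

lemma subst_single:
  assumes h: "ring_map h"
  shows "subst h y (Poly_Mapping.single m c) = h c * (\<Prod>i\<in>keys m. y i ^ lookup m i)"
  using h by (simp add: subst_def ring_map_def)

lemma subst_mult:
  assumes h: "ring_map h"
  shows "subst h y (p * q) = subst h y p * subst h y q"
proof (induction p rule: mpoly_induct)
  case zero
  then show ?case by simp
next
  case (add p u c)
  have "subst h y (Poly_Mapping.single u c * q) = subst h y (Poly_Mapping.single u c) * subst h y q"
  proof (induction q rule: mpoly_induct)
    case zero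
    then show ?case by simp
  next
    case (add q v d)
    have k: "keys (u + v) \<subseteq> keys u \<union> keys v" by (rule keys_add)
    have "(\<Prod>i\<in>keys (u + v). y i ^ lookup (u + v) i) =
       (\<Prod>i\<in>keys u. y i ^ lookup u i) * (\<Prod>i\<in>keys v. y i ^ lookup v i)"
    proof -
      have "(\<Prod>i\<in>keys w. y i ^ lookup w i) = (\<Prod>i\<in>keys u \<union> keys v. y i ^ lookup w i)"
        if "w \<in> {u, v, u + v}" for w
        using that k by (intro monom_eval_superset) auto
      from this[of u] this[of v] this[of "u + v"] show ?thesis
        by (simp only: insert_iff simp_thms lookup_add power_add prod.distrib)
    qed
    then show ?case using add h
      by (simp add: ring_distribs mult_single subst_add subst_single ring_map_def)
  qed
  then show ?case using add by (simp add: ring_distribs subst_add[OF h])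
qed

lemma subst_1 [simp]: "ring_map h \<Longrightarrow> subst h y 1 = 1"
  using subst_single[of h y 0 1] by (simp add: ring_map_def)

lemma subst_power: "ring_map h \<Longrightarrow> subst h y (p ^ n) = subst h y p ^ n"
  by (induction n) (simp_all add: subst_mult)

lemma ring_map_subst: "ring_map h \<Longrightarrow> ring_map (subst h y)"
  unfolding ring_map_def[of "subst h y"] by (simp add: subst_add subst_mult)

text \<open>The variable with index \<open>i\<close>, as a polynomial.\<close>

definition mvar :: "'v \<Rightarrow> ('v, 'k::zero_neq_one) mpoly" where
  "mvar i = of_monom (Poly_Mapping.single i 1)"

lemma mvar_power: "mvar i ^ n = (of_monom (Poly_Mapping.single i n) :: ('v, 'k::comm_ring_1) mpoly)"
proof (induction n)
  case 0
  then show ?case by (simp add: of_monom_def)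
next
  case (Suc n)
  then show ?case by (simp add: mvar_def of_monom_mult flip: single_add)
qed

lemma mvar_homogeneous [simp]: "(mvar i :: ('v::finite, 'k::zero_neq_one) mpoly) \<in> homogeneous 1"
  by (simp add: mvar_def)

lemma subst_mvar [simp]: "ring_map h \<Longrightarrow> subst h y (mvar i) = y i"
  by (simp add: mvar_def of_monom_def subst_single ring_map_def)

lemma subst_const [simp]: "ring_map h \<Longrightarrow> subst h y (Poly_Mapping.single 0 c) = h c"
  by (simp add: subst_single)

lemma of_monom_0 [simp]: "of_monom 0 = 1"
  by (simp add: of_monom_def)

lemma of_monom_prod_mvar:
  "of_monom u = (\<Prod>i\<in>keys u. (mvar i :: ('v, 'k::comm_ring_1) mpoly) ^ lookup u i)"
proof -
  have *: "of_monom (\<Sum>i\<in>A. w i) = (\<Prod>i\<in>A. of_monom (w i) :: ('v, 'k) mpoly)" for A and w :: "'v \<Rightarrow> 'v monom"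
    by (induction A rule: infinite_finite_induct) (simp_all flip: of_monom_mult)
  have "of_monom u = (of_monom (\<Sum>i\<in>keys u. Poly_Mapping.single i (lookup u i)) :: ('v, 'k) mpoly)"
    by (simp add: mpoly_sum_monom)
  then show ?thesis by (simp add: * mvar_power)
qed

lemma ring_map_eqI:
  fixes \<phi> \<psi> :: "('v, 'k::comm_ring_1) mpoly \<Rightarrow> 'b::comm_ring_1"
  assumes "ring_map \<phi>" "ring_map \<psi>"
    and "\<And>c. \<phi> (Poly_Mapping.single 0 c) = \<psi> (Poly_Mapping.single 0 c)"
    and "\<And>i. \<phi> (mvar i) = \<psi> (mvar i)"
  shows "\<phi> p = \<psi> p"
proof (induction p rule: mpoly_induct)
  case zero
  then show ?case using assms by (simp add: ring_map_def)
next
  case (add p u c)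
  have pw: "\<theta> (a ^ n) = \<theta> a ^ n" if "ring_map \<theta>" for \<theta> :: "('v, 'k) mpoly \<Rightarrow> 'b" and a and n :: nat
    using that by (induction n) (auto simp: ring_map_def)
  have pr: "\<theta> (\<Prod>i\<in>A. w i) = (\<Prod>i\<in>A. \<theta> (w i))" if "ring_map \<theta>"
    for \<theta> :: "('v, 'k) mpoly \<Rightarrow> 'b" and A and w :: "'v \<Rightarrow> ('v, 'k) mpoly"
    using that by (induction A rule: infinite_finite_induct) (auto simp: ring_map_def)
  have "\<phi> (of_monom u) = \<psi> (of_monom u)"
    by (simp add: of_monom_prod_mvar pr pw assms)
  moreover have "Poly_Mapping.single u c = Poly_Mapping.single 0 c * of_monom u"
    by (simp add: of_monom_def mult_single)
  ultimately show ?case using assms add by (simp add: ring_map_def)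
qed

lemma ring_map_single_0: "ring_map (Poly_Mapping.single 0 :: 'k::comm_ring_1 \<Rightarrow> ('v, 'k) mpoly)"
  by (simp add: ring_map_def single_add mult_single)

abbreviation msubst :: "('v \<Rightarrow> ('w, 'k::comm_ring_1) mpoly) \<Rightarrow> ('v, 'k) mpoly \<Rightarrow> ('w, 'k) mpoly" where
  "msubst \<equiv> subst (Poly_Mapping.single 0)"

lemmas ring_map_msubst = ring_map_subst[OF ring_map_single_0]

lemma msubst_smul: "msubst y (smul c p) = smul c (msubst y p)"
  by (simp add: smul_def subst_mult ring_map_single_0)

lemma linear_msubst: "Vector_Spaces.linear smul smul (msubst y)"
  for y :: "'v \<Rightarrow> ('w, 'k::field) mpoly"
  unfolding Vector_Spaces.linear_iff
  by (intro conjI vector_space_smul) (auto simp: msubst_smul subst_add ring_map_single_0)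

lemma msubst_inverse:
  assumes "\<And>i. msubst y (z i) = mvar i"
  shows "msubst y (msubst z p) = p"
proof (rule ring_map_eqI[of "\<lambda>p. msubst y (msubst z p)" "\<lambda>p. p"])
  show "ring_map (\<lambda>p. msubst y (msubst z p))"
    using ring_map_msubst[of y] ring_map_msubst[of z] by (simp add: ring_map_def)
qed (simp_all add: assms ring_map_single_0, simp add: ring_map_def)

lemma msubst_homogeneous:
  assumes y: "\<And>i. y i \<in> homogeneous 1" and p: "p \<in> homogeneous e"
  shows "msubst y (p :: ('v::finite, 'k::field) mpoly) \<in> (homogeneous e :: ('w::finite, 'k) mpoly set)"
proof -
  have "h (lookup p m) * (\<Prod>c\<in>keys m. y c ^ lookup m c) \<in> homogeneous e"
    if "m \<in> keys p" "h = Poly_Mapping.single 0" for m and h :: "'k \<Rightarrow> ('w, 'k) mpoly"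
  proof -
    have "(\<Prod>c\<in>A. y c ^ lookup m c) \<in> homogeneous (\<Sum>c\<in>A. lookup m c)" for A
    proof (induction A rule: infinite_finite_induct)
      case (insert c A)
      then show ?case
        using homogeneous_mult[OF homogeneous_power[OF y[of c], of "lookup m c"], of "\<Prod>c\<in>A. y c ^ lookup m c"] by simp
    qed (auto simp: homogeneous_def)
    from this[of UNIV] have "(\<Prod>c\<in>keys m. y c ^ lookup m c) \<in> homogeneous (mono_deg m)"
      by (simp add: monom_eval_superset[of UNIV m] mono_deg_def)
    moreover have "mono_deg m = e" using p that by (auto simp: homogeneous_def)
    moreover have "Poly_Mapping.single 0 (lookup p m) \<in> (homogeneous 0 :: ('w, 'k) mpoly set)"
      by (simp add: homogeneous_def)
    ultimately show ?thesis using that homogeneous_mult by fastforce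
  qed
  then show ?thesis unfolding subst_def by (intro mp.subspace_sum[OF subspace_homogeneous]) auto
qed

section \<open>The strong Lefschetz property of monomial complete intersections\<close>

text \<open>The coefficient function of \<open>L * p\<close>, where \<open>L\<close> is the sum of the variables, in terms of those of
\<open>p\<close>.\<close>

definition raise_op :: "('v::finite monom \<Rightarrow> 'k::comm_ring_1) \<Rightarrow> 'v monom \<Rightarrow> 'k" where
  "raise_op \<phi> w = (\<Sum>i\<in>UNIV. if lookup w i > 0 then \<phi> (w - Poly_Mapping.single i 1) else 0)"

text \<open>The lowering operator, which sends the monomial \<open>w\<close> to the sum over \<open>i\<close> of
\<open>w\<^sub>i (d\<^sub>i - w\<^sub>i) w / x\<^sub>i\<close>. The factor \<open>d\<^sub>i - w\<^sub>i\<close> vanishes at \<open>w\<^sub>i = d\<^sub>i\<close>, so that the ideal generated by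
the powers \<open>x\<^sub>i ^ d\<^sub>i\<close> is preserved.\<close>

definition lower_op :: "('v \<Rightarrow> nat) \<Rightarrow> ('v::finite monom \<Rightarrow> 'k::comm_ring_1) \<Rightarrow> 'v monom \<Rightarrow> 'k" where
  "lower_op d \<phi> w = (\<Sum>i\<in>UNIV. of_nat (lookup w i + 1) * (of_nat (d i) - of_nat (lookup w i) - 1)
     * \<phi> (w + Poly_Mapping.single i 1))"

abbreviation in_box :: "('v \<Rightarrow> nat) \<Rightarrow> 'v monom \<Rightarrow> bool" where
  "in_box d w \<equiv> \<forall>i. lookup w i < d i"

text \<open>In degree \<open>e\<close>, the polynomial with coefficients \<open>\<phi>\<close> belongs to the ideal generated by the
powers \<open>x\<^sub>i ^ d\<^sub>i\<close>: it has no monomial inside the box \<open>w\<^sub>i < d\<^sub>i\<close>.\<close>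

definition vanish_box :: "('v::finite \<Rightarrow> nat) \<Rightarrow> nat \<Rightarrow> ('v monom \<Rightarrow> 'k::comm_ring_1) \<Rightarrow> bool" where
  "vanish_box d e \<phi> \<longleftrightarrow> (\<forall>w. mono_deg w = e \<and> in_box d w \<longrightarrow> \<phi> w = 0)"

lemma minus_single_plus_single:
  assumes "lookup w i > 0"
  shows "w - Poly_Mapping.single i 1 + Poly_Mapping.single i 1 = (w :: 'v monom)"
  by (rule poly_mapping_eqI) (use assms in \<open>auto simp: lookup_add lookup_minus lookup_single when_def\<close>)

lemma mono_deg_minus_single:
  assumes "lookup w i > 0"
  shows "mono_deg w = Suc (mono_deg (w - Poly_Mapping.single i 1 :: 'v::finite monom))"
  using arg_cong[OF minus_single_plus_single[OF assms], of mono_deg] by (simp add: mono_deg_add)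

lemma lookup_sum_mvar_mult:
  "lookup ((\<Sum>i\<in>UNIV. mvar i) * p) w = raise_op (lookup p) w"
proof -
  have "lookup (mvar i * p) w = (if lookup w i > 0 then lookup p (w - Poly_Mapping.single i 1) else 0)" for i
  proof (cases "lookup w i > 0")
    case True
    have "lookup (mvar i * p) w = lookup (mvar i * p) (Poly_Mapping.single i 1 + (w - Poly_Mapping.single i 1))"
      using minus_single_plus_single[OF True] by (simp add: add.commute)
    also have "\<dots> = lookup p (w - Poly_Mapping.single i 1)"
      unfolding mvar_def of_monom_def lookup_single_mult by simp
    finally show ?thesis using True by simp
  next
    case False
    then have "\<nexists>z. w = Poly_Mapping.single i 1 + z" by (auto simp: lookup_add)
    then show ?thesis using False unfolding mvar_def of_monom_def by (simp add: lookup_single_mult_0)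
  qed
  then show ?thesis by (simp add: sum_distrib_right lookup_sum raise_op_def)
qed

lemma lookup_sum_mvar_power_mult:
  "lookup ((\<Sum>i\<in>UNIV. mvar i) ^ n * p) = (raise_op ^^ n) (lookup p)"
proof (induction n)
  case (Suc n)
  have "lookup ((\<Sum>i\<in>UNIV. mvar i) * ((\<Sum>i\<in>UNIV. mvar i) ^ n * p)) w = raise_op ((raise_op ^^ n) (lookup p)) w" for w
    unfolding lookup_sum_mvar_mult Suc.IH ..
  then show ?case by (intro ext) (simp only: power_Suc mult.assoc funpow.simps comp_def)
qed simp

lemma raise_op_cong:
  assumes "\<And>v. Suc (mono_deg v) = mono_deg w \<Longrightarrow> \<phi> v = \<psi> v"
  shows "raise_op \<phi> w = raise_op \<psi> w"
  unfolding raise_op_def by (intro sum.cong) (auto simp: assms mono_deg_minus_single)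

lemma raise_op_add_scale:
  "raise_op (\<lambda>w. \<phi> w + c * \<psi> w) w = raise_op \<phi> w + c * raise_op \<psi> w"
proof -
  have "raise_op (\<lambda>w. \<phi> w + c * \<psi> w) w =
    (\<Sum>i\<in>UNIV. (if lookup w i > 0 then \<phi> (w - Poly_Mapping.single i 1) else 0) +
      c * (if lookup w i > 0 then \<psi> (w - Poly_Mapping.single i 1) else 0))"
    unfolding raise_op_def by (intro sum.cong) auto
  then show ?thesis by (simp add: raise_op_def sum.distrib sum_distrib_left)
qed

text \<open>The relation \<open>[F, E] = H\<close> of \<open>sl\<^sub>2\<close>, where \<open>H\<close> acts on degree \<open>j\<close> as the scalar \<open>N - 2 j\<close> with
\<open>N\<close> the sum of the \<open>d\<^sub>i - 1\<close>.\<close>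

lemma lower_raise_commutator:
  fixes \<phi> :: "'v::finite monom \<Rightarrow> 'k::comm_ring_1"
  shows "lower_op d (raise_op \<phi>) w = raise_op (lower_op d \<phi>) w
    + ((\<Sum>i\<in>UNIV. of_nat (d i) - 1) - 2 * of_nat (mono_deg w)) * \<phi> w"
proof -
  define e where "e i = (Poly_Mapping.single i 1 :: 'v monom)" for i
  have le: "lookup (e i) j = (if i = j then 1 else 0)" for i j
    by (simp add: e_def lookup_single when_def)
  define a where "a u i = (of_nat (lookup u i + 1) * (of_nat (d i) - of_nat (lookup u i) - 1) :: 'k)" for u i
  define P where "P i j = a w i * (if lookup (w + e i) j > 0 then \<phi> (w + e i - e j) else 0)" for i j
  define Q where "Q i j = (if lookup w j > 0 then a (w - e j) i * \<phi> (w - e j + e i) else 0)" for i j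
  have 1: "lower_op d (raise_op \<phi>) w = (\<Sum>i\<in>UNIV. \<Sum>j\<in>UNIV. P i j)"
    unfolding lower_op_def raise_op_def P_def a_def e_def by (simp only: sum_distrib_left)
  have "raise_op (lower_op d \<phi>) w = (\<Sum>j\<in>UNIV. \<Sum>i\<in>UNIV. Q i j)"
    unfolding lower_op_def raise_op_def Q_def a_def e_def
    by (intro sum.cong refl) (simp only: sum.neutral_const split: if_split, simp)
  then have 2: "raise_op (lower_op d \<phi>) w = (\<Sum>i\<in>UNIV. \<Sum>j\<in>UNIV. Q i j)"
    using sum.swap by simp
  \<comment> \<open>Raising and lowering in different variables commute, so only the diagonal contributes.\<close>
  have off: "P i j = Q i j" if "i \<noteq> j" for i j
  proof (cases "lookup w j > 0")
    case True
    have "w + e i - e j = w - e j + e i"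
      by (rule poly_mapping_eqI) (use True that in \<open>auto simp: lookup_add lookup_minus le\<close>)
    moreover have "a (w - e j) i = a w i" using that by (simp add: a_def lookup_minus le)
    ultimately show ?thesis using True by (simp add: P_def Q_def lookup_add)
  next
    case False
    then show ?thesis using that by (simp add: P_def Q_def lookup_add le)
  qed
  have diag: "P i i = Q i i + (of_nat (d i) - 1 - 2 * of_nat (lookup w i)) * \<phi> w" for i
  proof (cases "lookup w i > 0")
    case True
    then obtain n where n: "lookup w i = Suc n" by (cases "lookup w i") auto
    have "w - e i + e i = w" using minus_single_plus_single[OF True] by (simp add: e_def)
    then have "Q i i = a (w - e i) i * \<phi> w" using True by (simp add: Q_def)
    moreover have "P i i = a w i * \<phi> w" by (simp add: P_def lookup_add le)
    moreover have "a (w - e i) i = (of_nat n + 1) * (of_nat (d i) - of_nat n - 1)"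
      by (simp add: a_def lookup_minus le n add.commute)
    moreover have "a w i = (of_nat n + 2) * (of_nat (d i) - of_nat n - 2)"
      by (simp add: a_def n algebra_simps)
    moreover have "of_nat (lookup w i) = (of_nat n + 1 :: 'k)" by (simp add: n)
    moreover have "(m + 2) * (D - m - 2) * x = (m + 1) * (D - m - 1) * x + (D - 1 - 2 * (m + 1)) * x"
      for m D x :: 'k by (simp add: algebra_simps)
    ultimately show ?thesis by simp
  next
    case False
    then show ?thesis by (simp add: P_def Q_def lookup_add le a_def)
  qed
  have "(\<Sum>j\<in>UNIV. P i j) = (\<Sum>j\<in>UNIV. Q i j) + (of_nat (d i) - 1 - 2 * of_nat (lookup w i)) * \<phi> w" for i
  proof -
    have "(\<Sum>j\<in>UNIV. P i j) = P i i + (\<Sum>j\<in>UNIV - {i}. P i j)"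
      by (rule sum.remove) auto
    also have "(\<Sum>j\<in>UNIV - {i}. P i j) = (\<Sum>j\<in>UNIV - {i}. Q i j)"
      using off by (intro sum.cong) auto
    also have "P i i + (\<Sum>j\<in>UNIV - {i}. Q i j) =
        (Q i i + (\<Sum>j\<in>UNIV - {i}. Q i j)) + (of_nat (d i) - 1 - 2 * of_nat (lookup w i)) * \<phi> w"
      by (simp add: diag)
    also have "Q i i + (\<Sum>j\<in>UNIV - {i}. Q i j) = (\<Sum>j\<in>UNIV. Q i j)"
      by (rule sum.remove[symmetric]) auto
    finally show ?thesis .
  qed
  then show ?thesis unfolding 1 2 mono_deg_def
    by (simp add: sum.distrib sum_subtractf sum_distrib_left sum_distrib_right left_diff_distrib)
qed

lemma lower_raise_power:
  fixes \<phi> :: "'v::finite monom \<Rightarrow> 'k::comm_ring_1"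
  assumes "mono_deg w = j + m"
  shows "lower_op d ((raise_op ^^ Suc m) \<phi>) w = (raise_op ^^ Suc m) (lower_op d \<phi>) w
    + of_nat (Suc m) * ((\<Sum>i\<in>UNIV. of_nat (d i) - 1) - 2 * of_nat j - of_nat m) * (raise_op ^^ m) \<phi> w"
  using assms
proof (induction m arbitrary: w)
  case 0
  then show ?case by (simp add: lower_raise_commutator)
next
  case (Suc m)
  let ?N = "(\<Sum>i\<in>UNIV. of_nat (d i) - 1) :: 'k"
  let ?R = "(raise_op ^^ Suc m) \<phi>"
  let ?c = "of_nat (Suc m) * (?N - 2 * of_nat j - of_nat m) :: 'k"
  have "lower_op d ((raise_op ^^ Suc (Suc m)) \<phi>) w = lower_op d (raise_op ?R) w" by simp
  also have "\<dots> = raise_op (lower_op d ?R) w + (?N - 2 * of_nat (mono_deg w)) * ?R w"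
    by (rule lower_raise_commutator)
  also have "raise_op (lower_op d ?R) w =
      raise_op (\<lambda>v. (raise_op ^^ Suc m) (lower_op d \<phi>) v + ?c * (raise_op ^^ m) \<phi> v) w"
    using Suc.prems by (intro raise_op_cong Suc.IH) simp
  also have "\<dots> = (raise_op ^^ Suc (Suc m)) (lower_op d \<phi>) w + ?c * ?R w"
    by (simp add: raise_op_add_scale)
  finally show ?case using Suc.prems by (simp add: algebra_simps)
qed

lemma vanish_box_raise: "vanish_box d e \<phi> \<Longrightarrow> vanish_box d (Suc e) (raise_op \<phi>)"
  unfolding vanish_box_def raise_op_def
proof (intro allI impI sum.neutral ballI)
  fix w i assume *: "\<forall>w. mono_deg w = e \<and> in_box d w \<longrightarrow> \<phi> w = 0" "mono_deg w = Suc e \<and> in_box d w"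
  have "\<phi> (w - Poly_Mapping.single i 1) = 0" if "lookup w i > 0"
  proof -
    have "in_box d (w - Poly_Mapping.single i 1)"
      using *(2) by (metis diff_le_self le_less_trans lookup_minus)
    then show ?thesis using * mono_deg_minus_single[OF that] by simp
  qed
  then show "(if lookup w i > 0 then \<phi> (w - Poly_Mapping.single i 1) else 0) = 0" by simp
qed

lemma vanish_box_raise_power: "vanish_box d e \<phi> \<Longrightarrow> vanish_box d (e + n) ((raise_op ^^ n) \<phi>)"
  by (induction n) (auto dest: vanish_box_raise)

lemma vanish_box_lower: "vanish_box d (Suc e) \<phi> \<Longrightarrow> vanish_box d e (lower_op d \<phi>)"
  unfolding vanish_box_def lower_op_def
proof (intro allI impI sum.neutral ballI)
  fix w i assume *: "\<forall>w. mono_deg w = Suc e \<and> in_box d w \<longrightarrow> \<phi> w = 0" "mono_deg w = e \<and> in_box d w"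
  show "of_nat (lookup w i + 1) * (of_nat (d i) - of_nat (lookup w i) - 1) * \<phi> (w + Poly_Mapping.single i 1) = 0"
  proof (cases "lookup w i + 1 = d i")
    case True
    then have "of_nat (d i) - of_nat (lookup w i) - (1 :: 'b) = 0" unfolding True[symmetric] by simp
    then show ?thesis by simp
  next
    case False
    then have "lookup w i + 1 < d i" using * by (metis Suc_eq_plus1 Suc_leI le_neq_implies_less)
    then have "in_box d (w + Poly_Mapping.single i 1)" using * by (simp add: lookup_add lookup_single when_def)
    then show ?thesis using * by (simp add: mono_deg_add)
  qed
qed

lemma raise_op_power_low_degree: "mono_deg w < n \<Longrightarrow> (raise_op ^^ n) \<phi> w = 0"
proof (induction n arbitrary: w)
  case (Suc n)
  then show ?case unfolding funpow.simps comp_def raise_op_def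
    by (intro sum.neutral) (auto simp: mono_deg_minus_single)
qed simp

text \<open>Induction on the degree \<open>j\<close>. Put \<open>n = N - 2 j\<close> and suppose that \<open>E ^ n \<phi>\<close> vanishes modulo the ideal.
The commutator of \<open>F\<close> with \<open>E ^ (n + 1)\<close> is zero on degree \<open>j\<close>, hence \<open>E ^ (n + 1) F \<phi>\<close> vanishes, and
\<open>F \<phi>\<close> vanishes by the induction hypothesis. Thus \<open>\<phi>\<close> is a lowest weight vector: for \<open>k < n\<close>, applying
\<open>F\<close> to \<open>E ^ (k + 1) \<phi>\<close> gives a nonzero multiple of \<open>E ^ k \<phi>\<close>, and one descends from \<open>k = n\<close> to \<open>0\<close>.\<close>

lemma lefschetz_middle:
  fixes \<phi> :: "'v::finite monom \<Rightarrow> 'k::field_char_0"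
  assumes d: "\<And>i. d i > 0" and "2 * j \<le> (\<Sum>i\<in>UNIV. d i - 1)"
    and "vanish_box d ((\<Sum>i\<in>UNIV. d i - 1) - j) ((raise_op ^^ ((\<Sum>i\<in>UNIV. d i - 1) - 2 * j)) \<phi>)"
  shows "vanish_box d j \<phi>"
  using assms(2-)
proof (induction j arbitrary: \<phi> rule: less_induct)
  case (less j)
  define N where "N = (\<Sum>i\<in>UNIV. d i - 1)"
  define n where "n = N - 2 * j"
  have N: "(\<Sum>i\<in>UNIV. of_nat (d i) - 1) = (of_nat N :: 'k)"
    unfolding N_def of_nat_sum using d by (intro sum.cong) (auto simp: of_nat_diff Suc_leI)
  have j: "2 * j \<le> N" using less.prems by (simp add: N_def)
  have top: "vanish_box d (j + n) ((raise_op ^^ n) \<phi>)"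
  proof -
    have "N - j = j + n" using j by (simp add: n_def)
    then show ?thesis using less.prems(2) unfolding N_def[symmetric] n_def[symmetric] by simp
  qed
  have commute: "lower_op d ((raise_op ^^ Suc m) \<phi>) w = (raise_op ^^ Suc m) (lower_op d \<phi>) w
    + of_nat (Suc m) * (of_nat n - of_nat m) * (raise_op ^^ m) \<phi> w" if "mono_deg w = j + m" for w m
  proof -
    have "N = 2 * j + n" using j by (simp add: n_def)
    from arg_cong[OF this, of "of_nat :: nat \<Rightarrow> 'k"]
    have "of_nat N = (2 * of_nat j + of_nat n :: 'k)" by simp
    then show ?thesis unfolding lower_raise_power[OF that] N by simp
  qed
  \<comment> \<open>For \<open>j = 0\<close> this holds for reasons of degree, since \<open>F \<phi>\<close> would have degree \<open>-1\<close>.\<close>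
  have prim: "vanish_box d (j + k) ((raise_op ^^ Suc k) (lower_op d \<phi>))" for k
  proof (cases j)
    case 0
    then show ?thesis unfolding vanish_box_def by (auto intro: raise_op_power_low_degree simp del: funpow.simps)
  next
    case (Suc i)
    have "vanish_box d (j + n) (lower_op d ((raise_op ^^ Suc n) \<phi>))"
      using vanish_box_lower[of d "j + n"] vanish_box_raise[OF top] by simp
    then have "vanish_box d (j + n) ((raise_op ^^ Suc n) (lower_op d \<phi>))"
      unfolding vanish_box_def using commute[of _ n] by (simp del: funpow.simps)
    then have "vanish_box d (Suc (j + n)) ((raise_op ^^ Suc (Suc n)) (lower_op d \<phi>))"
      by (simp add: vanish_box_raise)
    moreover have "Suc (j + n) = N - i" "Suc (Suc n) = N - 2 * i" using j Suc by (auto simp: n_def)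
    ultimately have "vanish_box d i (lower_op d \<phi>)"
      using less.IH[of i "lower_op d \<phi>"] j Suc by (simp only: N_def[symmetric])
    from vanish_box_raise_power[OF this, of "Suc k"] show ?thesis using Suc by (simp del: funpow.simps)
  qed
  have "vanish_box d (j + 0) ((raise_op ^^ 0) \<phi>)"
  proof (rule inc_induct[of 0 n "\<lambda>k. vanish_box d (j + k) ((raise_op ^^ k) \<phi>)"])
    fix k assume k: "k < n" and v: "vanish_box d (j + Suc k) ((raise_op ^^ Suc k) \<phi>)"
    have "vanish_box d (j + k) (lower_op d ((raise_op ^^ Suc k) \<phi>))"
      using vanish_box_lower[of d "j + k"] v by simp
    moreover have "of_nat (Suc k) * (of_nat n - of_nat k) \<noteq> (0 :: 'k)"
      using k by (simp del: of_nat_Suc)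
    ultimately show "vanish_box d (j + k) ((raise_op ^^ k) \<phi>)"
      using prim[of k] commute[of _ k] unfolding vanish_box_def by (metis add_0 mult_eq_0_iff)
  qed (use top in auto)
  then show ?case by simp
qed

text \<open>The monomials of degree \<open>e\<close> in the ideal generated by the powers \<open>x\<^sub>i ^ d\<^sub>i\<close>.\<close>

definition outside_box :: "('v \<Rightarrow> nat) \<Rightarrow> nat \<Rightarrow> ('v::finite monom) set" where
  "outside_box d e = {w. mono_deg w = e \<and> \<not> in_box d w}"

lemma lefschetz_injective:
  fixes p :: "('v::finite, 'k::field_char_0) mpoly"
  assumes d: "\<And>i. d i > 0" and c: "2 * j + c \<le> (\<Sum>i\<in>UNIV. d i - 1)"
    and p: "p \<in> homogeneous j" and Lp: "(\<Sum>i\<in>UNIV. mvar i) ^ c * p \<in> supported (outside_box d (j + c))"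
  shows "p \<in> supported (outside_box d j)"
proof -
  define N where "N = (\<Sum>i\<in>UNIV. d i - 1)"
  obtain r where r: "N = 2 * j + c + r" using c unfolding N_def by (rule less_eqE)
  have "vanish_box d (j + c) ((raise_op ^^ c) (lookup p))"
    using Lp unfolding vanish_box_def lookup_sum_mvar_power_mult[symmetric]
    by (auto simp: supported_iff outside_box_def)
  from vanish_box_raise_power[OF this, of r]
  have "vanish_box d (N - j) ((raise_op ^^ (N - 2 * j)) (lookup p))"
    unfolding r by (simp add: funpow_add[symmetric, unfolded comp_def fun_eq_iff] algebra_simps)
  then have "vanish_box d j (lookup p)"
    using lefschetz_middle[where d = d and j = j and \<phi> = "lookup p", OF d] c by (simp add: N_def)
  then show ?thesis using homogeneousD[OF p] by (auto simp: supported_iff outside_box_def vanish_box_def)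
qed

lemma in_box_le: "in_box d w \<Longrightarrow> lookup w i \<le> d i - 1"
  by (metis Suc_leI diff_Suc_1 diff_le_mono)

lemma card_box_symmetric:
  assumes "\<And>i. d i > 0" "e \<le> (\<Sum>i\<in>UNIV. d i - 1)"
  shows "card {w :: 'v::finite monom. mono_deg w = e \<and> in_box d w} =
    card {w :: 'v monom. mono_deg w = (\<Sum>i\<in>UNIV. d i - 1) - e \<and> in_box d w}"
proof -
  let ?N = "\<Sum>i\<in>UNIV. d i - 1"
  define g where "g w = Abs_poly_mapping (\<lambda>i. d i - 1 - lookup w i)" for w :: "'v monom"
  have lg: "lookup (g w) i = d i - 1 - lookup w i" for w i
    unfolding g_def by (subst lookup_Abs_poly_mapping) auto
  have gg: "g (g w) = w" if "in_box d w" for w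
    by (rule poly_mapping_eqI) (use that in \<open>auto simp: lg less_eq_Suc_le intro: diff_diff_cancel\<close>)
  have box: "in_box d (g w)" for w using assms(1) by (auto simp: lg intro: le_less_trans[OF diff_le_self])
  have deg: "mono_deg (g w) = ?N - mono_deg w" if "in_box d w" for w
    unfolding mono_deg_def lg by (intro sum_subtractf_nat) (rule in_box_le[OF that])
  have le: "mono_deg w \<le> ?N" if "in_box d w" for w
    unfolding mono_deg_def by (intro sum_mono in_box_le[OF that])
  show ?thesis
    by (rule bij_betw_same_card[of g], rule bij_betw_byWitness[of _ g])
      (use gg box deg assms(2) in auto)
qed

lemma box_empty:
  assumes "\<And>i. d i > 0" "e > (\<Sum>i\<in>UNIV. d i - 1)" "mono_deg w = e"
  shows "\<not> in_box d (w :: 'v::finite monom)"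
proof
  assume "in_box d w"
  then have "mono_deg w \<le> (\<Sum>i\<in>UNIV. d i - 1)"
    unfolding mono_deg_def by (intro sum_mono in_box_le)
  then show False using assms by simp
qed

lemma card_outside_box:
  "card {w :: 'v::finite monom. mono_deg w = e} =
    card (outside_box d e) + card {w :: 'v monom. mono_deg w = e \<and> in_box d w}"
proof -
  have "{w :: 'v monom. mono_deg w = e} = outside_box d e \<union> {w. mono_deg w = e \<and> in_box d w}"
    by (auto simp: outside_box_def)
  moreover have "finite (outside_box d e)" "finite {w :: 'v monom. mono_deg w = e \<and> in_box d w}"
    by (rule finite_subset[OF _ finite_mono_deg_eq[of e]]; auto simp: outside_box_def)+
  moreover have "outside_box d e \<inter> {w :: 'v monom. mono_deg w = e \<and> in_box d w} = {}"
    by (auto simp: outside_box_def)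
  ultimately show ?thesis by (simp only: card_Un_disjoint)
qed

lemma supported_mono: "M \<subseteq> N \<Longrightarrow> supported M \<subseteq> supported N"
  by (auto simp: supported_def)

text \<open>Surjectivity follows from injectivity by counting: the box has as many monomials in degree \<open>i\<close> as
in degree \<open>N - i\<close>, so \<open>L ^ (N - 2 i)\<close> is bijective between these degrees of the quotient, and it
factors through \<open>L ^ c\<close>.\<close>

lemma lefschetz_surjective:
  assumes d: "\<And>i. d i > 0" and c: "2 * j + c \<ge> (\<Sum>i\<in>UNIV. d i - 1)"
  shows "{x + (\<Sum>i\<in>UNIV. mvar i) ^ c * y | x y. x \<in> supported (outside_box d (j + c)) \<and> y \<in> homogeneous j}
    = (homogeneous (j + c) :: ('v::finite, 'k::field_char_0) mpoly set)" (is "?L = _")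
proof
  define N where "N = (\<Sum>i\<in>UNIV. d i - 1)"
  define L where "L = (\<Sum>i\<in>UNIV. mvar i :: ('v, 'k) mpoly)"
  have L1: "L \<in> homogeneous 1" unfolding L_def by (rule mp.subspace_sum[OF subspace_homogeneous mvar_homogeneous])
  have Lk: "L ^ k * y \<in> homogeneous (a + k)" if "y \<in> homogeneous a" for k a y
    using homogeneous_mult[OF homogeneous_power[OF L1, of k] that] by (simp add: add.commute)
  have out: "supported (outside_box d e) \<subseteq> (homogeneous e :: ('v, 'k) mpoly set)" for e
    unfolding homogeneous_supported by (rule supported_mono) (auto simp: outside_box_def)
  show "?L \<subseteq> homogeneous (j + c)"
    unfolding L_def[symmetric] using out Lk mp.subspace_add[OF subspace_homogeneous] by blast
  show "homogeneous (j + c) \<subseteq> ?L"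
  proof (cases "j + c > N")
    case True
    then have "outside_box d (j + c) = {w. mono_deg w = j + c}"
      using box_empty[where d = d, OF d] unfolding outside_box_def N_def by blast
    then have "p \<in> supported (outside_box d (j + c))" if "p \<in> homogeneous (j + c)" for p :: "('v, 'k) mpoly"
      using that by (simp add: homogeneous_supported)
    moreover have "0 \<in> (homogeneous j :: ('v, 'k) mpoly set)" by (rule mp.subspace_0[OF subspace_homogeneous])
    moreover have "p = p + L ^ c * 0" for p by simp
    ultimately show ?thesis unfolding L_def[symmetric] by blast
  next
    case False
    define i where "i = N - (j + c)"
    define k where "k = j + c - i"
    have ik: "i + k = j + c" "2 * i + k = N" "i \<le> j" "c \<le> k" "i + (k - c) = j"
      using c False unfolding i_def k_def N_def by auto
    let ?X = "supported (outside_box d (j + c)) :: ('v, 'k) mpoly set"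
    let ?Z = "{x + L ^ k * y | x y. x \<in> ?X \<and> y \<in> homogeneous i}"
    have X: "mp.subspace ?X" "mp.fin_dim ?X"
      by (auto intro!: subspace_supported mp.fin_dim_subset[OF fin_dim_homogeneous out])
    have "{y \<in> homogeneous i. L ^ k * y \<in> ?X} = supported (outside_box d i)"
    proof
      show "{y \<in> homogeneous i. L ^ k * y \<in> ?X} \<subseteq> supported (outside_box d i)"
        using lefschetz_injective[where d = d and j = i and c = k, OF d] ik unfolding L_def N_def by auto
      have vanish: "vanish_box d (i + k) (lookup (L ^ k * y))" if "y \<in> supported (outside_box d i)" for y
        unfolding L_def lookup_sum_mvar_power_mult
        using that by (intro vanish_box_raise_power) (auto simp: vanish_box_def supported_iff outside_box_def)
      show "supported (outside_box d i) \<subseteq> {y \<in> homogeneous i. L ^ k * y \<in> ?X}"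
      proof safe
        fix y :: "('v, 'k) mpoly" assume y: "y \<in> supported (outside_box d i)"
        show y': "y \<in> homogeneous i" using y out by blast
        have "L ^ k * y \<in> homogeneous (j + c)" using Lk[OF y', of k] ik(1) by simp
        moreover have "vanish_box d (j + c) (lookup (L ^ k * y))"
          using vanish[OF y] ik(1) by simp
        ultimately show "L ^ k * y \<in> ?X"
          unfolding supported_iff outside_box_def vanish_box_def by (blast dest: homogeneousD)
      qed
    qed
    then have "mp.dim ?Z + card (outside_box d i) = card (outside_box d (j + c)) + card {w :: 'v monom. mono_deg w = i}"
      using mp.dim_sum_image[OF linear_mult_left[of "L ^ k"] X subspace_homogeneous fin_dim_homogeneous, of i]
      by (simp add: dim_supported homogeneous_supported[of i])
    moreover have "card {w :: 'v monom. mono_deg w = i \<and> in_box d w} = card {w :: 'v monom. mono_deg w = j + c \<and> in_box d w}"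
      using card_box_symmetric[where d = d and e = "j + c", OF d] False unfolding i_def N_def by simp
    ultimately have "mp.dim ?Z = mp.dim (homogeneous (j + c) :: ('v, 'k) mpoly set)"
      using card_outside_box[of i d] card_outside_box[of "j + c" d]
      by (simp add: homogeneous_supported dim_supported)
    moreover have "?Z \<subseteq> homogeneous (j + c)"
    proof safe
      fix x y :: "('v, 'k) mpoly" assume "x \<in> ?X" "y \<in> homogeneous i"
      then show "x + L ^ k * y \<in> homogeneous (j + c)"
        using out[of "j + c"] Lk[of y i k] ik(1) by (intro mp.subspace_add[OF subspace_homogeneous]) auto
    qed
    moreover have "mp.subspace ?Z"
      using mp.subspace_sum_image[OF linear_mult_left X(1) subspace_homogeneous] .
    ultimately have Z: "?Z = homogeneous (j + c)"
      by (intro mp.fin_dim_subspace_eq[OF fin_dim_homogeneous _ subspace_homogeneous]) auto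
    show ?thesis
    proof
      fix p :: "('v, 'k) mpoly" assume "p \<in> homogeneous (j + c)"
      then obtain x y where xy: "x \<in> ?X" "y \<in> homogeneous i" "p = x + L ^ k * y" unfolding Z[symmetric] by blast
      have "L ^ k * y = L ^ c * (L ^ (k - c) * y)" using ik(4) by (simp flip: power_add mult.assoc)
      moreover have "L ^ (k - c) * y \<in> homogeneous j" using Lk[OF xy(2), of "k - c"] ik(5) by simp
      ultimately show "p \<in> ?L" using xy unfolding L_def by auto
    qed
  qed
qed

section \<open>Orders of vanishing in a space of univariate polynomials\<close>

text \<open>If the derivative of the fraction \<open>p / q\<close> is zero, then \<open>p / q\<close> is constant.\<close>

lemma pderiv_cross_eq_imp_smult:
  fixes p q :: "'k::field_char_0 poly"
  assumes q: "q \<noteq> 0" and eq: "pderiv p * q = p * pderiv q"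
  shows "\<exists>c. p = smult c q"
proof -
  \<comment> \<open>This \<open>c\<close> makes the degrees of \<open>p - c q\<close> and \<open>q\<close> different, which the leading terms forbid.\<close>
  define c where "c = coeff p (degree q) / lead_coeff q"
  define r where "r = p - smult c q"
  have r0: "coeff r (degree q) = 0" using q by (simp add: r_def c_def)
  have req: "pderiv r * q = r * pderiv q"
    using eq by (simp add: r_def pderiv_diff pderiv_smult algebra_simps)
  have lc: "lead_coeff (pderiv s) = of_nat (degree s) * lead_coeff s" for s :: "'k poly"
  proof (cases "degree s")
    case 0
    then have "pderiv s = 0" by (simp add: pderiv_eq_0_iff)
    then show ?thesis using 0 by simp
  next
    case (Suc n)
    then show ?thesis by (simp add: degree_pderiv coeff_pderiv)
  qed
  have "r = 0"
  proof (rule ccontr)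
    assume r: "r \<noteq> 0"
    have "lead_coeff (pderiv r * q) = lead_coeff (r * pderiv q)" using req by simp
    then have "of_nat (degree r) = (of_nat (degree q) :: 'k)"
      unfolding lead_coeff_mult lc using q r by simp
    then have "degree r = degree q" by simp
    then show False using r0 r by (metis leading_coeff_0_iff)
  qed
  then show ?thesis by (auto simp: r_def)
qed

lemma power_dvd_pderiv:
  fixes p l :: "'k::field_char_0 poly"
  assumes "l ^ Suc n dvd p"
  shows "l ^ n dvd pderiv p"
proof -
  obtain s where "p = l ^ Suc n * s" using assms by (rule dvdE)
  then have p: "pderiv p = l ^ Suc n * pderiv s + s * pderiv (l ^ Suc n)" by (simp only: pderiv_mult)
  have "l ^ n dvd l ^ Suc n * pderiv s" by (intro dvd_mult2 le_imp_power_dvd) simp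
  moreover have "l ^ n dvd s * pderiv (l ^ Suc n)"
    unfolding pderiv_power_Suc by (intro dvd_mult dvd_mult2 dvd_smult dvd_refl)
  ultimately show ?thesis unfolding p by (rule dvd_add)
qed

text \<open>For all but finitely many \<open>t\<close>, no nontrivial combination of \<open>n\<close> linearly independent polynomials
vanishes to order \<open>n\<close> at \<open>t\<close>. The induction replaces \<open>p\<^sub>x\<close> by the numerator of the derivative of
\<open>p\<^sub>x / p\<^sub>a\<close>, which removes \<open>p\<^sub>a\<close> and lowers orders of vanishing by at most one.\<close>

lemma finite_excess_vanishing:
  fixes p :: "'x \<Rightarrow> 'k::field_char_0 poly"
  assumes "finite C" "\<And>c. (\<Sum>x\<in>C. smult (c x) (p x)) = 0 \<Longrightarrow> \<forall>x\<in>C. c x = 0"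
  shows "finite {t. \<exists>c. (\<exists>x\<in>C. c x \<noteq> 0) \<and> [:- t, 1:] ^ card C dvd (\<Sum>x\<in>C. smult (c x) (p x))}"
  using assms
proof (induction C arbitrary: p)
  case empty
  then show ?case by simp
next
  case (insert a C)
  have split: "(\<Sum>x\<in>insert a C. smult (c x) (p x)) = smult (c a) (p a) + (\<Sum>x\<in>C. smult (c x) (p x))" for c
    using insert.hyps by simp
  have pa: "p a \<noteq> 0"
  proof
    assume "p a = 0"
    then have "(\<Sum>x\<in>insert a C. smult (if x = a then 1 else 0) (p x)) = 0" by (intro sum.neutral) auto
    from insert.prems[OF this] show False by simp
  qed
  have pds: "pderiv (\<Sum>x\<in>A. g x) = (\<Sum>x\<in>A. pderiv (g x))" for A and g :: "'x \<Rightarrow> 'k poly"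
    by (induction A rule: infinite_finite_induct) (simp_all add: pderiv_add)
  define q where "q x = pderiv (p x) * p a - p x * pderiv (p a)" for x
  have sq: "(\<Sum>x\<in>C. smult (c x) (q x)) =
      pderiv (\<Sum>x\<in>C. smult (c x) (p x)) * p a - (\<Sum>x\<in>C. smult (c x) (p x)) * pderiv (p a)" for c
    by (simp add: q_def pds pderiv_smult sum_distrib_right smult_diff_right sum_subtractf)
  have "\<forall>x\<in>C. c x = 0" if "(\<Sum>x\<in>C. smult (c x) (q x)) = 0" for c
  proof -
    from that sq[of c] obtain d where d: "(\<Sum>x\<in>C. smult (c x) (p x)) = smult d (p a)"
      using pderiv_cross_eq_imp_smult[OF pa] by auto
    have "(\<Sum>x\<in>C. smult ((c(a := - d)) x) (p x)) = (\<Sum>x\<in>C. smult (c x) (p x))"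
      using insert.hyps by (intro sum.cong) auto
    then have "(\<Sum>x\<in>insert a C. smult ((c(a := - d)) x) (p x)) = 0"
      unfolding split by (simp add: d)
    from insert.prems[OF this] show ?thesis using insert.hyps by (metis fun_upd_other insertCI)
  qed
  from insert.IH[OF this]
  have fin: "finite {t. \<exists>c. (\<exists>x\<in>C. c x \<noteq> 0) \<and> [:- t, 1:] ^ card C dvd (\<Sum>x\<in>C. smult (c x) (q x))}"
    (is "finite ?B") .
  have "{t. \<exists>c. (\<exists>x\<in>insert a C. c x \<noteq> 0) \<and>
      [:- t, 1:] ^ card (insert a C) dvd (\<Sum>x\<in>insert a C. smult (c x) (p x))} \<subseteq> ?B \<union> {t. poly (p a) t = 0}"
  proof (rule subsetI, rule ccontr)
    fix t assume t: "t \<in> {t. \<exists>c. (\<exists>x\<in>insert a C. c x \<noteq> 0) \<and>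
      [:- t, 1:] ^ card (insert a C) dvd (\<Sum>x\<in>insert a C. smult (c x) (p x))}"
      and nt: "t \<notin> ?B \<union> {t. poly (p a) t = 0}"
    obtain c where c: "\<exists>x\<in>insert a C. c x \<noteq> 0"
      and dv: "[:- t, 1:] ^ Suc (card C) dvd (\<Sum>x\<in>insert a C. smult (c x) (p x))"
      using t insert.hyps by auto
    define P where "P = (\<Sum>x\<in>insert a C. smult (c x) (p x))"
    have "(\<Sum>x\<in>C. smult (c x) (q x)) = pderiv P * p a - P * pderiv (p a)"
      unfolding sq P_def split by (simp add: pderiv_add pderiv_smult algebra_simps)
    moreover have "[:- t, 1:] ^ card C dvd pderiv P" using dv power_dvd_pderiv unfolding P_def by blast
    moreover have "[:- t, 1:] ^ card C dvd P"
      using dv unfolding P_def by (meson dvd_trans le_imp_power_dvd le_SucI order_refl)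
    ultimately have "[:- t, 1:] ^ card C dvd (\<Sum>x\<in>C. smult (c x) (q x))" by simp
    then have c0: "\<forall>x\<in>C. c x = 0" using nt by blast
    then have "P = smult (c a) (p a)" unfolding P_def split by simp
    moreover have "[:- t, 1:] dvd P" using dv unfolding P_def by (metis dvd_power dvd_trans zero_less_Suc)
    ultimately have "c a = 0" using nt by (simp add: poly_eq_0_iff_dvd[symmetric])
    then show False using c c0 by simp
  qed
  then show ?case using fin poly_roots_finite[OF pa] finite_subset by blast
qed

section \<open>Polynomial functions and generic independence\<close>

text \<open>Functions that are polynomial in the coordinates \<open>a i\<close>.\<close>

inductive_set polynomial_fun :: "(('a \<Rightarrow> 'k::comm_ring_1) \<Rightarrow> 'k) set" where
  const: "(\<lambda>_. c) \<in> polynomial_fun"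
| coord: "(\<lambda>a. a i) \<in> polynomial_fun"
| add: "\<phi> \<in> polynomial_fun \<Longrightarrow> \<psi> \<in> polynomial_fun \<Longrightarrow> (\<lambda>a. \<phi> a + \<psi> a) \<in> polynomial_fun"
| mult: "\<phi> \<in> polynomial_fun \<Longrightarrow> \<psi> \<in> polynomial_fun \<Longrightarrow> (\<lambda>a. \<phi> a * \<psi> a) \<in> polynomial_fun"

lemma polynomial_fun_diff:
  assumes "\<phi> \<in> polynomial_fun" "\<psi> \<in> polynomial_fun"
  shows "(\<lambda>a. \<phi> a - \<psi> a) \<in> polynomial_fun"
  using polynomial_fun.add[OF assms(1) polynomial_fun.mult[OF polynomial_fun.const[of "-1"] assms(2)]]
  by simp

lemma polynomial_fun_prod:
  "(\<And>s. s \<in> A \<Longrightarrow> \<phi> s \<in> polynomial_fun) \<Longrightarrow> (\<lambda>a. \<Prod>s\<in>A. \<phi> s a) \<in> polynomial_fun"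
  by (induction A rule: infinite_finite_induct) (auto intro: polynomial_fun.intros)

lemma polynomial_fun_line:
  assumes "\<phi> \<in> polynomial_fun"
  shows "\<exists>q. \<forall>t. \<phi> (\<lambda>i. a i + t * (b i - a i)) = poly q t"
  using assms
proof induction
  case (const c)
  then show ?case by (intro exI[of _ "[:c:]"]) simp
next
  case (coord i)
  then show ?case by (intro exI[of _ "[:a i, b i - a i:]"]) simp
next
  case (add \<phi> \<psi>)
  then show ?case by (metis poly_add)
next
  case (mult \<phi> \<psi>)
  then show ?case by (metis poly_mult)
qed

text \<open>Nonempty open subsets of a set that contains the lines through its points have a common point: on the line
through two points, a product of nonzero univariate polynomials has a non-root.\<close>

lemma polynomial_fun_nonzero_common:
  fixes \<phi> :: "'s \<Rightarrow> ('a \<Rightarrow> 'k::field_char_0) \<Rightarrow> 'k"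
  assumes line: "\<And>a b t. a \<in> V \<Longrightarrow> b \<in> V \<Longrightarrow> (\<lambda>i. a i + t * (b i - a i)) \<in> V" and "V \<noteq> {}"
    and "finite A" "\<And>s. s \<in> A \<Longrightarrow> \<phi> s \<in> polynomial_fun" "\<And>s. s \<in> A \<Longrightarrow> \<exists>a\<in>V. \<phi> s a \<noteq> 0"
  shows "\<exists>a\<in>V. \<forall>s\<in>A. \<phi> s a \<noteq> 0"
  using assms(3-)
proof (induction A)
  case empty
  then show ?case using assms(2) by auto
next
  case (insert r A)
  obtain a where a: "a \<in> V" "\<forall>s\<in>A. \<phi> s a \<noteq> 0" using insert by auto
  obtain b where b: "b \<in> V" "\<phi> r b \<noteq> 0" using insert.prems(2)[of r] by blast
  obtain p where p: "\<forall>t. (\<Prod>s\<in>A. \<phi> s (\<lambda>i. a i + t * (b i - a i))) = poly p t"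
    using polynomial_fun_line[OF polynomial_fun_prod[of A \<phi>], of a b] insert.prems(1) by auto
  obtain q where q: "\<forall>t. \<phi> r (\<lambda>i. a i + t * (b i - a i)) = poly q t"
    using polynomial_fun_line[of "\<phi> r" a b] insert.prems(1) by auto
  have "poly p 0 \<noteq> 0" 
  proof -
    have "(\<Prod>s\<in>A. \<phi> s a) \<noteq> 0" using a(2) insert.hyps(1) by (simp add: prod_zero_iff)
    then show ?thesis using p[rule_format, of 0] by simp
  qed
  moreover have "poly q 1 \<noteq> 0" using q[rule_format, of 1] b by simp
  ultimately have "p * q \<noteq> 0" by auto
  then have "finite {t. poly (p * q) t = 0}" by (rule poly_roots_finite)
  then obtain t where t: "poly (p * q) t \<noteq> 0"
    using infinite_UNIV_char_0[where 'a = 'k] by (metis (mono_tags, lifting) UNIV_eq_I mem_Collect_eq)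
  then have "\<forall>s\<in>insert r A. \<phi> s (\<lambda>i. a i + t * (b i - a i)) \<noteq> 0"
    using insert.hyps(1) unfolding poly_mult p[rule_format, symmetric] q[rule_format, symmetric]
    by (simp add: prod_zero_iff)
  then show ?case using line[OF a(1) b(1)] by blast
qed

text \<open>Linear independence of finitely many vectors \<open>v j\<close> whose entries \<open>v j x\<close> are polynomial functions is an
open condition. The polynomial \<open>\<phi>\<close> is the product of the pivots met in fraction-free elimination.\<close>

lemma independence_open:
  fixes v :: "'j \<Rightarrow> 'x \<Rightarrow> ('a \<Rightarrow> 'k::field) \<Rightarrow> 'k"
  assumes "finite J" "\<And>j x. j \<in> J \<Longrightarrow> v j x \<in> polynomial_fun"
    and "\<And>c. (\<forall>x. (\<Sum>j\<in>J. c j * v j x a0) = 0) \<Longrightarrow> \<forall>j\<in>J. c j = 0"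
  shows "\<exists>\<phi>\<in>polynomial_fun. \<phi> a0 \<noteq> 0 \<and>
    (\<forall>a. \<phi> a \<noteq> 0 \<longrightarrow> (\<forall>c. (\<forall>x. (\<Sum>j\<in>J. c j * v j x a) = 0) \<longrightarrow> (\<forall>j\<in>J. c j = 0)))"
  using assms
proof (induction J arbitrary: v)
  case empty
  then show ?case by (intro bexI[of _ "\<lambda>_. 1"]) (auto intro: polynomial_fun.intros)
next
  case (insert i J)
  have split: "(\<Sum>j\<in>insert i J. c j * v j x a) = c i * v i x a + (\<Sum>j\<in>J. c j * v j x a)" for c x a
    using insert.hyps by simp
  have "\<exists>y. v i y a0 \<noteq> 0"
  proof (rule ccontr)
    assume "\<nexists>y. v i y a0 \<noteq> 0"
    then have "\<forall>x. (\<Sum>j\<in>insert i J. (if j = i then 1 else 0) * v j x a0) = 0"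
      by (intro allI sum.neutral) auto
    from insert.prems(2)[OF this] show False by simp
  qed
  then obtain y where y: "v i y a0 \<noteq> 0" by blast
  define w where "w j x a = v i y a * v j x a - v j y a * v i x a" for j x a
  have sw: "(\<Sum>j\<in>J. c j * w j x a) =
      v i y a * (\<Sum>j\<in>J. c j * v j x a) - (\<Sum>j\<in>J. c j * v j y a) * v i x a" for c x a
    by (simp only: w_def right_diff_distrib sum_subtractf sum_distrib_left sum_distrib_right mult_ac)
  have "\<exists>\<phi>\<in>polynomial_fun. \<phi> a0 \<noteq> 0 \<and>
    (\<forall>a. \<phi> a \<noteq> 0 \<longrightarrow> (\<forall>c. (\<forall>x. (\<Sum>j\<in>J. c j * w j x a) = 0) \<longrightarrow> (\<forall>j\<in>J. c j = 0)))"
  proof (rule insert.IH)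
    show "w j x \<in> polynomial_fun" if "j \<in> J" for j x
      unfolding w_def[abs_def] using that insert.prems(1)
      by (intro polynomial_fun_diff polynomial_fun.mult) auto
    fix c assume c: "\<forall>x. (\<Sum>j\<in>J. c j * w j x a0) = 0"
    define d where "d = c(i := - (\<Sum>j\<in>J. c j * v j y a0) / v i y a0)"
    have dJ: "(\<Sum>j\<in>J. d j * v j x a0) = (\<Sum>j\<in>J. c j * v j x a0)" for x
      using insert.hyps by (intro sum.cong) (auto simp: d_def)
    have "(\<Sum>j\<in>insert i J. d j * v j x a0) = 0" for x
    proof -
      have "v i y a0 * (\<Sum>j\<in>J. c j * v j x a0) = (\<Sum>j\<in>J. c j * v j y a0) * v i x a0"
        using c[rule_format, of x] unfolding sw by simp
      then have "(\<Sum>j\<in>J. c j * v j x a0) = (\<Sum>j\<in>J. c j * v j y a0) * v i x a0 / v i y a0"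
        using y by (simp add: eq_divide_eq mult.commute)
      then show ?thesis unfolding split dJ by (simp add: d_def)
    qed
    then have "\<forall>j\<in>insert i J. d j = 0" using insert.prems(2)[of d] by blast
    show "\<forall>j\<in>J. c j = 0"
    proof
      fix j assume j: "j \<in> J"
      then have "j \<noteq> i" using insert.hyps by auto
      moreover have "d j = 0" using \<open>\<forall>j\<in>insert i J. d j = 0\<close> j by blast
      ultimately show "c j = 0" by (simp add: d_def)
    qed
  qed
  then obtain \<phi> where \<phi>: "\<phi> \<in> polynomial_fun" "\<phi> a0 \<noteq> 0"
    and imp: "\<And>a c. \<phi> a \<noteq> 0 \<Longrightarrow> (\<forall>x. (\<Sum>j\<in>J. c j * w j x a) = 0) \<Longrightarrow> \<forall>j\<in>J. c j = 0" by blast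
  show ?case
  proof (intro bexI conjI allI impI)
    show "(\<lambda>a. v i y a * \<phi> a) \<in> polynomial_fun"
      using \<phi> insert.prems(1) by (intro polynomial_fun.mult) auto
    show "v i y a0 * \<phi> a0 \<noteq> 0" using y \<phi> by simp
    fix a c assume a: "v i y a * \<phi> a \<noteq> 0" and c: "\<forall>x. (\<Sum>j\<in>insert i J. c j * v j x a) = 0"
    have e: "(\<Sum>j\<in>J. c j * v j x a) = - (c i * v i x a)" for x
      using c[rule_format, of x] unfolding split by (simp only: add_eq_0_iff)
    have w0: "\<forall>x. (\<Sum>j\<in>J. c j * w j x a) = 0" unfolding sw e by simp
    have c0: "\<forall>j\<in>J. c j = 0" using a imp[OF _ w0] by auto
    then have "c i * v i y a = 0" using e[of y] by simp
    then show "\<forall>j\<in>insert i J. c j = 0" using c0 a by simp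
  qed
qed

section \<open>Families whose ranks are maximal\<close>

lemma independent_family_iff:
  fixes g :: "'j \<Rightarrow> ('v, 'k::field) mpoly"
  assumes J: "finite J"
  shows "(\<forall>c. (\<forall>x. (\<Sum>j\<in>J. c j * lookup (g j) x) = 0) \<longrightarrow> (\<forall>j\<in>J. c j = 0)) \<longleftrightarrow>
    inj_on g J \<and> mp.independent (g ` J)" (is "?L \<longleftrightarrow> ?R")
proof -
  have sum0: "(\<forall>x. (\<Sum>j\<in>J. c j * lookup (g j) x) = 0) \<longleftrightarrow> (\<Sum>j\<in>J. smul (c j) (g j)) = 0" for c
  proof -
    have "(\<Sum>j\<in>J. smul (c j) (g j)) = 0 \<longleftrightarrow> (\<forall>x. lookup (\<Sum>j\<in>J. smul (c j) (g j)) x = 0)"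
      by (metis lookup_zero poly_mapping_eqI)
    then show ?thesis by (simp add: lookup_sum)
  qed
  show ?thesis unfolding sum0
  proof
    assume L: "\<forall>c. (\<Sum>j\<in>J. smul (c j) (g j)) = 0 \<longrightarrow> (\<forall>j\<in>J. c j = 0)"
    have inj: "inj_on g J"
    proof (rule inj_onI, rule ccontr)
      fix a b assume ab: "a \<in> J" "b \<in> J" "g a = g b" "a \<noteq> b"
      define c where "c j = (if j = a then 1 else if j = b then -1 else 0 :: 'k)" for j
      have "(\<Sum>j\<in>J. smul (c j) (g j)) = (\<Sum>j\<in>{a, b}. smul (c j) (g j))"
        using J ab by (intro sum.mono_neutral_right) (auto simp: c_def)
      also have "\<dots> = 0" using ab by (simp add: c_def)
      finally have "c a = 0" using L ab(1) by blast
      then show False by (simp add: c_def)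
    qed
    moreover have "mp.independent (g ` J)"
    proof (rule mp.independent_if_scalars_zero)
      fix c x assume *: "(\<Sum>x\<in>g ` J. smul (c x) x) = 0" "x \<in> g ` J"
      then have "(\<Sum>j\<in>J. smul (c (g j)) (g j)) = 0" using inj by (simp add: sum.reindex)
      then have "\<forall>j\<in>J. c (g j) = 0" using L[rule_format, of "\<lambda>j. c (g j)"] by blast
      then show "c x = 0" using * by auto
    qed (use J in simp)
    ultimately show ?R ..
  next
    assume R: ?R
    show "\<forall>c. (\<Sum>j\<in>J. smul (c j) (g j)) = 0 \<longrightarrow> (\<forall>j\<in>J. c j = 0)"
    proof (intro allI impI ballI)
      fix c j assume *: "(\<Sum>j\<in>J. smul (c j) (g j)) = 0" "j \<in> J"
      have "(\<Sum>x\<in>g ` J. smul (c (the_inv_into J g x)) x) = (\<Sum>j\<in>J. smul (c j) (g j))"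
        using R by (simp add: sum.reindex the_inv_into_f_f)
      then have "c (the_inv_into J g (g j)) = 0"
        using mp.independentD[of "g ` J" "g ` J" "\<lambda>x. c (the_inv_into J g x)" "g j"] R * J by auto
      then show "c j = 0" using R * by (simp add: the_inv_into_f_f)
    qed
  qed
qed

lemma polynomial_fun_eval_poly:
  assumes "\<phi> \<in> polynomial_fun"
  shows "\<exists>p. \<forall>a. \<phi> a = eval_poly p a"
proof -
  have ev: "eval_poly p a = subst (\<lambda>c. c) a p" for p :: "('a, 'b) mpoly" and a
    by (simp add: eval_poly_def subst_def)
  have h: "ring_map (\<lambda>c. c :: 'b)" by (simp add: ring_map_def)
  show ?thesis using assms
  proof induction
    case (const c)
    then show ?case by (intro exI[of _ "Poly_Mapping.single 0 c"]) (simp add: ev h)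
  next
    case (coord i)
    then show ?case by (intro exI[of _ "mvar i"]) (simp add: ev h)
  next
    case (add \<phi> \<psi>)
    then obtain p q where "\<forall>a. \<phi> a = eval_poly p a" "\<forall>a. \<psi> a = eval_poly q a" by blast
    then show ?case by (intro exI[of _ "p + q"]) (simp add: ev subst_add[OF h])
  next
    case (mult \<phi> \<psi>)
    then obtain p q where "\<forall>a. \<phi> a = eval_poly p a" "\<forall>a. \<psi> a = eval_poly q a" by blast
    then show ?case by (intro exI[of _ "p * q"]) (simp add: ev subst_mult[OF h])
  qed
qed

text \<open>Generators, as a vector space, of the part of degree \<open>e\<close> of the ideal generated by the \<open>f i\<close> with
\<open>i \<in> N\<close>, where \<open>f i\<close> is homogeneous of degree \<open>d i\<close>.\<close>

definition ideal_gens ::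
  "('i \<Rightarrow> nat) \<Rightarrow> 'i set \<Rightarrow> nat \<Rightarrow> ('i \<Rightarrow> ('v::finite, 'k::comm_ring_1) mpoly) \<Rightarrow> ('v, 'k) mpoly set" where
  "ideal_gens d N e f = {of_monom u * f i | u i. i \<in> N \<and> mono_deg u + d i = e}"

lemma finite_ideal_gens:
  fixes f :: "'i::finite \<Rightarrow> ('v::finite, 'k::comm_ring_1) mpoly"
  shows "finite (ideal_gens d N e f)"
proof -
  have "ideal_gens d N e f \<subseteq> (\<lambda>(u, i). of_monom u * f i) ` ({u. mono_deg u \<le> e} \<times> UNIV)"
    by (auto simp: ideal_gens_def)
  then show ?thesis
    by (rule finite_subset) (intro finite_imageI finite_cartesian_product finite_mono_deg finite)
qed

text \<open>The dimension of the sum of that part of the ideal and the span of the monomials in \<open>W\<close>.\<close>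

abbreviation rank_with ::
  "('i \<Rightarrow> nat) \<Rightarrow> 'i set \<Rightarrow> nat \<Rightarrow> 'v monom set \<Rightarrow> ('i \<Rightarrow> ('v::finite, 'k::field) mpoly) \<Rightarrow> nat" where
  "rank_with d N e W f \<equiv> mp.dim (mp.span (ideal_gens d N e f \<union> of_monom ` W))"

text \<open>All these dimensions up to degree \<open>D\<close> are as large as for any other family of the same degrees.\<close>

definition ranks_maximal ::
  "('i \<Rightarrow> nat) \<Rightarrow> nat \<Rightarrow> ('i \<Rightarrow> ('v::finite, 'k::field) mpoly) \<Rightarrow> bool" where
  "ranks_maximal d D f \<longleftrightarrow> (\<forall>e\<le>D. \<forall>N W. W \<subseteq> {w. mono_deg w = e} \<longrightarrow>
     (\<forall>g\<in>homogeneous_families d :: ('i \<Rightarrow> ('v, 'k) mpoly) set.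
       rank_with d N e W g \<le> rank_with d N e W f))"

text \<open>A family at which the rank is maximal has a maximal independent set of generators. These stay
independent where a suitable polynomial in the coefficients is nonzero.\<close>

lemma maximal_rank_open:
  fixes d :: "'i::finite \<Rightarrow> nat"
  assumes W: "finite (W :: 'v::finite monom set)"
  shows "\<exists>\<phi>\<in>polynomial_fun. (\<exists>f\<in>homogeneous_families d. \<phi> (coeffs_of f) \<noteq> 0) \<and>
    (\<forall>f :: 'i \<Rightarrow> ('v, 'k::field) mpoly. \<phi> (coeffs_of f) \<noteq> 0 \<longrightarrow>
       (\<forall>g\<in>homogeneous_families d :: ('i \<Rightarrow> ('v, 'k) mpoly) set.
         rank_with d N e W g \<le> rank_with d N e W f))"
proof -
  define J :: "('v monom \<times> 'i + 'v monom) set" where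
    "J = Inl ` {(u, i). i \<in> N \<and> mono_deg u + d i = e} \<union> Inr ` W"
  define gen :: "('i \<Rightarrow> ('v, 'k) mpoly) \<Rightarrow> ('v monom \<times> 'i + 'v monom) \<Rightarrow> ('v, 'k) mpoly" where
    "gen f j = (case j of Inl (u, i) \<Rightarrow> of_monom u * f i | Inr w \<Rightarrow> of_monom w)" for f j
  define v :: "('v monom \<times> 'i + 'v monom) \<Rightarrow> 'v monom \<Rightarrow> ('i \<times> 'v monom \<Rightarrow> 'k) \<Rightarrow> 'k" where
    "v j x = (case j of Inl (u, i) \<Rightarrow> if \<exists>z. x = u + z then (\<lambda>a. a (i, x - u)) else (\<lambda>_. 0)
       | Inr w \<Rightarrow> (\<lambda>_. if w = x then 1 else 0))" for j x
  have fin: "finite J"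
  proof -
    have "{(u :: 'v monom, i). i \<in> N \<and> mono_deg u + d i = e} \<subseteq> {u. mono_deg u \<le> e} \<times> UNIV" by auto
    then have "finite {(u :: 'v monom, i). i \<in> N \<and> mono_deg u + d i = e}"
      by (rule finite_subset) (auto intro: finite_mono_deg)
    then show ?thesis using W by (simp add: J_def)
  qed
  have gens: "ideal_gens d N e f \<union> of_monom ` W = gen f ` J" for f
  proof -
    have "ideal_gens d N e f = (\<lambda>(u, i). of_monom u * f i) ` {(u, i). i \<in> N \<and> mono_deg u + d i = e}"
      by (fastforce simp: ideal_gens_def image_def)
    then show ?thesis by (simp add: J_def gen_def image_Un image_image)
  qed
  have lk: "lookup (gen f j) x = v j x (coeffs_of f)" for f j x
  proof (cases j)
    case (Inl p)
    obtain u i where p: "p = (u, i)" by fastforce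
    show ?thesis
    proof (cases "\<exists>z. x = u + z")
      case True
      then show ?thesis
        using Inl p by (auto simp: gen_def v_def coeffs_of_def of_monom_def lookup_single_mult)
    next
      case False
      then have "v j x = (\<lambda>_. 0)" unfolding v_def Inl p by (simp only: sum.case prod.case if_False)
      then show ?thesis using Inl p False by (simp add: gen_def of_monom_def lookup_single_mult_0)
    qed
  next
    case (Inr w)
    then show ?thesis by (simp add: gen_def v_def of_monom_def lookup_single when_def)
  qed
  have v: "v j x \<in> polynomial_fun" for j x
    by (auto simp: v_def intro: polynomial_fun.intros split: sum.split prod.split)
  have ne: "(\<lambda>_. 0) \<in> (homogeneous_families d :: ('i \<Rightarrow> ('v, 'k) mpoly) set)"
    by (simp add: homogeneous_families_def homogeneous_def)
  have bound: "rank_with d N e W f \<le> card J" for f :: "'i \<Rightarrow> ('v, 'k) mpoly"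
    unfolding gens mp.dim_span
    by (rule order.trans[OF mp.dim_le_card[OF mp.span_superset] card_image_le]) (use fin in auto)
  obtain f0 where f0: "f0 \<in> homogeneous_families d"
    and max: "\<And>g :: 'i \<Rightarrow> ('v, 'k) mpoly. g \<in> homogeneous_families d \<Longrightarrow> rank_with d N e W g \<le> rank_with d N e W (f0 :: 'i \<Rightarrow> ('v, 'k) mpoly)"
  proof -
    let ?S = "rank_with d N e W ` (homogeneous_families d :: ('i \<Rightarrow> ('v, 'k) mpoly) set)"
    have fS: "finite ?S" by (rule finite_subset[of _ "{..card J}"]) (use bound in auto)
    moreover have "?S \<noteq> {}" using ne by blast
    ultimately have "Max ?S \<in> ?S" by (rule Max_in)
    then obtain f0 where "f0 \<in> homogeneous_families d" "Max ?S = rank_with d N e W (f0 :: 'i \<Rightarrow> ('v, 'k) mpoly)"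
      by blast
    moreover have "rank_with d N e W g \<le> Max ?S" if "g \<in> homogeneous_families d"
      for g :: "'i \<Rightarrow> ('v, 'k) mpoly"
      using that by (intro Max_ge[OF fS] imageI)
    ultimately show ?thesis by (intro that[of f0]) simp_all
  qed
  obtain B where B: "B \<subseteq> gen f0 ` J" "mp.independent B" "gen f0 ` J \<subseteq> mp.span B"
    using mp.maximal_independent_subset by blast
  from B(1)[unfolded subset_image_inj]
  obtain J0 where J0: "J0 \<subseteq> J" "inj_on (gen f0) J0" "B = gen f0 ` J0" by (elim exE conjE)
  have fin0: "finite J0" using J0(1) fin finite_subset by blast
  have "mp.span (gen f0 ` J) = mp.span B"
    by (intro equalityI mp.span_mono[OF B(1)] mp.span_minimal[OF B(3) mp.subspace_span])
  then have rank0: "rank_with d N e W f0 = card J0"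
    unfolding gens using mp.dim_span_eq_card_independent[OF B(2)] card_image[OF J0(2)] J0(3) by simp
  have "\<exists>\<phi>\<in>polynomial_fun. \<phi> (coeffs_of f0) \<noteq> 0 \<and>
    (\<forall>a. \<phi> a \<noteq> 0 \<longrightarrow> (\<forall>c. (\<forall>x. (\<Sum>j\<in>J0. c j * v j x a) = 0) \<longrightarrow> (\<forall>j\<in>J0. c j = 0)))"
  proof (rule independence_open[OF fin0])
    fix c assume "\<forall>x. (\<Sum>j\<in>J0. c j * v j x (coeffs_of f0)) = 0"
    then show "\<forall>j\<in>J0. c j = 0"
      using independent_family_iff[OF fin0, of "gen f0"] J0 B(2) unfolding lk by blast
  qed (rule v)
  then obtain \<phi> where \<phi>: "\<phi> \<in> polynomial_fun" "\<phi> (coeffs_of f0) \<noteq> 0"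
    and ind: "\<And>a. \<phi> a \<noteq> 0 \<Longrightarrow> \<forall>c. (\<forall>x. (\<Sum>j\<in>J0. c j * v j x a) = 0) \<longrightarrow> (\<forall>j\<in>J0. c j = 0)"
    by blast
  have "card J0 \<le> rank_with d N e W f" if "\<phi> (coeffs_of f) \<noteq> 0" for f :: "'i \<Rightarrow> ('v, 'k) mpoly"
  proof -
    have "inj_on (gen f) J0" "mp.independent (gen f ` J0)"
      using ind[OF that] independent_family_iff[OF fin0, of "gen f"] unfolding lk by blast+
    moreover have "mp.fin_dim (mp.span (gen f ` J))" using fin by (intro mp.fin_dim_span) simp
    moreover have "gen f ` J0 \<subseteq> mp.span (gen f ` J)" using J0(1) mp.span_superset by blast
    ultimately show ?thesis unfolding gens using mp.fin_dim_independent by (metis card_image)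
  qed
  then have "\<forall>f :: 'i \<Rightarrow> ('v, 'k) mpoly. \<phi> (coeffs_of f) \<noteq> 0 \<longrightarrow>
      (\<forall>g\<in>homogeneous_families d :: ('i \<Rightarrow> ('v, 'k) mpoly) set. rank_with d N e W g \<le> rank_with d N e W f)"
    using max unfolding rank0 by (blast intro: order.trans)
  then show ?thesis using \<phi> f0 by blast
qed

lemma generic_ranks_maximal:
  fixes d :: "'i::finite \<Rightarrow> nat"
  shows "\<exists>U :: ('i \<Rightarrow> ('v::finite, 'k::field_char_0) mpoly) set.
    zariski_open_in (homogeneous_families d) U \<and> U \<noteq> {} \<and> (\<forall>f\<in>U. ranks_maximal d D f)"
proof -
  define A where "A = (SIGMA e:{..D}. (UNIV :: 'i set set) \<times> Pow {w :: 'v monom. mono_deg w = e})"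
  have fA: "finite A" unfolding A_def by (auto intro!: finite_SigmaI finite_mono_deg_eq)
  let ?V = "homogeneous_families d :: ('i \<Rightarrow> ('v, 'k) mpoly) set"
  define good where "good s \<phi> \<longleftrightarrow> \<phi> \<in> polynomial_fun \<and> (\<exists>f\<in>?V. \<phi> (coeffs_of f) \<noteq> 0) \<and>
    (\<forall>f. \<phi> (coeffs_of f) \<noteq> 0 \<longrightarrow>
       (\<forall>g\<in>?V. case s of (e, N, W) \<Rightarrow> rank_with d N e W g \<le> rank_with d N e W f))" for s \<phi>
  have "\<exists>\<phi>. good s \<phi>" if "s \<in> A" for s
  proof -
    obtain e N W where s: "s = (e, N, W)" using prod_cases3 by blast
    have "finite W" using that s finite_mono_deg_eq[of e] finite_subset by (auto simp: A_def)
    from maximal_rank_open[OF this, of d N e] show ?thesis unfolding good_def s prod.case by blast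
  qed
  then obtain \<phi> where good: "\<forall>s\<in>A. good s (\<phi> s)" using bchoice[of A good] by blast
  have \<phi>: "\<And>s. s \<in> A \<Longrightarrow> \<phi> s \<in> polynomial_fun"
    "\<And>s. s \<in> A \<Longrightarrow> \<exists>f\<in>?V. \<phi> s (coeffs_of f) \<noteq> 0"
    "\<And>s f g. s \<in> A \<Longrightarrow> \<phi> s (coeffs_of f) \<noteq> 0 \<Longrightarrow> g \<in> ?V \<Longrightarrow>
       (case s of (e, N, W) \<Rightarrow> rank_with d N e W g \<le> rank_with d N e W f)"
    using good unfolding good_def by blast+
  have "\<exists>a\<in>coeffs_of ` ?V. \<forall>s\<in>A. \<phi> s a \<noteq> 0"
  proof (rule polynomial_fun_nonzero_common[OF _ _ fA])
    fix a b :: "'i \<times> 'v monom \<Rightarrow> 'k" and t assume "a \<in> coeffs_of ` ?V" "b \<in> coeffs_of ` ?V"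
    then obtain f g where fg: "f \<in> ?V" "g \<in> ?V" "a = coeffs_of f" "b = coeffs_of g" by blast
    have "(\<lambda>i. a i + t * (b i - a i)) = coeffs_of (\<lambda>i. f i + smul t (g i - f i))"
      by (auto simp: fg coeffs_of_def lookup_add lookup_minus)
    moreover have "(\<lambda>i. f i + smul t (g i - f i)) \<in> ?V"
      using fg(1,2) subspace_homogeneous unfolding homogeneous_families_def
      by (auto intro!: mp.subspace_add mp.subspace_scale mp.subspace_diff)
    ultimately show "(\<lambda>i. a i + t * (b i - a i)) \<in> coeffs_of ` ?V" by blast
  next
    have "(\<lambda>_. 0) \<in> ?V" by (simp add: homogeneous_families_def homogeneous_def)
    then show "coeffs_of ` ?V \<noteq> {}" by blast
  qed (use \<phi> in auto)
  then obtain f where f: "f \<in> ?V" "\<forall>s\<in>A. \<phi> s (coeffs_of f) \<noteq> 0" by blast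
  obtain p where p: "\<And>a. (\<Prod>s\<in>A. \<phi> s a) = eval_poly p a"
    using polynomial_fun_eval_poly[OF polynomial_fun_prod[of A \<phi>]] \<phi>(1) by auto
  define U where "U = ?V - {f. \<forall>q\<in>{p}. eval_poly q (coeffs_of f) = 0}"
  have U: "f \<in> U \<longleftrightarrow> f \<in> ?V \<and> (\<forall>s\<in>A. \<phi> s (coeffs_of f) \<noteq> 0)" for f
    by (simp add: U_def prod_zero_iff[OF fA] flip: p)
  show ?thesis
  proof (intro exI[of _ U] conjI ballI)
    show "zariski_open_in ?V U" unfolding zariski_open_in_def U_def by (rule exI[of _ "{p}"]) simp
    show "U \<noteq> {}" using f U by blast
    fix f assume "f \<in> U"
    then show "ranks_maximal d D f"
      unfolding ranks_maximal_def U using \<phi>(3)[of "(_, _, _)" f] by (auto simp: A_def)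
  qed
qed

section \<open>The Hilbert function of a generic family\<close>

lemma ranks_maximalD:
  fixes f g :: "'i \<Rightarrow> ('v::finite, 'k::field) mpoly"
  assumes "ranks_maximal d D f" "g \<in> homogeneous_families d" "e \<le> D" "W \<subseteq> {w. mono_deg w = e}"
  shows "rank_with d N e W g \<le> rank_with d N e W f"
  using assms unfolding ranks_maximal_def by blast

text \<open>The monomials of degree \<open>e\<close> divisible by \<open>x\<^sub>i ^ d\<^sub>i\<close> for some \<open>i \<in> N\<close>.\<close>

definition monom_part :: "('v \<Rightarrow> nat) \<Rightarrow> 'v set \<Rightarrow> nat \<Rightarrow> ('v::finite monom) set" where
  "monom_part d N e = {w. mono_deg w = e \<and> (\<exists>i\<in>N. d i \<le> lookup w i)}"

lemma monom_part_UNIV: "monom_part d UNIV e = outside_box d e"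
  by (auto simp: monom_part_def outside_box_def not_less)

lemma finite_monom_part [simp]: "finite (monom_part d N e)"
  by (rule finite_subset[OF _ finite_mono_deg_eq[of e]]) (auto simp: monom_part_def)

lemma ideal_gens_mvar_power:
  "mp.span (ideal_gens d N e (\<lambda>i. mvar i ^ d i)) = (supported (monom_part d N e) :: ('v::finite, 'k::field) mpoly set)"
proof -
  have "ideal_gens d N e (\<lambda>i. mvar i ^ d i) = (of_monom ` monom_part d N e :: ('v, 'k) mpoly set)"
  proof (intro equalityI subsetI)
    fix p :: "('v, 'k) mpoly" assume "p \<in> ideal_gens d N e (\<lambda>i. mvar i ^ d i)"
    then obtain u i where "p = of_monom (u + Poly_Mapping.single i (d i))" "i \<in> N" "mono_deg u + d i = e"
      by (auto simp: ideal_gens_def mvar_power of_monom_mult)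
    then show "p \<in> of_monom ` monom_part d N e"
      by (auto simp: monom_part_def mono_deg_add lookup_add intro!: imageI bexI[of _ i])
  next
    fix p :: "('v, 'k) mpoly" assume "p \<in> of_monom ` monom_part d N e"
    then obtain w i where w: "p = of_monom w" "mono_deg w = e" "i \<in> N" "d i \<le> lookup w i"
      by (auto simp: monom_part_def)
    then have "\<exists>z. w = Poly_Mapping.single i (d i) + z"
      unfolding monom_dvd_iff by (simp add: lookup_single when_def)
    then obtain z where z: "w = z + Poly_Mapping.single i (d i)" by (auto simp: add.commute)
    then show "p \<in> ideal_gens d N e (\<lambda>i. mvar i ^ d i)"
      using w unfolding ideal_gens_def mvar_power by (auto simp: of_monom_mult mono_deg_add)
  qed
  then show ?thesis by (simp add: span_of_monom)
qed

lemma span_ideal_gens_homogeneous: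
  assumes "f \<in> homogeneous_families d"
  shows "mp.span (ideal_gens d N e f) \<subseteq> homogeneous e"
proof (rule mp.span_minimal[OF _ subspace_homogeneous])
  show "ideal_gens d N e f \<subseteq> homogeneous e"
    using assms by (auto simp: ideal_gens_def homogeneous_families_def intro!: homogeneous_mult)
qed

lemma fin_dim_ideal_gens:
  "mp.fin_dim (mp.span (ideal_gens d N e (f :: 'i::finite \<Rightarrow> ('v::finite, 'k::field) mpoly)))"
  by (rule mp.fin_dim_span[OF finite_ideal_gens])

lemma homogeneous_span: "homogeneous e = mp.span (of_monom ` {u. mono_deg u = e})"
  by (simp add: span_of_monom homogeneous_supported)

lemma homogeneous_induct [consumes 1, case_names zero add]:
  assumes "g \<in> homogeneous c"
    and "P 0" "\<And>a u q. mono_deg u = c \<Longrightarrow> P q \<Longrightarrow> P (smul a (of_monom u) + q)"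
  shows "P (g :: ('v::finite, 'k::field) mpoly)"
  using assms(1) unfolding homogeneous_span
  by (induction rule: mp.span_induct_alt) (use assms(2,3) in auto)

lemma mult_generator_in_span:
  assumes "g \<in> homogeneous c" "c + d i = e" "i \<in> N"
  shows "(g :: ('v::finite, 'k::field) mpoly) * f i \<in> mp.span (ideal_gens d N e f)"
  using assms(1)
proof (induction rule: homogeneous_induct)
  case zero
  then show ?case by (simp add: mp.span_zero)
next
  case (add a u q)
  have "of_monom u * f i \<in> ideal_gens d N e f" using add assms by (auto simp: ideal_gens_def)
  then have "smul a (of_monom u * f i) + q * f i \<in> mp.span (ideal_gens d N e f)"
    by (intro mp.span_add mp.span_scale mp.span_base add.IH)
  then show ?case by (simp only: distrib_right smul_mult)
qed

lemma mult_in_span_ideal_gens: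
  assumes "y \<in> mp.span (ideal_gens d N e f)" and g: "g \<in> homogeneous c"
  shows "(g :: ('v::finite, 'k::field) mpoly) * y \<in> mp.span (ideal_gens d N (c + e) f)"
  using assms(1)
proof (induction rule: mp.span_induct_alt)
  case base
  then show ?case by (simp add: mp.span_zero)
next
  case (step a x y)
  then obtain u i where x: "x = of_monom u * f i" "i \<in> N" "mono_deg u + d i = e"
    by (auto simp: ideal_gens_def)
  have "g * of_monom u * f i \<in> mp.span (ideal_gens d N (c + e) f)"
    by (rule mult_generator_in_span[OF homogeneous_mult[OF g]]) (use x in auto)
  then have "smul a (g * x) + g * y \<in> mp.span (ideal_gens d N (c + e) f)"
    unfolding x(1) mult.assoc by (intro mp.span_add mp.span_scale step.IH)
  then show ?case by (simp only: distrib_left smul_mult)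
qed

lemma span_ideal_gens_insert:
  fixes f :: "'i \<Rightarrow> ('v::finite, 'k::field) mpoly"
  assumes "d a \<le> e"
  shows "mp.span (ideal_gens d (insert a N) e f) =
    {x + f a * y | x y. x \<in> mp.span (ideal_gens d N e f) \<and> y \<in> homogeneous (e - d a)}"
proof -
  interpret T: Vector_Spaces.linear smul smul "\<lambda>p. f a * p" by (rule linear_mult_left)
  have eq: "ideal_gens d (insert a N) e f =
      ideal_gens d N e f \<union> (\<lambda>p. f a * p) ` of_monom ` {u. mono_deg u = e - d a}"
  proof (intro equalityI subsetI)
    fix p assume "p \<in> ideal_gens d (insert a N) e f"
    then obtain u i where p: "p = of_monom u * f i" "i = a \<or> i \<in> N" "mono_deg u + d i = e"
      by (auto simp: ideal_gens_def)
    show "p \<in> ideal_gens d N e f \<union> (\<lambda>p. f a * p) ` of_monom ` {u. mono_deg u = e - d a}"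
    proof (cases "i \<in> N")
      case True
      then show ?thesis using p by (auto simp: ideal_gens_def)
    next
      case False
      then have "p = f a * of_monom u" "mono_deg u = e - d a" using p by (auto simp: mult.commute)
      then show ?thesis by blast
    qed
  next
    fix p assume "p \<in> ideal_gens d N e f \<union> (\<lambda>p. f a * p) ` of_monom ` {u. mono_deg u = e - d a}"
    then consider "p \<in> ideal_gens d N e f" | u where "p = of_monom u * f a" "mono_deg u = e - d a"
      by (auto simp: mult.commute)
    then show "p \<in> ideal_gens d (insert a N) e f"
    proof cases
      case 2
      then have "p = of_monom u * f a \<and> a \<in> insert a N \<and> mono_deg u + d a = e" using assms by simp
      then show ?thesis unfolding ideal_gens_def by blast
    qed (auto simp: ideal_gens_def)
  qed
  show ?thesis unfolding eq mp.span_Un T.span_image homogeneous_span by blast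
qed

lemma ideal_gens_insert_low:
  "e < d a \<Longrightarrow> ideal_gens d (insert a N) e f = ideal_gens d N e f"
  by (auto simp: ideal_gens_def)

lemma card_monom_part_insert:
  fixes d :: "'v::finite \<Rightarrow> nat"
  assumes "a \<notin> N" "d a \<le> e"
  shows "card (monom_part d (insert a N) e) + card (monom_part d N (e - d a)) =
    card (monom_part d N e) + card {u :: 'v monom. mono_deg u = e - d a}"
proof -
  define A where "A = {u :: 'v monom. mono_deg u = e \<and> d a \<le> lookup u a}"
  define s where "s z = z + Poly_Mapping.single a (d a)" for z :: "'v monom"
  have inj: "inj_on s M" for M by (simp add: inj_on_def s_def)
  have surj: "\<exists>z. w = s z \<and> mono_deg z = e - d a" if "w \<in> A" for w
  proof -
    have "\<exists>z. w = Poly_Mapping.single a (d a) + z"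
      using that unfolding monom_dvd_iff by (auto simp: A_def lookup_single when_def)
    then obtain z where "w = s z" by (auto simp: s_def add.commute)
    then show ?thesis using that by (auto simp: A_def s_def mono_deg_add)
  qed
  have A: "A = s ` {u. mono_deg u = e - d a}"
    using surj assms(2) by (auto simp: A_def s_def mono_deg_add lookup_add)
  have cap: "monom_part d N e \<inter> A = s ` monom_part d N (e - d a)"
  proof (intro equalityI subsetI)
    fix w assume w: "w \<in> monom_part d N e \<inter> A"
    then obtain z where z: "w = s z" "mono_deg z = e - d a" using surj by blast
    obtain i where i: "i \<in> N" "d i \<le> lookup w i" using w by (auto simp: monom_part_def)
    then have "lookup w i = lookup z i" using assms(1) by (auto simp: z s_def lookup_add lookup_single when_def)
    then show "w \<in> s ` monom_part d N (e - d a)" using z i by (auto simp: monom_part_def)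
  qed (use assms in \<open>auto simp: monom_part_def A_def s_def mono_deg_add lookup_add intro!: bexI trans_le_add1\<close>)
  have "monom_part d (insert a N) e = monom_part d N e \<union> A"
    by (auto simp: monom_part_def A_def)
  moreover have "finite A" by (rule finite_subset[OF _ finite_mono_deg_eq[of e]]) (auto simp: A_def)
  ultimately have "card (monom_part d (insert a N) e) + card (monom_part d N e \<inter> A) = card (monom_part d N e) + card A"
    using card_Un_Int[OF finite_monom_part, of A d N e] by simp
  then show ?thesis unfolding cap unfolding A card_image[OF inj] .
qed

lemma mvar_power_families: "(\<lambda>i. mvar i ^ d i) \<in> (homogeneous_families d :: ('v \<Rightarrow> ('v::finite, 'k::comm_ring_1) mpoly) set)"
  by (simp add: homogeneous_families_def mvar_power)

text \<open>Maximality against the family \<open>x\<^sub>i ^ d\<^sub>i\<close> gives one inequality. The other is an induction on the set \<open>N\<close> of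
generators: adding \<open>f\<^sub>a\<close> adds at most the dimension of the quotient by the previous generators in
degree \<open>e - d\<^sub>a\<close>, which is known exactly, and for \<open>x\<^sub>i ^ d\<^sub>i\<close> it adds that much.\<close>

lemma generic_hilbert_function:
  fixes f :: "'v::finite \<Rightarrow> ('v, 'k::field) mpoly"
  assumes f: "f \<in> homogeneous_families d" and m: "ranks_maximal d D f" and "e \<le> D"
  shows "mp.dim (mp.span (ideal_gens d N e f)) = card (monom_part d N e)"
proof -
  have "finite N" by simp
  then show ?thesis using \<open>e \<le> D\<close>
  proof (induction N arbitrary: e)
    case empty
    have "ideal_gens d {} e f = {}" "monom_part d {} e = {}" by (auto simp: ideal_gens_def monom_part_def)
    then show ?case using mp.dim_eq_card_independent[OF mp.independent_empty] by (simp del: mp.span_empty)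
  next
    case (insert a N)
    show ?case
    proof (cases "d a \<le> e")
      case False
      moreover have "monom_part d (insert a N) e = monom_part d N e"
      proof -
        have "lookup w a \<le> mono_deg w" for w :: "'v monom" unfolding mono_deg_def by (rule member_le_sum) auto
        then have "\<not> d a \<le> lookup w a" if "mono_deg w = e" for w :: "'v monom"
          using False that by (metis order.trans)
        then show ?thesis by (auto simp: monom_part_def)
      qed
      ultimately show ?thesis using insert by (simp add: ideal_gens_insert_low)
    next
      case True
      let ?Q = "\<lambda>e. mp.span (ideal_gens d N e f)"
      let ?R = "mp.span (ideal_gens d (insert a N) e f)"
      let ?K = "{y \<in> homogeneous (e - d a). f a * y \<in> ?Q e}"
      have "mp.dim ?R + mp.dim ?K = mp.dim (?Q e) + mp.dim (homogeneous (e - d a) :: ('v, 'k) mpoly set)"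
        unfolding span_ideal_gens_insert[where d = d and a = a and e = e, OF True]
        by (rule mp.dim_sum_image[OF linear_mult_left mp.subspace_span fin_dim_ideal_gens subspace_homogeneous fin_dim_homogeneous])
      moreover have "mp.dim (?Q (e - d a)) \<le> mp.dim ?K"
      proof (rule mp.fin_dim_dim_mono)
        show "mp.fin_dim ?K" by (rule mp.fin_dim_subset[OF fin_dim_homogeneous]) auto
        have "f a \<in> homogeneous (d a)" using f by (simp add: homogeneous_families_def)
        then have "f a * y \<in> ?Q e" if "y \<in> ?Q (e - d a)" for y
          using mult_in_span_ideal_gens[OF that] True by fastforce
        then show "?Q (e - d a) \<subseteq> ?K" using span_ideal_gens_homogeneous[OF f] by blast
      qed
      moreover have "mp.dim (?Q e) = card (monom_part d N e)" "mp.dim (?Q (e - d a)) = card (monom_part d N (e - d a))"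
        using insert.IH insert.prems by auto
      ultimately have "mp.dim ?R \<le> card (monom_part d (insert a N) e)"
        using card_monom_part_insert[where d = d and a = a and e = e, OF insert.hyps(2) True] by (simp add: homogeneous_supported dim_supported)
      moreover have "card (monom_part d (insert a N) e) \<le> mp.dim ?R"
      proof -
        have "rank_with d (insert a N) e {} (\<lambda>i. mvar i ^ d i :: ('v, 'k) mpoly) \<le> rank_with d (insert a N) e {} f"
          by (rule ranks_maximalD[OF m mvar_power_families insert.prems]) simp
        then show ?thesis by (simp add: ideal_gens_mvar_power dim_supported del: mp.dim_span)
      qed
      ultimately show ?thesis by simp
    qed
  qed
qed

text \<open>A linear change of coordinates, with \<open>y\<close> inverse to \<open>z\<close>, carries the ideal of \<open>f\<close> to the ideal
of the transformed family.\<close>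

lemma span_ideal_gens_msubst:
  fixes f :: "'i \<Rightarrow> ('v::finite, 'k::field) mpoly"
  assumes y: "\<And>i. y i \<in> homogeneous 1" and z: "\<And>i. z i \<in> homogeneous 1"
    and yz: "\<And>i. msubst y (z i) = mvar i" and zy: "\<And>i. msubst z (y i) = (mvar i :: ('v, 'k) mpoly)"
  shows "mp.span (ideal_gens d N e (\<lambda>i. msubst z (f i))) = msubst z ` mp.span (ideal_gens d N e f)"
proof -
  have sub: "msubst w ` mp.span (ideal_gens d N e g) \<subseteq> mp.span (ideal_gens d N e (\<lambda>i. msubst w (g i)))"
    if w: "\<And>i. w i \<in> homogeneous 1" for w :: "'v \<Rightarrow> ('v, 'k) mpoly" and g :: "'i \<Rightarrow> ('v, 'k) mpoly"
  proof -
    interpret T: Vector_Spaces.linear smul smul "msubst w" by (rule linear_msubst)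
    have "msubst w ` ideal_gens d N e g \<subseteq> mp.span (ideal_gens d N e (\<lambda>i. msubst w (g i)))"
    proof
      fix p assume "p \<in> msubst w ` ideal_gens d N e g"
      then obtain u i where p: "p = msubst w (of_monom u) * msubst w (g i)" "i \<in> N" "mono_deg u + d i = e"
        by (auto simp: ideal_gens_def subst_mult[OF ring_map_single_0])
      have "msubst w (of_monom u) \<in> homogeneous (mono_deg u)" by (rule msubst_homogeneous[OF w]) simp
      then show "p \<in> mp.span (ideal_gens d N e (\<lambda>i. msubst w (g i)))"
        unfolding p(1) by (rule mult_generator_in_span) (use p in auto)
    qed
    then show ?thesis unfolding T.span_image[symmetric] by (rule mp.span_minimal[OF _ mp.subspace_span])
  qed
  show ?thesis
  proof
    show "msubst z ` mp.span (ideal_gens d N e f) \<subseteq> mp.span (ideal_gens d N e (\<lambda>i. msubst z (f i)))"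
      by (rule sub[where w = z, OF z])
    show "mp.span (ideal_gens d N e (\<lambda>i. msubst z (f i))) \<subseteq> msubst z ` mp.span (ideal_gens d N e f)"
    proof
      fix p assume "p \<in> mp.span (ideal_gens d N e (\<lambda>i. msubst z (f i)))"
      then have "msubst y p \<in> mp.span (ideal_gens d N e f)"
        using sub[where w = y and g = "\<lambda>i. msubst z (f i)", OF y] by (auto simp: msubst_inverse[where y = y and z = z, OF yz])
      then show "p \<in> msubst z ` mp.span (ideal_gens d N e f)"
        using msubst_inverse[where y = z and z = y, OF zy, of p] by (metis imageI)
    qed
  qed
qed

lemma msubst_homogeneous_image:
  fixes y z :: "'v::finite \<Rightarrow> ('v, 'k::field) mpoly"
  assumes y: "\<And>i. y i \<in> homogeneous 1" and z: "\<And>i. z i \<in> homogeneous 1"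
    and zy: "\<And>i. msubst z (y i) = mvar i"
  shows "msubst z ` homogeneous e = homogeneous e"
proof (intro equalityI subsetI)
  fix p :: "('v, 'k) mpoly" assume "p \<in> homogeneous e"
  then have "msubst y p \<in> homogeneous e" "p = msubst z (msubst y p)"
    using msubst_homogeneous[where y = y, OF y] msubst_inverse[where y = z and z = y, OF zy, of p] by auto
  then show "p \<in> msubst z ` homogeneous e" by (rule rev_image_eqI)
qed (use msubst_homogeneous[where y = z, OF z] in auto)

section \<open>The Lefschetz property of a generic family\<close>

lemma span_ideal_gens_Un_mvar_power:
  fixes f :: "'i \<Rightarrow> ('v::finite, 'k::field) mpoly"
  shows "mp.span (ideal_gens d N (j + c) f \<union> of_monom ` {w. mono_deg w = j + c \<and> c \<le> lookup w k}) =
    {x + mvar k ^ c * y | x y. x \<in> mp.span (ideal_gens d N (j + c) f) \<and> y \<in> homogeneous j}"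
proof -
  interpret T: Vector_Spaces.linear smul smul "\<lambda>p :: ('v, 'k) mpoly. mvar k ^ c * p" by (rule linear_mult_left)
  have "{w :: 'v monom. mono_deg w = j + c \<and> c \<le> lookup w k} = (\<lambda>u. Poly_Mapping.single k c + u) ` {u. mono_deg u = j}"
  proof (intro equalityI subsetI)
    fix w :: "'v monom" assume w: "w \<in> {w. mono_deg w = j + c \<and> c \<le> lookup w k}"
    then have "\<exists>z. w = Poly_Mapping.single k c + z"
      unfolding monom_dvd_iff by (auto simp: lookup_single when_def)
    then show "w \<in> (\<lambda>u. Poly_Mapping.single k c + u) ` {u. mono_deg u = j}"
      using w by (auto simp: mono_deg_add)
  qed (auto simp: mono_deg_add lookup_add)
  then have eq: "of_monom ` {w. mono_deg w = j + c \<and> c \<le> lookup w k} =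
      (\<lambda>p :: ('v, 'k) mpoly. mvar k ^ c * p) ` of_monom ` {u. mono_deg u = j}"
    by (simp add: image_image mvar_power of_monom_mult)
  show ?thesis unfolding eq mp.span_Un T.span_image homogeneous_span by blast
qed

text \<open>The family to compare with is \<open>x\<^sub>i ^ d\<^sub>i\<close> after the change of coordinates \<open>z\<close>, which takes the sum \<open>L\<close> of
the variables to the single variable \<open>x\<^sub>k\<close>.\<close>

lemma generic_lefschetz:
  fixes f :: "'v::finite \<Rightarrow> ('v, 'k::field_char_0) mpoly"
  assumes d: "\<And>i. d i > 0" and f: "f \<in> homogeneous_families d" and m: "ranks_maximal d D f"
    and D: "j + c \<le> D"
  shows "2 * j + c \<le> (\<Sum>i\<in>UNIV. d i - 1) \<Longrightarrow> g \<in> homogeneous j \<Longrightarrow>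
      mvar k ^ c * g \<in> mp.span (ideal_gens d UNIV (j + c) f) \<Longrightarrow> g \<in> mp.span (ideal_gens d UNIV j f)"
    and "2 * j + c \<ge> (\<Sum>i\<in>UNIV. d i - 1) \<Longrightarrow>
      {x + mvar k ^ c * y | x y. x \<in> mp.span (ideal_gens d UNIV (j + c) f) \<and> y \<in> homogeneous j} = homogeneous (j + c)"
proof -
  define L where "L = (\<Sum>i\<in>UNIV. mvar i :: ('v, 'k) mpoly)"
  define z where "z i = (if i = k then mvar k - (\<Sum>i\<in>UNIV - {k}. mvar i) else mvar i :: ('v, 'k) mpoly)" for i
  define y where "y i = (if i = k then L else mvar i :: ('v, 'k) mpoly)" for i
  have L: "L = mvar k + (\<Sum>i\<in>UNIV - {k}. mvar i)" unfolding L_def by (rule sum.remove) auto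
  have sum_hom: "(\<Sum>i\<in>A. mvar i :: ('v, 'k) mpoly) \<in> homogeneous 1" for A
    by (rule mp.subspace_sum[OF subspace_homogeneous mvar_homogeneous])
  have z1: "z i \<in> homogeneous 1" for i
    unfolding z_def using mvar_homogeneous sum_hom by (auto intro!: mp.subspace_diff[OF subspace_homogeneous])
  have y1: "y i \<in> homogeneous 1" for i
    unfolding y_def L_def using mvar_homogeneous sum_hom by auto
  note h = ring_map_single_0
  have msum: "msubst w (\<Sum>i\<in>A. g i) = (\<Sum>i\<in>A. msubst w (g i))"
    for w :: "'v \<Rightarrow> ('v, 'k) mpoly" and g :: "'v \<Rightarrow> ('v, 'k) mpoly" and A
    by (induction A rule: infinite_finite_induct) (simp_all add: subst_add[OF h])
  have rest: "msubst w (\<Sum>i\<in>UNIV - {k}. mvar i) = (\<Sum>i\<in>UNIV - {k}. mvar i)"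
    if "\<And>i. i \<noteq> k \<Longrightarrow> w i = mvar i" for w :: "'v \<Rightarrow> ('v, 'k) mpoly"
    unfolding msum by (intro sum.cong) (auto simp: that h)
  have zL: "msubst z L = mvar k"
    unfolding L subst_add[OF h] by (subst rest) (auto simp: z_def h)
  have zy: "msubst z (y i) = mvar i" for i
    using zL by (simp add: y_def h z_def)
  have yz: "msubst y (z i) = mvar i" for i
  proof (cases "i = k")
    case True
    have "msubst y (z k) + (\<Sum>i\<in>UNIV - {k}. mvar i) = msubst y (z k + (\<Sum>i\<in>UNIV - {k}. mvar i))"
      unfolding subst_add[OF h] by (subst rest) (auto simp: y_def)
    also have "\<dots> = L" by (simp add: z_def h y_def)
    finally show ?thesis using True by (simp add: L)
  qed (simp add: z_def y_def h)
  define e where "e = j + c"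
  define h0 where "h0 i = msubst z (mvar i ^ d i)" for i
  have h0: "h0 \<in> homogeneous_families d"
    unfolding homogeneous_families_def h0_def
    using msubst_homogeneous[where y = z, OF z1] mvar_power_families[where d = d] by (auto simp: homogeneous_families_def)
  have Q0: "mp.span (ideal_gens d UNIV e h0) = msubst z ` supported (outside_box d e)"
    unfolding h0_def
    by (subst span_ideal_gens_msubst[where y = y, OF y1 z1 yz zy]) (simp only: ideal_gens_mvar_power monom_part_UNIV)
  have homz: "msubst z ` homogeneous n = homogeneous n" for n
    by (rule msubst_homogeneous_image[where y = y and z = z, OF y1 z1 zy])
  let ?R = "\<lambda>f. {x + mvar k ^ c * y | x y. x \<in> mp.span (ideal_gens d UNIV e f) \<and> y \<in> homogeneous j}"
  let ?RL = "{x + L ^ c * y | x y. x \<in> supported (outside_box d e) \<and> y \<in> homogeneous j}"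
  have R0: "?R h0 = msubst z ` ?RL"
  proof (intro equalityI subsetI)
    fix p assume "p \<in> ?R h0"
    then obtain a b' where ab: "a \<in> supported (outside_box d e)" "b' \<in> homogeneous j"
      "p = msubst z a + mvar k ^ c * b'" unfolding Q0 by blast
    then obtain b where b: "b \<in> homogeneous j" "b' = msubst z b" using homz[of j] by blast
    then have "p = msubst z (a + L ^ c * b)"
      using ab(3) by (simp only: subst_add[OF h] subst_mult[OF h] subst_power[OF h] zL)
    then show "p \<in> msubst z ` ?RL" using ab(1) b(1) by blast
  next
    fix p assume "p \<in> msubst z ` ?RL"
    then obtain a b where ab: "a \<in> supported (outside_box d e)" "b \<in> homogeneous j" "p = msubst z (a + L ^ c * b)"
      by blast
    then have "p = msubst z a + mvar k ^ c * msubst z b"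
      by (simp only: subst_add[OF h] subst_mult[OF h] subst_power[OF h] zL)
    then show "p \<in> ?R h0" using ab homz[of j] unfolding Q0 by blast
  qed
  have out: "supported (outside_box d n) \<subseteq> (homogeneous n :: ('v, 'k) mpoly set)" for n
    unfolding homogeneous_supported by (rule supported_mono) (auto simp: outside_box_def)
  have Xs: "mp.subspace (supported (outside_box d e) :: ('v, 'k) mpoly set)"
    "mp.fin_dim (supported (outside_box d e) :: ('v, 'k) mpoly set)"
    by (rule subspace_supported, rule mp.fin_dim_subset[OF fin_dim_homogeneous out])
  have Lk: "L ^ c * q \<in> homogeneous e" if "q \<in> homogeneous j" for q
    using homogeneous_mult[OF homogeneous_power[OF sum_hom[of UNIV], of c] that]
    by (simp add: L_def e_def add.commute)
  have xk: "mvar k ^ c * q \<in> homogeneous e" if "q \<in> homogeneous j" for q :: "('v, 'k) mpoly"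
    using homogeneous_mult[OF homogeneous_power[OF mvar_homogeneous, of k c] that]
    by (simp add: e_def add.commute)
  have R0_sub: "?RL \<subseteq> homogeneous e"
    using out Lk by (auto intro!: mp.subspace_add[OF subspace_homogeneous])
  have R_sub: "?R f \<subseteq> homogeneous e"
    using span_ideal_gens_homogeneous[OF f, of UNIV e] xk
    by (auto intro!: mp.subspace_add[OF subspace_homogeneous])
  have dim_R0: "mp.dim (?R h0) = mp.dim ?RL"
    unfolding R0
  proof (rule mp.dim_image_inj[OF linear_msubst])
    show "inj_on (msubst z) ?RL"
      by (rule inj_on_inverseI[of _ "msubst y"]) (rule msubst_inverse[where y = y and z = z, OF yz])
    show "mp.subspace ?RL"
      by (rule mp.subspace_sum_image[OF linear_mult_left Xs(1) subspace_homogeneous])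
    show "mp.fin_dim ?RL" by (rule mp.fin_dim_subset[OF fin_dim_homogeneous R0_sub])
  qed
  have "rank_with d UNIV e {w. mono_deg w = e \<and> c \<le> lookup w k} h0 \<le>
      rank_with d UNIV e {w. mono_deg w = e \<and> c \<le> lookup w k} f"
    by (rule ranks_maximalD[OF m h0]) (use D in \<open>auto simp: e_def\<close>)
  then have "mp.dim (?R h0) \<le> mp.dim (?R f)"
    unfolding e_def span_ideal_gens_Un_mvar_power .
  then have le: "mp.dim ?RL \<le> mp.dim (?R f)" unfolding dim_R0 .
  show "{x + mvar k ^ c * y | x y. x \<in> mp.span (ideal_gens d UNIV (j + c) f) \<and> y \<in> homogeneous j} = homogeneous (j + c)"
    if "2 * j + c \<ge> (\<Sum>i\<in>UNIV. d i - 1)"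
  proof -
    have "?RL = homogeneous e"
      unfolding L_def e_def by (rule lefschetz_surjective[where d = d, OF d that])
    then have "mp.dim (homogeneous e :: ('v, 'k) mpoly set) \<le> mp.dim (?R f)" using le by simp
    then have "?R f = homogeneous e"
      by (intro mp.fin_dim_subspace_eq[OF fin_dim_homogeneous _ subspace_homogeneous R_sub]
          mp.subspace_sum_image[OF linear_mult_left mp.subspace_span subspace_homogeneous])
    then show ?thesis by (simp only: e_def)
  qed
  show "g \<in> mp.span (ideal_gens d UNIV j f)"
    if c: "2 * j + c \<le> (\<Sum>i\<in>UNIV. d i - 1)" and g: "g \<in> homogeneous j"
      and xg: "mvar k ^ c * g \<in> mp.span (ideal_gens d UNIV (j + c) f)"
  proof -
    let ?Q = "mp.span (ideal_gens d UNIV j f)"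
    let ?KL = "{q \<in> homogeneous j. L ^ c * q \<in> supported (outside_box d e)}"
    let ?K = "{q \<in> homogeneous j. mvar k ^ c * q \<in> mp.span (ideal_gens d UNIV e f)}"
    have fK: "mp.fin_dim ?K" by (rule mp.fin_dim_subset[OF fin_dim_homogeneous]) auto
    have K0: "?KL \<subseteq> supported (outside_box d j)"
      unfolding L_def e_def using lefschetz_injective[where d = d and j = j and c = c, OF d c] by blast
    have "mp.dim ?RL + mp.dim ?KL = mp.dim (supported (outside_box d e) :: ('v, 'k) mpoly set)
        + mp.dim (homogeneous j :: ('v, 'k) mpoly set)"
      by (rule mp.dim_sum_image[OF linear_mult_left Xs subspace_homogeneous fin_dim_homogeneous])
    moreover have "mp.dim (?R f) + mp.dim ?K = mp.dim (mp.span (ideal_gens d UNIV e f))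
        + mp.dim (homogeneous j :: ('v, 'k) mpoly set)"
      by (rule mp.dim_sum_image[OF linear_mult_left mp.subspace_span fin_dim_ideal_gens
            subspace_homogeneous fin_dim_homogeneous])
    moreover have "mp.dim ?KL \<le> mp.dim (supported (outside_box d j) :: ('v, 'k) mpoly set)"
      by (rule mp.fin_dim_dim_mono[OF mp.fin_dim_subset[OF fin_dim_homogeneous out] K0])
    moreover have "mp.dim (supported (outside_box d n) :: ('v, 'k) mpoly set) =
        mp.dim (mp.span (ideal_gens d UNIV n f))" if "n \<le> e" for n
      using generic_hilbert_function[OF f m, of n UNIV] that D
      by (simp add: e_def dim_supported monom_part_UNIV del: mp.dim_span)
    ultimately have "mp.dim ?K \<le> mp.dim ?Q" using le by (simp add: e_def del: mp.dim_span)
    moreover have "?Q \<subseteq> ?K"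
    proof
      fix q assume q: "q \<in> ?Q"
      have "mvar k ^ c * q \<in> mp.span (ideal_gens d UNIV (c * 1 + j) f)"
        by (rule mult_in_span_ideal_gens[OF q homogeneous_power[OF mvar_homogeneous]])
      then show "q \<in> ?K" using q span_ideal_gens_homogeneous[OF f] by (auto simp: e_def add.commute)
    qed
    moreover have "mp.subspace ?K"
      unfolding mp.subspace_def
      by (auto simp: mp.subspace_0[OF subspace_homogeneous] mp.span_zero distrib_left smul_mult
          intro!: mp.subspace_add[OF subspace_homogeneous] mp.subspace_scale[OF subspace_homogeneous]
            mp.span_add mp.span_scale)
    ultimately have "?Q = ?K"
      by (intro mp.fin_dim_subspace_eq[OF fK mp.subspace_span])
    then show ?thesis using g xg unfolding e_def by blast
  qed
qed

lemma generic_ideal_high_degree: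
  fixes f :: "'v::finite \<Rightarrow> ('v, 'k::field) mpoly"
  assumes d: "\<And>i. d i > 0" and f: "f \<in> homogeneous_families d" and m: "ranks_maximal d D f"
    and e: "(\<Sum>i\<in>UNIV. d i - 1) < e" "e \<le> D"
  shows "mp.span (ideal_gens d UNIV e f) = homogeneous e"
proof -
  have "outside_box d e = {w. mono_deg w = e}"
    using box_empty[where d = d, OF d e(1)] by (auto simp: outside_box_def)
  then have "mp.dim (homogeneous e :: ('v, 'k) mpoly set) \<le> mp.dim (mp.span (ideal_gens d UNIV e f))"
    using generic_hilbert_function[OF f m e(2), of UNIV]
    by (simp add: homogeneous_supported dim_supported monom_part_UNIV del: mp.dim_span)
  then show ?thesis
    by (intro mp.fin_dim_subspace_eq[OF fin_dim_homogeneous mp.subspace_span subspace_homogeneous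
          span_ideal_gens_homogeneous[OF f]])
qed

section \<open>Initial monomials and minimal generators\<close>

lemma of_monom_in_monom_ideal:
  "(of_monom w :: ('v, 'k::comm_ring_1) mpoly) \<in> ideal_gen (of_monom ` G) \<longleftrightarrow> (\<exists>g\<in>G. \<exists>z. w = g + z)"
proof
  let ?T = "{p :: ('v, 'k) mpoly. \<forall>w\<in>keys p. \<exists>g\<in>G. \<exists>z. w = g + z}"
  have "ideal.subspace ?T"
  proof (rule ideal.subspaceI)
    show "p + q \<in> ?T" if "p \<in> ?T" "q \<in> ?T" for p q
      using that keys_add[of p q] by blast
    show "c * p \<in> ?T" if p: "p \<in> ?T" for c p
    proof (rule CollectI, rule ballI)
      fix w assume "w \<in> keys (c * p)"
      then obtain a b where "w = a + b" "b \<in> keys p" using keys_mult[of c p] by blast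
      moreover obtain g z where "g \<in> G" "b = g + z" using p calculation(2) by blast
      ultimately show "\<exists>g\<in>G. \<exists>z. w = g + z" by (metis add.assoc add.commute)
    qed
  qed simp
  moreover have "of_monom ` G \<subseteq> ?T"
  proof safe
    fix g w assume "g \<in> G" "w \<in> keys (of_monom g :: ('v, 'k) mpoly)"
    then show "\<exists>g\<in>G. \<exists>z. w = g + z" by (intro bexI[of _ g] exI[of _ 0]) (auto simp: of_monom_def)
  qed
  ultimately have sub: "ideal_gen (of_monom ` G) \<subseteq> ?T" by (intro ideal.span_minimal)
  assume "(of_monom w :: ('v, 'k) mpoly) \<in> ideal_gen (of_monom ` G)"
  then show "\<exists>g\<in>G. \<exists>z. w = g + z" using sub by (auto simp: of_monom_def)
next
  assume "\<exists>g\<in>G. \<exists>z. w = g + z"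
  then obtain g z where g: "g \<in> G" "w = g + z" by blast
  have "of_monom z * of_monom g \<in> (ideal_gen (of_monom ` G) :: ('v, 'k) mpoly set)"
    using g(1) by (intro ideal.span_scale ideal.span_base) simp
  then show "(of_monom w :: ('v, 'k) mpoly) \<in> ideal_gen (of_monom ` G)"
    using g(2) by (simp add: of_monom_mult add.commute)
qed

lemma monom_ideal_eqI:
  assumes "\<And>w. (\<exists>g\<in>G. \<exists>z. w = g + z) \<longleftrightarrow> (\<exists>g\<in>H. \<exists>z. w = g + z)"
  shows "ideal_gen (of_monom ` G) = (ideal_gen (of_monom ` H) :: ('v, 'k::comm_ring_1) mpoly set)"
proof -
  have "of_monom ` A \<subseteq> (ideal_gen (of_monom ` B) :: ('v, 'k) mpoly set)"
    if "\<And>w. (\<exists>g\<in>A. \<exists>z. w = g + z) \<longleftrightarrow> (\<exists>g\<in>B. \<exists>z. w = g + z)" for A B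
  proof safe
    fix w assume "w \<in> A"
    then have "\<exists>g\<in>A. \<exists>z. w = g + z" by (intro bexI[of _ w] exI[of _ 0]) auto
    then show "(of_monom w :: ('v, 'k) mpoly) \<in> ideal_gen (of_monom ` B)"
      unfolding of_monom_in_monom_ideal that .
  qed
  from this[of G H] this[of H G] show ?thesis
    using assms by (intro equalityI ideal.span_minimal ideal.subspace_span) auto
qed

text \<open>The set \<open>M\<close>, being closed under multiples, consists of all monomials of the ideal, hence the minimal generators are the elements of
\<open>M\<close> that no other element of \<open>M\<close> divides.\<close>

lemma minimal_monom_gen_ideal:
  assumes "minimal_monom_gen (ideal_gen (of_monom ` M) :: ('v, 'k::comm_ring_1) mpoly set) u"
    and up: "\<And>w z. w \<in> M \<Longrightarrow> w + z \<in> M"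
  shows "u \<in> M" "u = w + z \<Longrightarrow> w \<in> M \<Longrightarrow> z = 0"
proof -
  obtain G where G: "u \<in> G" and gen: "ideal_gen (of_monom ` G) = (ideal_gen (of_monom ` M) :: ('v, 'k) mpoly set)"
    and min: "\<And>H. H \<subset> G \<Longrightarrow> ideal_gen (of_monom ` H) \<noteq> (ideal_gen (of_monom ` M) :: ('v, 'k) mpoly set)"
    using assms(1) unfolding minimal_monom_gen_def monom_gens_def by blast
  have mem: "(\<exists>g\<in>G. \<exists>z. w = g + z) \<longleftrightarrow> w \<in> M" for w
  proof -
    have "(\<exists>g\<in>G. \<exists>z. w = g + z) \<longleftrightarrow> (\<exists>g\<in>M. \<exists>z. w = g + z)"
      using gen unfolding of_monom_in_monom_ideal[where 'k = 'k, symmetric] by simp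
    also have "\<dots> \<longleftrightarrow> w \<in> M" using up by (metis add_0_right)
    finally show ?thesis .
  qed
  show "u \<in> M" unfolding mem[symmetric] using G by (metis add_0_right)
  assume u: "u = w + z" "w \<in> M"
  then obtain g y where g: "g \<in> G" "w = g + y" using mem by blast
  show "z = 0"
  proof (rule ccontr)
    assume z: "z \<noteq> 0"
    have "g \<noteq> u"
    proof
      assume "g = u"
      then have "y + z = 0" using u(1) g(2) by (simp add: add.assoc)
      then have "lookup y i + lookup z i = 0" for i by (metis lookup_add lookup_zero)
      then have "z = 0" by (intro poly_mapping_eqI) simp
      then show False using z by simp
    qed
    have "ideal_gen (of_monom ` (G - {u})) = (ideal_gen (of_monom ` G) :: ('v, 'k) mpoly set)"
    proof (rule monom_ideal_eqI, rule iffI)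
      fix v assume "\<exists>g\<in>G. \<exists>z. v = g + z"
      then obtain h x where h: "h \<in> G" "v = h + x" by blast
      show "\<exists>g\<in>G - {u}. \<exists>z. v = g + z"
      proof (cases "h = u")
        case True
        then have "v = g + (y + z + x)" using h u(1) g(2) by (simp add: add.assoc)
        then show ?thesis using g(1) \<open>g \<noteq> u\<close> by blast
      qed (use h in blast)
    qed blast
    then show False using min[of "G - {u}"] gen G by auto
  qed
qed

text \<open>The monomials that generate \<^const>\<open>initial_ideal\<close>.\<close>

definition initial_monoms :: "('v::{finite,linorder}, 'k::comm_ring_1) mpoly set \<Rightarrow> 'v monom set" where
  "initial_monoms I = {u. \<exists>f\<in>I. is_initial_monom f u}"

lemma grevlex_less_add: "grevlex_less v u \<Longrightarrow> grevlex_less (z + v) (z + u)"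
  by (auto simp: grevlex_less_def mono_deg_add lookup_add)

lemma initial_monoms_add:
  assumes "u \<in> initial_monoms (ideal_gen X)"
  shows "u + z \<in> initial_monoms (ideal_gen (X :: ('v::{finite,linorder}, 'k::comm_ring_1) mpoly set))"
proof -
  obtain f where f: "f \<in> ideal_gen X" "is_initial_monom f u" using assms by (auto simp: initial_monoms_def)
  have lk: "lookup (of_monom z * f) (z + v) = lookup f v" for v
    unfolding of_monom_def lookup_single_mult by simp
  have "is_initial_monom (of_monom z * f) (z + u)"
    unfolding is_initial_monom_def
  proof (intro conjI ballI impI)
    show "z + u \<in> keys (of_monom z * f)" using f(2) by (simp add: in_keys_iff lk is_initial_monom_def)
    fix w assume w: "w \<in> keys (of_monom z * f)" "w \<noteq> z + u"
    then obtain v where v: "w = z + v"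
      using lookup_single_mult_0[of w z 1 f] by (auto simp: of_monom_def in_keys_iff)
    then have "grevlex_less v u" using f(2) w by (auto simp: is_initial_monom_def in_keys_iff lk)
    then show "grevlex_less w (z + u)" unfolding v by (rule grevlex_less_add)
  qed
  moreover have "of_monom z * f \<in> ideal_gen X" using f(1) by (rule ideal.span_scale)
  ultimately show ?thesis by (auto simp: initial_monoms_def add.commute)
qed

lemma homog_comp_ideal:
  fixes f :: "'i \<Rightarrow> ('v::finite, 'k::field) mpoly"
  assumes f: "f \<in> homogeneous_families d" and p: "p \<in> ideal_gen (range f)"
  shows "homog_comp e p \<in> mp.span (ideal_gens d UNIV e f)"
  using p
proof (induction rule: ideal.span_induct_alt)
  case base
  have "homog_comp e 0 = (0 :: ('v, 'k) mpoly)" by (simp add: homog_comp_def)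
  then show ?case by (simp add: mp.span_zero)
next
  case (step c x y)
  then obtain i where i: "x = f i" by blast
  have fi: "f i \<in> homogeneous (d i)" using f by (simp add: homogeneous_families_def)
  have "homog_comp e (c * f i) \<in> mp.span (ideal_gens d UNIV e f)"
  proof (cases "d i \<le> e")
    case True
    then show ?thesis unfolding homog_comp_mult[OF fi]
      using mult_generator_in_span[OF homog_comp_homogeneous, of "e - d i" d i e UNIV] by simp
  qed (simp add: homog_comp_mult[OF fi] mp.span_zero)
  then show ?case using step by (simp add: homog_comp_add i mp.span_add)
qed

lemma span_ideal_gens_subset_ideal:
  "mp.span (ideal_gens d N e f) \<subseteq> ideal_gen (range (f :: 'i \<Rightarrow> ('v::finite, 'k::field) mpoly))"
proof (rule mp.span_minimal)
  show "ideal_gens d N e f \<subseteq> ideal_gen (range f)"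
    by (auto simp: ideal_gens_def intro: ideal.span_scale ideal.span_base)
  show "mp.subspace (ideal_gen (range f))"
    by (rule mp.subspaceI) (auto simp: smul_def intro: ideal.span_zero ideal.span_add ideal.span_scale)
qed

text \<open>The order refines the degree, so an initial monomial of an element of a homogeneous ideal is one of
its homogeneous component of that degree.\<close>

lemma initial_monoms_homogeneous:
  fixes f :: "'i \<Rightarrow> ('v::{finite,linorder}, 'k::field) mpoly"
  assumes f: "f \<in> homogeneous_families d"
  shows "u \<in> initial_monoms (ideal_gen (range f)) \<longleftrightarrow>
    (\<exists>p\<in>mp.span (ideal_gens d UNIV (mono_deg u) f). is_initial_monom p u)"
proof
  assume "u \<in> initial_monoms (ideal_gen (range f))"
  then obtain p where p: "p \<in> ideal_gen (range f)" "is_initial_monom p u" by (auto simp: initial_monoms_def)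
  then have "is_initial_monom (homog_comp (mono_deg u) p) u"
    unfolding is_initial_monom_def Ball_def in_keys_iff lookup_homog_comp by presburger
  then show "\<exists>p\<in>mp.span (ideal_gens d UNIV (mono_deg u) f). is_initial_monom p u"
    using homog_comp_ideal[OF f p(1)] by blast
qed (unfold initial_monoms_def, use span_ideal_gens_subset_ideal in blast)

lemma UNIV_three: "(UNIV :: 3 set) = {0, 1, 2}"
  using UNIV_3 by auto

lemma less_three: "(0::3) < 1" "(1::3) < 2" "(0::3) < 2"
  by (simp_all add: less_bit1_def bit1.Rep_0 bit1.Rep_1 bit1.Rep_numeral)

section \<open>Three variables: the order, slices and shears\<close>

lemma all_three: "(\<forall>i::3. P i) \<longleftrightarrow> P 0 \<and> P 1 \<and> P 2"
  using UNIV_three by (metis UNIV_I insertE singletonD)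

lemma ex_three: "(\<exists>i::3. P i) \<longleftrightarrow> P 0 \<or> P 1 \<or> P 2"
  using all_three[of "\<lambda>i. \<not> P i"] by blast

lemma distinct_three [simp]:
  "(0::3) \<noteq> 1" "(1::3) \<noteq> 0" "(0::3) \<noteq> 2" "(2::3) \<noteq> 0" "(1::3) \<noteq> 2" "(2::3) \<noteq> 1"
  using less_three by auto

lemma sum_three: "(\<Sum>i\<in>UNIV. g (i::3)) = g 0 + g 1 + (g 2 :: 'a::comm_monoid_add)"
  unfolding UNIV_three by (simp add: add.assoc)

lemma prod_three: "(\<Prod>i\<in>UNIV. g (i::3)) = g 0 * g 1 * (g 2 :: 'a::comm_monoid_mult)"
  unfolding UNIV_three by (simp add: mult.assoc)

lemma mono_deg_three: "mono_deg (u :: 3 monom) = lookup u 0 + lookup u 1 + lookup u 2"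
  by (simp add: mono_deg_def sum_three)

lemma monom_three_eqI:
  assumes "mono_deg u = mono_deg v" "lookup u 1 = lookup v 1" "lookup u 2 = lookup v 2"
  shows "u = (v :: 3 monom)"
proof (rule poly_mapping_eqI)
  have "\<forall>i. lookup u i = lookup v i" using assms unfolding all_three mono_deg_three by simp
  then show "lookup u i = lookup v i" for i by blast
qed

lemma ex_monom_three: "\<exists>w :: 3 monom. lookup w 0 = a \<and> lookup w 1 = b \<and> lookup w 2 = c"
  by (rule exI[of _ "Poly_Mapping.single 0 a + Poly_Mapping.single 1 b + Poly_Mapping.single 2 c"])
    (simp add: lookup_add lookup_single)

lemma grevlex_less_three:
  assumes "mono_deg v = mono_deg u"
  shows "grevlex_less v u \<longleftrightarrow>
    lookup u 2 < lookup v 2 \<or> lookup u 2 = lookup v 2 \<and> lookup u 1 < lookup v (1::3)"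
proof -
  have "\<not> (1::3) < 0" "\<not> (2::3) < 0" "\<not> (2::3) < 1" using less_three by auto
  then show ?thesis using assms unfolding grevlex_less_def ex_three all_three
    by (auto simp: mono_deg_three less_three)
qed

text \<open>The monomials of degree \<open>e\<close> that are at most \<open>x\<^sub>1 ^ (e - c - b) x\<^sub>2 ^ b x\<^sub>3 ^ c\<close>, if \<open>b + c \<le> e\<close>. For \<open>b = 0\<close> these
are the monomials divisible by \<open>x\<^sub>3 ^ c\<close>, and for \<open>b = e - c + 1\<close> those divisible by \<open>x\<^sub>3 ^ (c + 1)\<close>.\<close>

definition revlex_tail :: "nat \<Rightarrow> nat \<Rightarrow> nat \<Rightarrow> (3 monom) set" where
  "revlex_tail e c b = {w. mono_deg w = e \<and> (c < lookup w 2 \<or> c = lookup w 2 \<and> b \<le> lookup w 1)}"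

lemma revlex_tail_0: "revlex_tail e c 0 = {w. mono_deg w = e \<and> c \<le> lookup w 2}"
  by (auto simp: revlex_tail_def)

lemma revlex_tail_mono: "b \<le> b' \<Longrightarrow> revlex_tail e c b' \<subseteq> revlex_tail e c b"
  by (auto simp: revlex_tail_def)

lemma finite_revlex_tail [simp]: "finite (revlex_tail e c b)"
  by (rule finite_subset[OF _ finite_mono_deg_eq[of e]]) (auto simp: revlex_tail_def)

lemma card_revlex_tail:
  assumes "b + c \<le> Suc e"
  shows "card (revlex_tail e c 0) = card (revlex_tail e c b) + b"
proof -
  define B where "B = {w :: 3 monom. mono_deg w = e \<and> lookup w 2 = c \<and> lookup w 1 < b}"
  have "bij_betw (\<lambda>w. lookup w 1) B {..<b}"
  proof (rule bij_betw_imageI)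
    show "inj_on (\<lambda>w. lookup w 1) B"
      by (rule inj_onI, rule monom_three_eqI) (auto simp: B_def)
    have "j \<in> (\<lambda>w. lookup w 1) ` B" if "j < b" for j
    proof -
      obtain w :: "3 monom" where "lookup w 0 = e - c - j" "lookup w 1 = j" "lookup w 2 = c"
        using ex_monom_three by blast
      then have "w \<in> B" "j = lookup w 1" using that assms by (auto simp: B_def mono_deg_three)
      then show ?thesis by blast
    qed
    then show "(\<lambda>w. lookup w 1) ` B = {..<b}" by (auto simp: B_def)
  qed
  then have "card B = b" by (simp add: bij_betw_same_card)
  moreover have "revlex_tail e c 0 = revlex_tail e c b \<union> B" "revlex_tail e c b \<inter> B = {}"
    by (auto simp: revlex_tail_def B_def)
  moreover have "finite B" by (rule finite_subset[OF _ finite_mono_deg_eq[of e]]) (auto simp: B_def)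
  ultimately show ?thesis by (simp add: card_Un_disjoint)
qed

lemma initial_monom_of_sum:
  fixes f :: "3 \<Rightarrow> (3, 'k::field) mpoly"
  assumes f: "f \<in> homogeneous_families d" and v: "mono_deg v = e"
    and eq: "of_monom v = q + s" and q: "q \<in> mp.span (ideal_gens d UNIV e f)" and s: "s \<in> supported M"
    and M: "\<And>w. w \<in> M \<Longrightarrow> grevlex_less w v" "v \<notin> M"
  shows "v \<in> initial_monoms (ideal_gen (range f))"
proof -
  have sz: "lookup s w = 0" if "w \<notin> M" for w using s that by (simp add: supported_iff)
  have lq: "lookup q w = (if w = v then 1 else 0) - lookup s w" for w
    using arg_cong[OF eq, of "\<lambda>p. lookup p w"] by (auto simp: of_monom_def lookup_add lookup_single when_def algebra_simps)
  have "is_initial_monom q v"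
    unfolding is_initial_monom_def in_keys_iff Ball_def lq using sz M by auto
  then show ?thesis using q v unfolding initial_monoms_homogeneous[OF f] by blast
qed

text \<open>The ring homomorphism to \<open>k[x][z]\<close> that sends \<open>x\<^sub>1, x\<^sub>2, x\<^sub>3\<close> to \<open>1, x, z\<close>.\<close>

definition dehom :: "(3, 'k::comm_ring_1) mpoly \<Rightarrow> 'k poly poly" where
  "dehom = subst (\<lambda>c. [:[:c:]:]) (\<lambda>i. if i = 0 then 1 else if i = 1 then [:[:0, 1:]:] else [:0, 1:])"

text \<open>The coefficient of \<open>x\<^sub>3 ^ c\<close>, with \<open>x\<^sub>1 = 1\<close>, as a univariate polynomial in \<open>x\<^sub>2\<close>.\<close>

definition slice :: "nat \<Rightarrow> (3, 'k::comm_ring_1) mpoly \<Rightarrow> 'k poly" where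
  "slice c p = coeff (dehom p) c"

lemma ring_map_const2: "ring_map (\<lambda>c :: 'k::comm_ring_1. [:[:c:]:])"
  by (simp add: ring_map_def one_pCons)

lemma prod_keys_three:
  "(\<Prod>i\<in>keys u. (y i :: 'r::comm_ring_1) ^ lookup u i) = y 0 ^ lookup u 0 * y 1 ^ lookup u 1 * y (2::3) ^ lookup u 2"
  using monom_eval_superset[of UNIV u y] by (simp add: prod_three)

lemma dehom_single: "dehom (Poly_Mapping.single u a) = monom (monom a (lookup u 1)) (lookup u 2)"
  by (simp add: dehom_def subst_single[OF ring_map_const2] prod_keys_three poly_const_pow
      monom_altdef smult_monom mult_ac)

lemma slice_single: "slice c (Poly_Mapping.single u a) = (if lookup u 2 = c then monom a (lookup u 1) else 0)"
  by (simp add: slice_def dehom_single)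

lemma slice_add: "slice c (p + q) = slice c p + slice c q"
  by (simp add: slice_def dehom_def subst_add[OF ring_map_const2])

lemma slice_0 [simp]: "slice c 0 = 0"
  by (simp add: slice_def dehom_def)

lemma slice_smul: "slice c (smul a p) = smult a (slice c p)"
  by (simp add: slice_def dehom_def smul_def subst_mult[OF ring_map_const2] subst_const[OF ring_map_const2])

lemma slice_sum: "slice c (\<Sum>x\<in>A. g x) = (\<Sum>x\<in>A. slice c (g x))"
  by (induction A rule: infinite_finite_induct) (simp_all add: slice_add)

lemma coeff_slice:
  fixes p :: "(3, 'k::field) mpoly"
  assumes "p \<in> homogeneous e" "mono_deg w = e"
  shows "coeff (slice (lookup w 2) p) (lookup w 1) = lookup p w"
  using assms(1)
proof (induction rule: homogeneous_induct)
  case zero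
  then show ?case by simp
next
  case (add a u q)
  have "u = w" if "lookup u 2 = lookup w 2" "lookup u 1 = lookup w 1"
    using that add assms(2) by (intro monom_three_eqI) auto
  then have "coeff (slice (lookup w 2) (of_monom u)) (lookup w 1) = lookup (of_monom u :: (3, 'k) mpoly) w"
    by (auto simp: of_monom_def slice_single lookup_single when_def)
  then show ?case using add by (simp add: slice_add slice_smul lookup_add)
qed

text \<open>The substitution \<open>x\<^sub>2 \<mapsto> x\<^sub>2 + t x\<^sub>1\<close>, which fixes \<open>x\<^sub>1\<close> and \<open>x\<^sub>3\<close>. On slices it is
translation by \<open>t\<close>.\<close>

definition shear :: "'k::comm_ring_1 \<Rightarrow> 3 \<Rightarrow> (3, 'k) mpoly" where
  "shear t i = (if i = 1 then mvar 1 + smul t (mvar 0) else mvar i)"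

lemma slice_shear:
  fixes p :: "(3, 'k::field_char_0) mpoly"
  shows "slice c (msubst (shear t) p) = pcompose (slice c p) [:t, 1:]"
proof (induction p rule: mpoly_induct)
  case zero
  then show ?case by simp
next
  case (add p u a)
  have dm: "dehom (p * q) = dehom p * dehom q" for p q :: "(3, 'k) mpoly"
    by (simp add: dehom_def subst_mult[OF ring_map_const2])
  have dp: "dehom (p ^ n) = dehom p ^ n" for p :: "(3, 'k) mpoly" and n
    by (simp add: dehom_def subst_power[OF ring_map_const2])
  have d0: "dehom (mvar 0 :: (3, 'k) mpoly) = 1" "dehom (mvar 2 :: (3, 'k) mpoly) = [:0, 1:]"
    by (simp_all add: dehom_def subst_mvar[OF ring_map_const2])
  have d1: "dehom (mvar 1 + smul t (mvar 0)) = [:[:t, 1:]:]"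
    by (simp add: dehom_def subst_add[OF ring_map_const2] smul_def subst_mult[OF ring_map_const2]
        subst_mvar[OF ring_map_const2] subst_const[OF ring_map_const2])
  have dc: "dehom (Poly_Mapping.single 0 a) = [:[:a:]:]"
    by (simp add: dehom_def subst_const[OF ring_map_const2])
  have "dehom (msubst (shear t) (Poly_Mapping.single u a)) = monom (smult a ([:t, 1:] ^ lookup u 1)) (lookup u 2)"
    unfolding subst_single[OF ring_map_single_0] prod_keys_three
    by (simp add: shear_def dm dp d0 d1 dc poly_const_pow monom_altdef mult_ac)
  then have "slice c (msubst (shear t) (Poly_Mapping.single u a)) =
      (if lookup u 2 = c then smult a ([:t, 1:] ^ lookup u 1) else 0)"
    by (simp add: slice_def)
  moreover have "pcompose (monom a n) [:t, 1:] = smult a ([:t, 1:] ^ n)" for n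
    by (simp add: poly_eq_poly_eq_iff[symmetric] fun_eq_iff poly_pcompose poly_monom)
  ultimately have "slice c (msubst (shear t) (Poly_Mapping.single u a)) =
      pcompose (slice c (Poly_Mapping.single u a)) [:t, 1:]"
    by (simp add: slice_single)
  then show ?case using add by (simp add: subst_add[OF ring_map_single_0] slice_add pcompose_add)
qed

lemma shear_inverse: "msubst (shear (- t)) (shear t i) = (mvar i :: (3, 'k::field) mpoly)"
proof -
  have "msubst (shear (- t)) (mvar 1 + smul t (mvar 0)) = (mvar 1 :: (3, 'k) mpoly)"
    by (simp add: subst_add[OF ring_map_single_0] msubst_smul subst_mvar[OF ring_map_single_0] shear_def)
  then show ?thesis by (simp add: shear_def[of t] subst_mvar[OF ring_map_single_0]) (simp add: shear_def)
qed

lemma shear_homogeneous: "(shear t i :: (3, 'k::field) mpoly) \<in> homogeneous 1"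
  unfolding shear_def using mvar_homogeneous
  by (auto intro!: mp.subspace_add[OF subspace_homogeneous] mp.subspace_scale[OF subspace_homogeneous])

lemma supported_revlex_tail_0:
  "supported (revlex_tail (j + c) c 0) = {mvar 2 ^ c * y | y :: (3, 'k::field) mpoly. y \<in> homogeneous j}"
  using span_ideal_gens_Un_mvar_power[of undefined "{}" j c "undefined :: 3 \<Rightarrow> (3, 'k) mpoly" 2]
  by (simp add: ideal_gens_def span_of_monom revlex_tail_0)

lemma msubst_shear_revlex_tail:
  "c \<le> e \<Longrightarrow> msubst (shear t) ` supported (revlex_tail e c 0) = (supported (revlex_tail e c 0) :: (3, 'k::field) mpoly set)"
proof -
  assume "c \<le> e"
  then obtain j where e: "e = j + c" by (metis le_add_diff_inverse2)
  have "msubst (shear t) (mvar 2 ^ c * y) = mvar 2 ^ c * msubst (shear t) y" for y :: "(3, 'k) mpoly"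
    by (simp add: subst_mult[OF ring_map_single_0] subst_power[OF ring_map_single_0] subst_mvar[OF ring_map_single_0] shear_def)
  moreover have "msubst (shear t) ` homogeneous j = (homogeneous j :: (3, 'k) mpoly set)"
    by (rule msubst_homogeneous_image[where y = "shear (- t)", OF shear_homogeneous shear_homogeneous])
      (use shear_inverse[of "- t"] in simp)
  moreover have "{mvar 2 ^ c * y | y :: (3, 'k) mpoly. y \<in> A} = (\<lambda>y. mvar 2 ^ c * y) ` A" for A
    by blast
  ultimately show ?thesis unfolding e supported_revlex_tail_0
    by (simp add: image_image) (simp flip: image_image)
qed

section \<open>Initial ideals of families with maximal ranks\<close>

text \<open>Let \<open>W b\<close> be the span of the tail \<^term>\<open>revlex_tail e c b\<close>, let \<open>n = e - c + 1\<close>, and let \<open>k\<close> be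
the dimension of \<open>Q \<inter> W 0\<close> modulo \<open>Q \<inter> W n\<close>. The core of the proof is \<open>Q + W k = Q + W 0\<close>. It says that each
of \<open>x\<^sub>1 ^ (e - c - j) x\<^sub>2 ^ j x\<^sub>3 ^ c\<close> with \<open>j < k\<close> is an initial monomial of \<open>Q\<close>, and by a
dimension count no others with the same exponent of \<open>x\<^sub>3\<close> are.\<close>

lemma initial_monoms_stable:
  fixes f :: "3 \<Rightarrow> (3, 'k::field_char_0) mpoly"
  assumes f: "f \<in> homogeneous_families d" and m: "ranks_maximal d D f" and e: "e \<le> D"
    and u: "u \<in> initial_monoms (ideal_gen (range f))" "mono_deg u = e"
    and v: "mono_deg v = e" "lookup v 2 = lookup u 2" "lookup v 1 < lookup u 1"
  shows "v \<in> initial_monoms (ideal_gen (range f))"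
proof -
  define c where "c = lookup u 2"
  define n where "n = Suc e - c"
  have ce: "c + lookup u 1 \<le> e" using u(2) by (simp add: c_def mono_deg_three)
  then have nc: "n + c = Suc e" by (simp add: n_def)
  let ?W = "\<lambda>b. supported (revlex_tail e c b) :: (3, 'k) mpoly set"
  define Q where "Q = mp.span (ideal_gens d UNIV e f)"
  have Qs: "mp.subspace Q" and Qf: "mp.fin_dim Q"
    unfolding Q_def by (auto intro: fin_dim_ideal_gens)
  have Ws: "mp.subspace (?W b)" and Wf: "mp.fin_dim (?W b)" for b
    by (auto intro: subspace_supported fin_dim_supported)
  have Whom: "?W b \<subseteq> homogeneous e" for b
    unfolding homogeneous_supported by (rule supported_mono) (auto simp: revlex_tail_def)
  have Wmono: "?W b' \<subseteq> ?W b" if "b \<le> b'" for b b'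
    by (rule supported_mono[OF revlex_tail_mono[OF that]])
  have cardW: "mp.dim (?W 0) = mp.dim (?W b) + b" if "b \<le> n" for b
    using card_revlex_tail[of b c e] that nc by (simp add: dim_supported)
  let ?V = "\<lambda>b. Q \<inter> ?W b"
  have Vs: "mp.subspace (?V b)" and Vf: "mp.fin_dim (?V b)" for b
    by (auto intro: mp.subspace_inter Qs Ws mp.fin_dim_subset[OF Qf])
  obtain A where A: "finite A" "A \<subseteq> ?V n" "mp.independent A" "mp.span A = ?V n" "card A = mp.dim (?V n)"
    using mp.fin_dim_basis[OF Vf Vs] by blast
  obtain B where B: "A \<subseteq> B" "B \<subseteq> ?V 0" "mp.independent B" "?V 0 \<subseteq> mp.span B"
    using mp.maximal_independent_subset_extend[of A "?V 0"] A Wmono[of 0 n] by blast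
  have fB: "finite B" using mp.fin_dim_independent[OF Vf B(3,2)] by blast
  have cB: "card B = mp.dim (?V 0)" using B by (intro mp.basis_card_eq_dim)
  \<comment> \<open>The set \<open>C\<close> is a basis of a complement of \<open>Q \<inter> W n\<close> in \<open>Q \<inter> W 0\<close>.\<close>
  define C where "C = B - A"
  define k where "k = card C"
  have fC: "finite C" using fB by (simp add: C_def)
  have CV: "C \<subseteq> ?V 0" using B(2) by (auto simp: C_def)
  have dimV: "mp.dim (?V 0) = mp.dim (?V n) + k"
    using card_Diff_subset[OF A(1) B(1)] card_mono[OF fB B(1)] cB A(5) by (simp add: k_def C_def)
  have kn: "k \<le> n"
  proof -
    have "mp.dim {x + y | x y. x \<in> ?V 0 \<and> y \<in> ?W n} + mp.dim (?V 0 \<inter> ?W n) = mp.dim (?V 0) + mp.dim (?W n)"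
      by (rule mp.dim_sum_inter[OF Vs Vf Ws Wf])
    moreover have "?V 0 \<inter> ?W n = ?V n" using Wmono[of 0 n] by blast
    moreover have "mp.dim {x + y | x y. x \<in> ?V 0 \<and> y \<in> ?W n} \<le> mp.dim (?W 0)"
      using Wmono[of 0 n] by (intro mp.fin_dim_dim_mono[OF Wf]) (auto intro: mp.subspace_add[OF Ws])
    ultimately show ?thesis using dimV cardW[of n] by simp
  qed
  have slice_dvd: "monom 1 k dvd slice c p" if "p \<in> ?W k" for p
    unfolding monom_1_dvd_iff'
  proof (intro allI impI)
    fix j assume j: "j < k"
    obtain w :: "3 monom" where w: "lookup w 0 = e - c - j" "lookup w 1 = j" "lookup w 2 = c"
      using ex_monom_three by blast
    have "mono_deg w = e" using w j kn nc by (simp add: mono_deg_three)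
    then have "coeff (slice c p) j = lookup p w" using coeff_slice[of p e w] that Whom w by auto
    then show "coeff (slice c p) j = 0"
      using that w j by (simp add: supported_iff revlex_tail_def)
  qed
  have slice_zero: "p \<in> ?W n" if "p \<in> ?W 0" "slice c p = 0" for p
    unfolding supported_iff
  proof (intro allI impI)
    fix w assume w: "w \<notin> revlex_tail e c n"
    show "lookup p w = 0"
    proof (cases "w \<in> revlex_tail e c 0")
      case True
      then have "mono_deg w = e" "lookup w 2 = c" using w by (auto simp: revlex_tail_def)
      then show ?thesis using coeff_slice[of p e w] that Whom by auto
    qed (use that(1) in \<open>simp add: supported_iff\<close>)
  qed
  have spanC: "mp.span C \<subseteq> ?V 0" by (rule mp.span_minimal[OF CV Vs])
  have indep: "\<forall>x\<in>C. a x = 0" if "(\<Sum>x\<in>C. smult (a x) (slice c x)) = 0" for a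
  proof -
    let ?p = "\<Sum>x\<in>C. smul (a x) x"
    have p: "?p \<in> mp.span C" by (intro mp.span_sum mp.span_scale mp.span_base)
    have "slice c ?p = 0" using that by (simp add: slice_sum slice_smul)
    then have "?p \<in> mp.span A" using p spanC slice_zero unfolding A(4) by blast
    then obtain b where b: "?p = (\<Sum>x\<in>A. smul (b x) x)" unfolding mp.span_finite[OF A(1)] by blast
    have "(\<Sum>x\<in>B. smul (if x \<in> A then - b x else a x) x) =
        (\<Sum>x\<in>C. smul (a x) x) + (\<Sum>x\<in>A. smul (- b x) x)"
    proof -
      have "(\<Sum>x\<in>B. smul (if x \<in> A then - b x else a x) x) =
        (\<Sum>x\<in>C. smul (if x \<in> A then - b x else a x) x) + (\<Sum>x\<in>A. smul (if x \<in> A then - b x else a x) x)"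
        unfolding C_def by (rule sum.subset_diff[OF B(1) fB])
      then show ?thesis by (simp add: C_def)
    qed
    also have "\<dots> = 0" using b by (simp add: sum_negf)
    finally have "(\<Sum>x\<in>B. smul (if x \<in> A then - b x else a x) x) = 0" .
    from mp.independentD[OF B(3) fB order_refl this]
    have "(if x \<in> A then - b x else a x) = 0" if "x \<in> B" for x using that by blast
    then show ?thesis unfolding C_def by (metis DiffD1 DiffD2)
  qed
  have "finite {t. \<exists>a. (\<exists>x\<in>C. a x \<noteq> 0) \<and> [:- t, 1:] ^ card C dvd (\<Sum>x\<in>C. smult (a x) (slice c x))}"
    by (rule finite_excess_vanishing[OF fC indep])
  from ex_new_if_finite[OF infinite_UNIV_char_0 this] obtain t
    where "\<nexists>a. (\<exists>x\<in>C. a x \<noteq> 0) \<and> [:- t, 1:] ^ card C dvd (\<Sum>x\<in>C. smult (a x) (slice c x))"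
    by (elim exE) simp
  then have t: "\<forall>x\<in>C. a x = 0" if "[:- t, 1:] ^ k dvd (\<Sum>x\<in>C. smult (a x) (slice c x))" for a
    using that unfolding k_def by blast
  define g where "g = msubst (shear t)"
  interpret g: Vector_Spaces.linear smul smul g unfolding g_def by (rule linear_msubst)
  have gW: "g ` ?W 0 = ?W 0"
    unfolding g_def by (rule msubst_shear_revlex_tail) (use ce in simp)
  have sh: "msubst (shear (- t)) (shear t i) = (mvar i :: (3, 'k) mpoly)"
    "msubst (shear t) (shear (- t) i) = (mvar i :: (3, 'k) mpoly)" for i
    using shear_inverse[of t] shear_inverse[of "- t"] by simp_all
  have g_inj: "inj_on g M" for M
    unfolding g_def by (rule inj_on_inverseI[of _ "msubst (shear (- t))"]) (rule msubst_inverse[OF sh(1)])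
  \<comment> \<open>An element of the sheared complement in \<open>W k\<close> would have a slice vanishing to order \<open>k\<close>.\<close>
  have trivial: "{p \<in> mp.span C. g p \<in> ?W k} = {0}"
  proof (intro equalityI subsetI)
    fix p assume p: "p \<in> {p \<in> mp.span C. g p \<in> ?W k}"
    then obtain a where a: "p = (\<Sum>x\<in>C. smul (a x) x)" unfolding mp.span_finite[OF fC] by blast
    have "monom 1 k dvd slice c (g p)" using p slice_dvd by blast
    then obtain s where "pcompose (slice c p) [:t, 1:] = monom 1 k * s"
      unfolding g_def slice_shear by (rule dvdE)
    then have "pcompose (pcompose (slice c p) [:t, 1:]) [:- t, 1:] = pcompose (monom 1 k * s) [:- t, 1:]" by simp
    then have "slice c p = [:- t, 1:] ^ k * pcompose s [:- t, 1:]"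
      by (simp add: poly_eq_poly_eq_iff[symmetric] fun_eq_iff poly_pcompose poly_monom)
    then have "\<forall>x\<in>C. a x = 0" by (intro t) (simp add: a slice_sum slice_smul)
    then show "p \<in> {0}" by (simp add: a)
  qed (auto simp: mp.span_zero mp.subspace_0[OF Ws] g.zero)
  have dimC: "mp.dim (mp.span C) = k"
    unfolding k_def by (rule mp.dim_span_eq_card_independent)
      (rule mp.independent_mono[OF B(3)], simp add: C_def)
  have dim0: "mp.dim ({0} :: (3, 'k) mpoly set) = 0"
    using mp.dim_span_eq_card_independent[OF mp.independent_empty] by simp
  have full: "{x + g y | x y. x \<in> ?W k \<and> y \<in> mp.span C} = ?W 0"
  proof (rule mp.fin_dim_subspace_eq[OF Wf _ Ws])
    show "mp.subspace {x + g y | x y. x \<in> ?W k \<and> y \<in> mp.span C}"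
      by (rule mp.subspace_sum_image[OF g.linear_axioms Ws mp.subspace_span])
    show "{x + g y | x y. x \<in> ?W k \<and> y \<in> mp.span C} \<subseteq> ?W 0"
    proof safe
      fix x y assume "x \<in> ?W k" "y \<in> mp.span C"
      then have "x \<in> ?W 0" "g y \<in> ?W 0" using Wmono[of 0 k] spanC gW by blast+
      then show "x + g y \<in> ?W 0" by (rule mp.subspace_add[OF Ws])
    qed
    have "mp.dim {x + g y | x y. x \<in> ?W k \<and> y \<in> mp.span C} + mp.dim {p \<in> mp.span C. g p \<in> ?W k}
        = mp.dim (?W k) + mp.dim (mp.span C)"
      by (rule mp.dim_sum_image[OF g.linear_axioms Ws Wf mp.subspace_span mp.fin_dim_span[OF fC]])
    then show "mp.dim (?W 0) \<le> mp.dim {x + g y | x y. x \<in> ?W k \<and> y \<in> mp.span C}"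
      unfolding trivial dim0 dimC using cardW[OF kn] by simp
  qed
  define plus where "plus X Y = {x + y | x y. x \<in> X \<and> y \<in> Y}" for X Y :: "(3, 'k) mpoly set"
  have plus_sub: "plus X Y \<subseteq> plus X' Y'" if "X \<subseteq> X'" "Y \<subseteq> Y'" for X X' Y Y'
    using that unfolding plus_def by blast
  define h where "h i = msubst (shear t) (f i)" for i
  have h: "h \<in> homogeneous_families d"
    using f msubst_homogeneous[where y = "shear t", OF shear_homogeneous] by (auto simp: homogeneous_families_def h_def)
  have Qh: "mp.span (ideal_gens d UNIV e h) = g ` Q"
    unfolding h_def g_def Q_def
    by (rule span_ideal_gens_msubst[where y = "shear (- t)" and z = "shear t", OF shear_homogeneous shear_homogeneous sh])
  have gplus: "g ` plus Q (?W 0) \<subseteq> plus (g ` Q) (?W k)"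
  proof
    fix p assume "p \<in> g ` plus Q (?W 0)"
    then obtain q w where p: "p = g q + g w" "q \<in> Q" "w \<in> ?W 0"
      unfolding plus_def by (auto simp: g.add)
    have "g w \<in> ?W 0" using gW p(3) by blast
    then obtain x y where xy: "g w = x + g y" "x \<in> ?W k" "y \<in> mp.span C" unfolding full[symmetric] by blast
    have "p = g (q + y) + x" using p(1) xy(1) by (simp add: g.add algebra_simps)
    moreover have "q + y \<in> Q" using p(2) xy(3) spanC by (intro mp.subspace_add[OF Qs]) auto
    ultimately show "p \<in> plus (g ` Q) (?W k)" using xy(2) unfolding plus_def by blast
  qed
  have plus_s: "mp.subspace (plus Q (?W b))" for b
    unfolding plus_def by (rule mp.subspace_sums[OF Qs Ws])
  have span_plus: "mp.span (ideal_gens d UNIV e f' \<union> of_monom ` revlex_tail e c b) = plus (mp.span (ideal_gens d UNIV e f')) (?W b)"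
    for f' :: "3 \<Rightarrow> (3, 'k) mpoly" and b
    unfolding mp.span_Un span_of_monom plus_def ..
  have plus_f: "mp.fin_dim (plus (mp.span (ideal_gens d UNIV e f')) (?W b))" for f' :: "3 \<Rightarrow> (3, 'k) mpoly" and b
    unfolding span_plus[symmetric] by (intro mp.fin_dim_span finite_UnI finite_ideal_gens finite_imageI finite_revlex_tail)
  \<comment> \<open>Maximality against the sheared family: the dimension of \<open>Q + W k\<close> is at least that of
    \<open>g Q + W k\<close>, which contains \<open>g (Q + W 0)\<close>.\<close>
  have "rank_with d UNIV e (revlex_tail e c k) h \<le> rank_with d UNIV e (revlex_tail e c k) f"
    by (rule ranks_maximalD[OF m h e]) (auto simp: revlex_tail_def)
  then have "mp.dim (plus (g ` Q) (?W k)) \<le> mp.dim (plus Q (?W k))"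
    unfolding span_plus Qh Q_def[symmetric] .
  moreover have "mp.dim (plus Q (?W 0)) = mp.dim (g ` plus Q (?W 0))"
    using mp.dim_image_inj[OF g.linear_axioms g_inj plus_s] plus_f[of f 0] by (simp add: Q_def)
  moreover have "mp.dim (g ` plus Q (?W 0)) \<le> mp.dim (plus (g ` Q) (?W k))"
    using mp.fin_dim_dim_mono[OF _ gplus] plus_f[of h k] by (simp add: Qh)
  ultimately have plus_eq: "plus Q (?W k) = plus Q (?W 0)"
    using plus_f[of f 0] plus_s plus_sub[OF order_refl Wmono[of 0 k]]
    by (intro mp.fin_dim_subspace_eq) (auto simp: Q_def)
  have inter: "mp.dim (plus Q (?W b)) + mp.dim (?V b) = mp.dim Q + mp.dim (?W b)" for b
    unfolding plus_def by (rule mp.dim_sum_inter[OF Qs Qf Ws Wf])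
  have "?V n = ?V k"
  proof (rule mp.fin_dim_subspace_eq[OF Vf Vs Vs])
    show "?V n \<subseteq> ?V k" using Wmono[OF kn] by blast
    show "mp.dim (?V k) \<le> mp.dim (?V n)"
      using inter[of k] inter[of 0] plus_eq dimV cardW[OF kn] by simp
  qed
  obtain p where p: "p \<in> Q" "is_initial_monom p u"
    using u unfolding initial_monoms_homogeneous[OF f] Q_def by blast
  have pW: "p \<in> ?W (lookup u 1)"
    unfolding supported_iff
  proof (intro allI impI, rule ccontr)
    fix w assume w: "w \<notin> revlex_tail e c (lookup u 1)" "lookup p w \<noteq> 0"
    have we: "mono_deg w = e"
      using w(2) p(1) span_ideal_gens_homogeneous[OF f] homogeneousD unfolding Q_def by blast
    have "w = u \<or> grevlex_less w u" using p(2) w(2) by (auto simp: is_initial_monom_def in_keys_iff)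
    then show False using w(1) we u(2) by (auto simp: revlex_tail_def grevlex_less_three c_def)
  qed
  \<comment> \<open>Since \<open>Q \<inter> W k\<close> is contained in \<open>W n\<close>, a polynomial of \<open>Q\<close> in \<open>W k\<close> has no monomial whose
    exponent of \<open>x\<^sub>3\<close> is \<open>c\<close>.\<close>
  have "lookup u 1 < k"
  proof (rule ccontr)
    assume "\<not> lookup u 1 < k"
    then have "p \<in> ?V n" using \<open>?V n = ?V k\<close> p(1) pW Wmono[of k "lookup u 1"] by auto
    moreover have "lookup p u \<noteq> 0" using p(2) by (simp add: is_initial_monom_def in_keys_iff)
    ultimately have "u \<in> revlex_tail e c n" by (auto simp: supported_iff)
    then show False using ce nc by (simp add: revlex_tail_def c_def)
  qed
  have "of_monom v \<in> ?W 0" using v by (simp add: revlex_tail_0 c_def)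
  moreover have "?W 0 \<subseteq> plus Q (?W 0)"
    using mp.subspace_0[OF Qs] unfolding plus_def by force
  ultimately have "of_monom v \<in> plus Q (?W k)" unfolding plus_eq by blast
  then obtain q s where "of_monom v = q + s" "q \<in> Q" "s \<in> ?W k" unfolding plus_def by blast
  then show ?thesis
  proof (intro initial_monom_of_sum[OF f v(1)])
    fix w assume "w \<in> revlex_tail e c k"
    then show "grevlex_less w v"
      using v \<open>lookup u 1 < k\<close> by (auto simp: revlex_tail_def grevlex_less_three c_def)
  next
    show "v \<notin> revlex_tail e c k" using v \<open>lookup u 1 < k\<close> by (simp add: revlex_tail_def c_def)
  qed (auto simp: Q_def)
qed

lemma homogeneous_in_ideal_above:
  fixes f :: "'v::finite \<Rightarrow> ('v, 'k::field) mpoly"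
  assumes "homogeneous e \<subseteq> mp.span (ideal_gens d N e f)" "e \<le> n"
  shows "homogeneous n \<subseteq> mp.span (ideal_gens d N n f)"
  using assms(2)
proof (induction n rule: dec_induct)
  case base
  then show ?case by (rule assms(1))
next
  case (step n)
  have "of_monom w \<in> mp.span (ideal_gens d N (Suc n) f)" if w: "mono_deg w = Suc n" for w
  proof -
    have "\<exists>i. lookup w i > 0" using w unfolding mono_deg_def by (metis neq0_conv sum.neutral nat.distinct(1))
    then obtain i where i: "lookup w i > 0" ..
    define z where "z = w - Poly_Mapping.single i 1"
    have "mono_deg z = n" using mono_deg_minus_single[OF i] w by (simp add: z_def)
    then have "of_monom z \<in> mp.span (ideal_gens d N n f)" using step.IH by auto
    from mult_in_span_ideal_gens[OF this mvar_homogeneous, of i]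
    have span: "mvar i * of_monom z \<in> mp.span (ideal_gens d N (Suc n) f)" by simp
    have "w = Poly_Mapping.single i 1 + z"
      using minus_single_plus_single[OF i] by (simp add: z_def add.commute)
    then have "mvar i * of_monom z = (of_monom w :: ('v, 'k) mpoly)"
      by (simp only: mvar_def of_monom_mult)
    then show ?thesis using span by simp
  qed
  then show ?case unfolding homogeneous_span[of "Suc n"] by (intro mp.span_minimal mp.subspace_span) auto
qed

lemma ranks_maximal_imp_almost_revlex:
  fixes f :: "3 \<Rightarrow> (3, 'k::field_char_0) mpoly"
  assumes d: "\<And>i. d i > 0" and f: "f \<in> homogeneous_families d"
    and m: "ranks_maximal d (Suc (\<Sum>i\<in>UNIV. d i - 1)) f"
  shows "almost_revlex_ideal (initial_ideal (ideal_gen (range f)))"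
proof -
  define N where "N = (\<Sum>i\<in>UNIV. d i - 1)"
  let ?M = "initial_monoms (ideal_gen (range f))"
  let ?J = "initial_ideal (ideal_gen (range f))"
  have J: "?J = ideal_gen (of_monom ` ?M)" by (simp add: initial_ideal_def initial_monoms_def)
  note m' = m[folded N_def]
  have high: "v \<in> ?M" if "N < mono_deg v" for v
  proof -
    have top: "mp.span (ideal_gens d UNIV (Suc N) f) = homogeneous (Suc N)"
      by (rule generic_ideal_high_degree[where d = d, OF d f m']) (simp_all add: N_def)
    have "homogeneous (mono_deg v) \<subseteq> mp.span (ideal_gens d UNIV (mono_deg v) f)"
      by (rule homogeneous_in_ideal_above[OF equalityD2[OF top] Suc_leI[OF that]])
    moreover have "(of_monom v :: (3, 'k) mpoly) \<in> homogeneous (mono_deg v)" by simp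
    moreover have "is_initial_monom (of_monom v :: (3, 'k) mpoly) v"
      by (simp add: is_initial_monom_def of_monom_def)
    ultimately show ?thesis unfolding initial_monoms_homogeneous[OF f] by blast
  qed
  have main: "v \<in> ?M" if min: "minimal_monom_gen ?J u" and deg: "mono_deg v = mono_deg u" and less: "grevlex_less u v"
    for u v
  proof -
    define e where "e = mono_deg u"
    have uM: "u \<in> ?M"
      by (rule minimal_monom_gen_ideal(1)[OF min[unfolded J] initial_monoms_add])
    have umin: "z = 0" if "u = w + z" "w \<in> ?M" for w z
      by (rule minimal_monom_gen_ideal(2)[OF min[unfolded J] initial_monoms_add that])
    consider "N < e" | "e \<le> N" "lookup v 2 < lookup u 2"
      | "e \<le> N" "lookup v 2 = lookup u 2" "lookup v 1 < lookup u 1"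
      using less deg by (force simp: grevlex_less_three)
    then show ?thesis
    proof cases
      case 1
      then show ?thesis using high deg by (simp add: e_def)
    next
      case 3
      then show ?thesis
        using initial_monoms_stable[OF f m' _ uM refl deg] by (simp add: e_def)
    next
      case 2
      define c where "c = lookup u 2"
      define j where "j = e - c"
      have ej: "e = j + c" by (simp add: j_def e_def c_def mono_deg_three)
      have jc: "j + c \<le> Suc N" using 2(1) ej by simp
      obtain p where p: "p \<in> mp.span (ideal_gens d UNIV e f)" "is_initial_monom p u"
        using uM unfolding initial_monoms_homogeneous[OF f] e_def by blast
      have "p \<in> supported (revlex_tail (j + c) c 0)"
        unfolding supported_iff
      proof (intro allI impI, rule ccontr)
        fix w assume w: "w \<notin> revlex_tail (j + c) c 0" "lookup p w \<noteq> 0"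
        have we: "mono_deg w = e"
          using w(2) p(1) span_ideal_gens_homogeneous[OF f] homogeneousD by blast
        have "w = u \<or> grevlex_less w u" using p(2) w(2) by (auto simp: is_initial_monom_def in_keys_iff)
        then show False using w(1) we unfolding ej[symmetric]
          by (auto simp: revlex_tail_0 grevlex_less_three c_def e_def)
      qed
      then obtain g where g: "p = mvar 2 ^ c * g" "g \<in> homogeneous j"
        unfolding supported_revlex_tail_0 by blast
      obtain z where z: "u = Poly_Mapping.single 2 c + z"
        using monom_dvd_iff[of u "Poly_Mapping.single 2 c"] by (auto simp: c_def lookup_single when_def)
      have zj: "mono_deg z = j" using ej unfolding e_def z by (simp add: mono_deg_add)
      have lg: "lookup g w = lookup p (Poly_Mapping.single 2 c + w)" for w
        unfolding g(1) mvar_power of_monom_def lookup_single_mult by simp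
      have "is_initial_monom g z"
        unfolding is_initial_monom_def
      proof (intro conjI ballI impI)
        show "z \<in> keys g" using p(2) by (simp add: in_keys_iff lg z is_initial_monom_def)
        fix w assume w: "w \<in> keys g" "w \<noteq> z"
        then have "mono_deg w = j" using g(2) by (auto simp: homogeneous_def)
        moreover have "grevlex_less (Poly_Mapping.single 2 c + w) (Poly_Mapping.single 2 c + z)"
          using p(2) w by (simp add: is_initial_monom_def in_keys_iff lg z)
        ultimately show "grevlex_less w z"
          using zj by (simp add: grevlex_less_three mono_deg_add lookup_add)
      qed
      moreover have "z \<notin> ?M"
      proof
        assume "z \<in> ?M"
        then have "Poly_Mapping.single (2::3) c = 0"
          using umin[of z "Poly_Mapping.single 2 c"] z by (simp add: add.commute)
        then have "c = 0" using mono_deg_single[of "2::3" c] by simp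
        then show False using 2(2) by (simp add: c_def)
      qed
      ultimately have gQ: "g \<notin> mp.span (ideal_gens d UNIV j f)"
        unfolding initial_monoms_homogeneous[OF f] zj by blast
      have "N \<le> 2 * j + c"
      proof (rule ccontr)
        assume "\<not> N \<le> 2 * j + c"
        then have "2 * j + c \<le> (\<Sum>i\<in>UNIV. d i - 1)" by (simp add: N_def)
        from generic_lefschetz(1)[where d = d, OF d f m' jc this g(2)] show False
          using gQ p(1) unfolding g(1) ej by blast
      qed
      then have "{x + mvar 2 ^ c * y | x y. x \<in> mp.span (ideal_gens d UNIV (j + c) f) \<and> y \<in> homogeneous j}
          = homogeneous (j + c)"
        using generic_lefschetz(2)[where d = d, OF d f m' jc] by (simp add: N_def)
      moreover have "(of_monom v :: (3, 'k) mpoly) \<in> homogeneous (j + c)" using deg ej by (simp add: e_def)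
      ultimately obtain x y where xy: "of_monom v = x + mvar 2 ^ c * y"
        "x \<in> mp.span (ideal_gens d UNIV e f)" "y \<in> homogeneous j" unfolding ej by blast
      have "mvar 2 ^ c * y \<in> supported (revlex_tail e c 0)"
        unfolding ej supported_revlex_tail_0 using xy(3) by blast
      then show ?thesis
        using xy(1,2) deg 2(2)
        by (intro initial_monom_of_sum[OF f, of v e x "mvar 2 ^ c * y" "revlex_tail e c 0"])
          (auto simp: e_def c_def revlex_tail_0 grevlex_less_three)
    qed
  qed
  show ?thesis unfolding almost_revlex_ideal_def
  proof (intro conjI allI impI)
    show "\<exists>G. monom_gens G ?J" unfolding J monom_gens_def by blast
    fix u v assume "minimal_monom_gen ?J u \<and> mono_deg v = mono_deg u \<and> grevlex_less u v"
    then have "v \<in> ?M" using main by blast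
    then show "of_monom v \<in> ?J" unfolding J by (intro ideal.span_base imageI)
  qed
qed

theorem theorem2p1p2:
  fixes d :: "3 \<Rightarrow> nat"
  assumes "\<And>i. d i > 0"
  shows "\<exists>U :: (3 \<Rightarrow> (3, 'k::field_char_0) mpoly) set.
           zariski_open_in (homogeneous_families d) U \<and> U \<noteq> {} \<and>
           (\<forall>f\<in>U. almost_revlex_ideal (initial_ideal (ideal_gen (range f))))"
proof -
  obtain U :: "(3 \<Rightarrow> (3, 'k) mpoly) set" where U: "zariski_open_in (homogeneous_families d) U" "U \<noteq> {}"
    "\<forall>f\<in>U. ranks_maximal d (Suc (\<Sum>i\<in>UNIV. d i - 1)) f"
    using generic_ranks_maximal by blast
  have "almost_revlex_ideal (initial_ideal (ideal_gen (range f)))" if "f \<in> U" for f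
  proof (rule ranks_maximal_imp_almost_revlex[where d = d])
    show "f \<in> homogeneous_families d" using U(1) that unfolding zariski_open_in_def by blast
  qed (use assms U(3) that in auto)
  then show ?thesis using U(1,2) by blast
qed

end
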